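(* Let $m=m(u)$ be an arbitrary (smooth) non-increasing function of $u$, write $m'=\frac{dm}{du}$, and consider, in the coordinates $(x^1,x^2,x^3,x^4)=(u,r,\theta,\phi)$ with $r>0$, the Vaidya metric $$g=-\left(1-\frac{2m(u)}{r}\right)du^2-2\,dr\,du+r^2\left(d\theta^2+\sin^2\theta\,d\phi^2\right).$$ Let $R,S,\kappa$ be its Riemann-Christoffel curvature tensor, Ricci tensor and scalar curvature, and let $P,K,W,C$ be its projective, conharmonic, concircular and conformal curvature tensors (conventions as in the context). The Vaidya metric possesses the following curvature properties: (i) It is neither Ricci flat nor Ricci symmetric, but its scalar curvature is zero, and hence $R=W$ and $C=K$. (ii) It is neither conformally semisymmetric nor Deszcz pseudosymmetric, but $C\cdot C=\frac{m}{r^3}Q(g,C)$. (iii) It is neither Ricci generalized pseudosymmetric nor Weyl pseudosymmetric, but it satisfies the pseudosymmetric type conditions $$R\cdot R-Q(S,R)=\frac{m}{r^3}Q(g,C)\quad\text{and}\quad R\cdot C+C\cdot R=\frac{2m}{r^3}Q(g,C)+Q(S,C).$$ (iv) It is not conformally recurrent, and neither the curvature 2-forms $\Omega^{\,k}_{(R)l}$ nor the Ricci 1-forms $\Lambda_{(S)l}$ are recurrent, but the conformal 2-forms $\Omega^{\,k}_{(C)l}$ are recurrent for the 1-form $\Pi=\left\{\frac{m'}{m},0,0,0\right\}$ (that is, $\Pi=\frac{m'}{m}\,du$). (v) It is not Einstein, but it is Ricci simple: $S=\beta\,(\eta\otimes\eta)$, where $\beta=2m'$ and $\eta=\left\{\frac1r,0,0,0\right\}$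 (that is, $\eta=\frac1r\,du$), with $\|\eta\|=0$. Hence $S\wedge S=0$ (Kulkarni-Nomizu product) and $S^2=0$. (vi) Its Ricci tensor is neither cyclic parallel nor of Codazzi type, but it is Riemann compatible ($R$-compatible) as well as Weyl compatible ($C$-compatible). (vii) The general form of the compatible tensors for $R$ and $P$ is given by $$\left(\begin{array}{cccc} a_{11}&a_{12}&0&0\\ a_{12}+\frac{r m'}{m}a_{22}&a_{22}&0&0\\ 0&0&a_{33}&a_{43}\\ 0&0&a_{43}&a_{44}\end{array}\right),$$ where the $a_{ij}$ are arbitrary scalars. (viii) The general form of the compatible tensors for $C$ and $K$ is given by $$\left(\begin{array}{cccc} a_{11}&a_{12}&0&0\\ a_{12}&a_{22}&0&0\\ 0&0&a_{33}&a_{34}\\ 0&0&a_{34}&a_{44}\end{array}\right),$$ where the $a_{ij}$ are arbitrary scalars.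
   Context: Here $n=\dim M=4$, $\nabla$ is the Levi-Civita connection, "scalar" means smooth function, and $X,Y,X_1,X_2,\dots$ are vector fields. A 1-form $\{p_1,p_2,p_3,p_4\}$ means $p_i\,dx^i$ in the coordinates $(x^1,x^2,x^3,x^4)=(u,r,\theta,\phi)$. Curvature sign convention: $\mathcal R(X,Y)Z=\nabla_{[X,Y]}Z-\nabla_X\nabla_YZ+\nabla_Y\nabla_XZ$, $R(X_1,X_2,X_3,X_4)=g(\mathcal R(X_1,X_2)X_3,X_4)$, $S_{jk}=g^{il}R_{ijkl}$, $\kappa=g^{jk}S_{jk}$. With this convention, for the Vaidya metric, $R_{1212}=-\frac{2m}{r^3}$, $R_{3434}=2mr\sin^2\theta$ and $S_{11}=\frac{2m'}{r^2}$. Kulkarni-Nomizu product of symmetric $(0,2)$-tensors $A,E$: $(A\wedge E)(X_1,X_2,X_3,X_4)=A(X_1,X_4)E(X_2,X_3)+A(X_2,X_3)E(X_1,X_4)-A(X_1,X_3)E(X_2,X_4)-A(X_2,X_4)E(X_1,X_3)$. For a symmetric $(0,2)$-tensor $E$: the endomorphism $\mathcal E$ is defined by $g(\mathcal EX_1,X_2)=E(X_1,X_2)$, and $(X\wedge_EY)X_1=E(Y,X_1)X-E(X,X_1)Y$. Denote by $\wedge_E$ also the $(0,4)$-tensor $(X_1,X_2,X_3,X_4)\mapsto g((X_1\wedge_EX_2)X_3,X_4)$. Also $S^2(X,Y)=S(\mathcal SX,Y)$, with $\mathcal S$ the endomorphism of $S$. Curvature tensors: $\mathfrak G=\wedge_g$,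 $P=R-\frac1{n-1}\wedge_S$, $K=R-\frac1{n-2}(g\wedge S)$, $W=R-\frac{\kappa}{n(n-1)}\mathfrak G$, $C=K+\frac{\kappa}{(n-1)(n-2)}\mathfrak G$. For a $(0,4)$-tensor $D$ with $D(X_1,X_2,X_3,X_4)=g(\mathcal D(X_1,X_2)X_3,X_4)$, a symmetric $(0,2)$-tensor $A$ and a $(0,k)$-tensor $H$, $k\ge1$: $$D\cdot H(X_1,\dots,X_k,X,Y)=-H(\mathcal D(X,Y)X_1,X_2,\dots,X_k)-\cdots-H(X_1,\dots,\mathcal D(X,Y)X_k),$$ $$Q(A,H)(X_1,\dots,X_k,X,Y)=A(X,X_1)H(Y,X_2,\dots,X_k)+\cdots+A(X,X_k)H(X_1,\dots,X_{k-1},Y)$$ $$\qquad -A(Y,X_1)H(X,X_2,\dots,X_k)-\cdots-A(Y,X_k)H(X_1,\dots,X_{k-1},X).$$ Definitions (with $L$ a scalar, $\Pi$ a 1-form): Ricci flat: $S=0$. Ricci symmetric: $\nabla S=0$. Conformally semisymmetric: $R\cdot C=0$. Deszcz pseudosymmetric: $R\cdot R=L\,Q(g,R)$ for some $L$. Ricci generalized pseudosymmetric: $R\cdot R=L\,Q(S,R)$ for some $L$. Weyl pseudosymmetric: $R\cdot C=L\,Q(g,C)$ for some $L$. Conformally recurrent: $\nabla C=\Pi\otimes C$ for some $\Pi$. Einstein: $S=\alpha g$ for a scalar $\alpha$. Ricci simple: $S=\beta\,\Pi\otimes\Pi$ for some scalar $\beta$ and 1-form $\Pi$. $S$ is cyclic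 parallel if $(\nabla_{X_1}S)(X_2,X_3)+(\nabla_{X_2}S)(X_3,X_1)+(\nabla_{X_3}S)(X_1,X_2)=0$, and of Codazzi type if $(\nabla_{X_1}S)(X_2,X_3)=(\nabla_{X_2}S)(X_1,X_3)$. Recurrence of forms: for a $(0,4)$ curvature tensor $D$, the curvature 2-forms are $\Omega^{\,k}_{(D)l}=D_{ijl}{}^{k}\,dx^i\wedge dx^j$; they are recurrent, with associated 1-form $\Pi$, if $\mathfrak D\Omega^{\,k}_{(D)l}=\Pi\wedge\Omega^{\,k}_{(D)l}$, where $\mathfrak D$ is the exterior derivative; this is characterized by $$(\nabla_{X_1}D)(X_2,X_3,X,Y)+(\nabla_{X_2}D)(X_3,X_1,X,Y)+(\nabla_{X_3}D)(X_1,X_2,X,Y)$$ $$=\Pi(X_1)D(X_2,X_3,X,Y)+\Pi(X_2)D(X_3,X_1,X,Y)+\Pi(X_3)D(X_1,X_2,X,Y)$$ for a 1-form $\Pi$. The Ricci 1-forms $\Lambda_{(S)l}=S_{lk}dx^k$ are recurrent if $\mathfrak D\Lambda_{(S)l}=\Pi\wedge\Lambda_{(S)l}$, characterized by $(\nabla_{X_1}S)(X_2,X)-(\nabla_{X_2}S)(X_1,X)=\Pi(X_1)S(X_2,X)-\Pi(X_2)S(X_1,X)$ for a 1-form $\Pi$. Compatibility: for a $(0,4)$-tensor $D$, a symmetric $(0,2)$-tensor $E$ (with endomorphism $\mathcal E$) is $D$-compatible, or a compatible tensor for $D$, if $$D(\mathcal EX_1,X,X_2,X_3)+D(\mathcal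 EX_2,X,X_3,X_1)+D(\mathcal EX_3,X,X_1,X_2)=0$$ for all $X,X_1,X_2,X_3$. The matrices in (vii) and (viii) are matrices of components in the coordinates $(u,r,\theta,\phi)$.
   Formalization: Mended: m is nowhere zero; negative claims that fail for constant m assume m not constant; recurrent 2-forms need Π not identically zero; E in (vii), (viii) need not be symmetric; compatibility for P puts the endomorphism in the last slot: P(X2,X3,X,EX1)+cyclic=0. *)

theory Defs
  imports "HOL-Analysis.Analysis"
begin

section \<open>Smooth scalars, 1-forms and tensor fields on an open set of coordinates\<close>

primrec Ck_on :: "nat \<Rightarrow> 'a::real_normed_vector set \<Rightarrow> ('a \<Rightarrow> real) \<Rightarrow> bool" where
  "Ck_on 0 U f \<longleftrightarrow> continuous_on U f"
| "Ck_on (Suc k) U f \<longleftrightarrow> (\<forall>p\<in>U. f differentiable (at p)) \<and>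
     (\<forall>v. Ck_on k U (\<lambda>p. frechet_derivative f (at p) v))"

text \<open>Intended for open \<open>U\<close>.\<close>

definition scalar_on :: "'a::real_normed_vector set \<Rightarrow> ('a \<Rightarrow> real) \<Rightarrow> bool" where
  "scalar_on U f \<longleftrightarrow> (\<forall>k. Ck_on k U f)"

text \<open>A tensor at a point of a coordinate domain in \<open>\<real>\<^sup>n\<close> is a multilinear form on
  \<open>\<real>\<^sup>n\<close>, the tangent vector \<open>v\<close> standing for \<open>v\<^sup>i \<partial>\<^sub>i\<close>; a tensor field maps points to such forms.\<close>

type_synonym 'n form1 = "real^'n \<Rightarrow> real"
type_synonym 'n form2 = "real^'n \<Rightarrow> real^'n \<Rightarrow> real"
type_synonym 'n form4 = "real^'n \<Rightarrow> real^'n \<Rightarrow> real^'n \<Rightarrow> real^'n \<Rightarrow> real"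
type_synonym 'n form6 =
  "real^'n \<Rightarrow> real^'n \<Rightarrow> real^'n \<Rightarrow> real^'n \<Rightarrow> real^'n \<Rightarrow> real^'n \<Rightarrow> real"

definition one_form_on :: "(real^'n) set \<Rightarrow> (real^'n \<Rightarrow> 'n::finite form1) \<Rightarrow> bool" where
  "one_form_on M \<omega> \<longleftrightarrow> (\<forall>p\<in>M. linear (\<omega> p)) \<and> (\<forall>x. scalar_on M (\<lambda>p. \<omega> p x))"

definition tensor02_on :: "(real^'n) set \<Rightarrow> (real^'n \<Rightarrow> 'n::finite form2) \<Rightarrow> bool" where
  "tensor02_on M E \<longleftrightarrow> (\<forall>p\<in>M. bilinear (E p)) \<and> (\<forall>x y. scalar_on M (\<lambda>p. E p x y))"

section \<open>Pointwise algebra; \<open>g\<close> is the metric at the point\<close>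

definition form_matrix :: "'n::finite form2 \<Rightarrow> real^'n^'n" where
  "form_matrix A = (\<chi> i j. A (axis i 1) (axis j 1))"

definition cometric :: "'n::finite form2 \<Rightarrow> real^'n^'n" where
  "cometric g = matrix_inv (form_matrix g)"

text \<open>The vector \<open>v\<close> with \<open>g v w = \<alpha> w\<close> for all \<open>w\<close>.\<close>

definition raise :: "'n::finite form2 \<Rightarrow> 'n form1 \<Rightarrow> real^'n" where
  "raise g \<alpha> = cometric g *v (\<chi> i. \<alpha> (axis i 1))"

definition form_norm :: "'n::finite form2 \<Rightarrow> 'n form1 \<Rightarrow> real" where
  "form_norm g \<alpha> = sqrt \<bar>\<alpha> (raise g \<alpha>)\<bar>"

definition endo :: "'n::finite form2 \<Rightarrow> 'n form2 \<Rightarrow> real^'n \<Rightarrow> real^'n" where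
  "endo g E x = raise g (E x)"

definition curv_endo ::
  "'n::finite form2 \<Rightarrow> 'n form4 \<Rightarrow> real^'n \<Rightarrow> real^'n \<Rightarrow> real^'n \<Rightarrow> real^'n" where
  "curv_endo g D x y z = raise g (D x y z)"

definition kulkarni_nomizu :: "'n::finite form2 \<Rightarrow> 'n form2 \<Rightarrow> 'n form4" where
  "kulkarni_nomizu A E x1 x2 x3 x4 =
     A x1 x4 * E x2 x3 + A x2 x3 * E x1 x4 - A x1 x3 * E x2 x4 - A x2 x4 * E x1 x3"

definition wedge_endo :: "'n::finite form2 \<Rightarrow> real^'n \<Rightarrow> real^'n \<Rightarrow> real^'n \<Rightarrow> real^'n" where
  "wedge_endo E x y z = E y z *\<^sub>R x - E x z *\<^sub>R y"

definition wedge4 :: "'n::finite form2 \<Rightarrow> 'n form2 \<Rightarrow> 'n form4" where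
  "wedge4 g E x1 x2 x3 x4 = g (wedge_endo E x1 x2 x3) x4"

text \<open>The tensors \<open>D \<cdot> H\<close> and \<open>Q(A, H)\<close> for a (0,4)-tensor \<open>H\<close>.\<close>

definition curv_act :: "'n::finite form2 \<Rightarrow> 'n form4 \<Rightarrow> 'n form4 \<Rightarrow> 'n form6" where
  "curv_act g D H x1 x2 x3 x4 x y =
     - H (curv_endo g D x y x1) x2 x3 x4 - H x1 (curv_endo g D x y x2) x3 x4
     - H x1 x2 (curv_endo g D x y x3) x4 - H x1 x2 x3 (curv_endo g D x y x4)"

definition tachibana :: "'n::finite form2 \<Rightarrow> 'n form4 \<Rightarrow> 'n form6" where
  "tachibana A H x1 x2 x3 x4 x y =
     A x x1 * H y x2 x3 x4 + A x x2 * H x1 y x3 x4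
   + A x x3 * H x1 x2 y x4 + A x x4 * H x1 x2 x3 y
   - A y x1 * H x x2 x3 x4 - A y x2 * H x1 x x3 x4
   - A y x3 * H x1 x2 x x4 - A y x4 * H x1 x2 x3 x"

section \<open>Levi-Civita connection and curvature; \<open>g\<close> is the metric field\<close>

text \<open>\<open>christoffel g p x y\<close> is the vector \<open>\<Gamma>\<^sup>k\<^sub>i\<^sub>j x\<^sup>i y\<^sup>j \<partial>\<^sub>k\<close> at \<open>p\<close>: the Koszul
  formula for vector fields with constant coefficients.\<close>

definition christoffel ::
  "(real^'n \<Rightarrow> 'n::finite form2) \<Rightarrow> real^'n \<Rightarrow> real^'n \<Rightarrow> real^'n \<Rightarrow> real^'n" where
  "christoffel g p x y = raise (g p) (\<lambda>w.
     (frechet_derivative (\<lambda>q. g q y w) (at p) x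
      + frechet_derivative (\<lambda>q. g q x w) (at p) y
      - frechet_derivative (\<lambda>q. g q x y) (at p) w) / 2)"

definition covd :: "(real^'n \<Rightarrow> 'n::finite form2) \<Rightarrow>
    (real^'n \<Rightarrow> real^'n) \<Rightarrow> (real^'n \<Rightarrow> real^'n) \<Rightarrow> (real^'n \<Rightarrow> real^'n)" where
  "covd g X Y p = frechet_derivative Y (at p) (X p) + christoffel g p (X p) (Y p)"

definition lie_bracket ::
  "(real^'n \<Rightarrow> real^'n) \<Rightarrow> (real^'n \<Rightarrow> real^'n) \<Rightarrow> (real^'n \<Rightarrow> real^'n::finite)" where
  "lie_bracket X Y p =
     frechet_derivative Y (at p) (X p) - frechet_derivative X (at p) (Y p)"

definition curv_op :: "(real^'n \<Rightarrow> 'n::finite form2) \<Rightarrow> (real^'n \<Rightarrow> real^'n) \<Rightarrow>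
    (real^'n \<Rightarrow> real^'n) \<Rightarrow> (real^'n \<Rightarrow> real^'n) \<Rightarrow> (real^'n \<Rightarrow> real^'n)" where
  "curv_op g X Y Z p =
     covd g (lie_bracket X Y) Z p - covd g X (covd g Y Z) p + covd g Y (covd g X Z) p"

text \<open>Tangent vectors at \<open>p\<close> are extended to vector fields with constant coefficients;
  as the curvature is tensorial, the choice of extension is immaterial.\<close>

definition Riem :: "(real^'n \<Rightarrow> 'n::finite form2) \<Rightarrow> real^'n \<Rightarrow> 'n form4" where
  "Riem g p x1 x2 x3 x4 = g p (curv_op g (\<lambda>_. x1) (\<lambda>_. x2) (\<lambda>_. x3) p) x4"

definition Ric :: "(real^'n \<Rightarrow> 'n::finite form2) \<Rightarrow> real^'n \<Rightarrow> 'n form2" where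
  "Ric g p x y =
     (\<Sum>i\<in>UNIV. \<Sum>l\<in>UNIV. cometric (g p) $ i $ l * Riem g p (axis i 1) x y (axis l 1))"

definition Ric2 :: "(real^'n \<Rightarrow> 'n::finite form2) \<Rightarrow> real^'n \<Rightarrow> 'n form2" where
  "Ric2 g p x y = Ric g p (endo (g p) (Ric g p) x) y"

definition scal :: "(real^'n \<Rightarrow> 'n::finite form2) \<Rightarrow> real^'n \<Rightarrow> real" where
  "scal g p =
     (\<Sum>j\<in>UNIV. \<Sum>k\<in>UNIV. cometric (g p) $ j $ k * Ric g p (axis j 1) (axis k 1))"

definition projective :: "(real^'n \<Rightarrow> 'n::finite form2) \<Rightarrow> real^'n \<Rightarrow> 'n form4" where
  "projective g p x1 x2 x3 x4 =
     Riem g p x1 x2 x3 x4 - 1 / (real CARD('n) - 1) * wedge4 (g p) (Ric g p) x1 x2 x3 x4"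

definition conharmonic :: "(real^'n \<Rightarrow> 'n::finite form2) \<Rightarrow> real^'n \<Rightarrow> 'n form4" where
  "conharmonic g p x1 x2 x3 x4 =
     Riem g p x1 x2 x3 x4
     - 1 / (real CARD('n) - 2) * kulkarni_nomizu (g p) (Ric g p) x1 x2 x3 x4"

definition concircular :: "(real^'n \<Rightarrow> 'n::finite form2) \<Rightarrow> real^'n \<Rightarrow> 'n form4" where
  "concircular g p x1 x2 x3 x4 =
     Riem g p x1 x2 x3 x4
     - scal g p / (real CARD('n) * (real CARD('n) - 1)) * wedge4 (g p) (g p) x1 x2 x3 x4"

definition conformal :: "(real^'n \<Rightarrow> 'n::finite form2) \<Rightarrow> real^'n \<Rightarrow> 'n form4" where
  "conformal g p x1 x2 x3 x4 =
     conharmonic g p x1 x2 x3 x4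
     + scal g p / ((real CARD('n) - 1) * (real CARD('n) - 2)) * wedge4 (g p) (g p) x1 x2 x3 x4"

text \<open>\<open>nabla2 g T p x y z\<close> is \<open>(\<nabla>\<^sub>x T)(y, z)\<close>, and similarly for \<open>nabla4\<close>.\<close>

definition nabla2 :: "(real^'n \<Rightarrow> 'n::finite form2) \<Rightarrow> (real^'n \<Rightarrow> 'n form2) \<Rightarrow>
    real^'n \<Rightarrow> real^'n \<Rightarrow> 'n form2" where
  "nabla2 g T p x y z = frechet_derivative (\<lambda>q. T q y z) (at p) x
     - T p (christoffel g p x y) z - T p y (christoffel g p x z)"

definition nabla4 :: "(real^'n \<Rightarrow> 'n::finite form2) \<Rightarrow> (real^'n \<Rightarrow> 'n form4) \<Rightarrow>
    real^'n \<Rightarrow> real^'n \<Rightarrow> 'n form4" where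
  "nabla4 g T p x y1 y2 y3 y4 = frechet_derivative (\<lambda>q. T q y1 y2 y3 y4) (at p) x
     - T p (christoffel g p x y1) y2 y3 y4 - T p y1 (christoffel g p x y2) y3 y4
     - T p y1 y2 (christoffel g p x y3) y4 - T p y1 y2 y3 (christoffel g p x y4)"

section \<open>Curvature conditions on an open set \<open>M\<close> of coordinates\<close>

definition ricci_flat :: "(real^'n) set \<Rightarrow> (real^'n \<Rightarrow> 'n::finite form2) \<Rightarrow> bool" where
  "ricci_flat M g \<longleftrightarrow> (\<forall>p\<in>M. \<forall>x y. Ric g p x y = 0)"

definition ricci_symmetric :: "(real^'n) set \<Rightarrow> (real^'n \<Rightarrow> 'n::finite form2) \<Rightarrow> bool" where
  "ricci_symmetric M g \<longleftrightarrow> (\<forall>p\<in>M. \<forall>x y z. nabla2 g (Ric g) p x y z = 0)"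

definition conformally_semisymmetric ::
  "(real^'n) set \<Rightarrow> (real^'n \<Rightarrow> 'n::finite form2) \<Rightarrow> bool" where
  "conformally_semisymmetric M g \<longleftrightarrow> (\<forall>p\<in>M. \<forall>x1 x2 x3 x4 x y.
     curv_act (g p) (Riem g p) (conformal g p) x1 x2 x3 x4 x y = 0)"

definition deszcz_pseudosymmetric ::
  "(real^'n) set \<Rightarrow> (real^'n \<Rightarrow> 'n::finite form2) \<Rightarrow> bool" where
  "deszcz_pseudosymmetric M g \<longleftrightarrow> (\<exists>L. scalar_on M L \<and> (\<forall>p\<in>M. \<forall>x1 x2 x3 x4 x y.
     curv_act (g p) (Riem g p) (Riem g p) x1 x2 x3 x4 x y
     = L p * tachibana (g p) (Riem g p) x1 x2 x3 x4 x y))"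

definition ricci_generalized_pseudosymmetric ::
  "(real^'n) set \<Rightarrow> (real^'n \<Rightarrow> 'n::finite form2) \<Rightarrow> bool" where
  "ricci_generalized_pseudosymmetric M g \<longleftrightarrow>
     (\<exists>L. scalar_on M L \<and> (\<forall>p\<in>M. \<forall>x1 x2 x3 x4 x y.
        curv_act (g p) (Riem g p) (Riem g p) x1 x2 x3 x4 x y
        = L p * tachibana (Ric g p) (Riem g p) x1 x2 x3 x4 x y))"

definition weyl_pseudosymmetric ::
  "(real^'n) set \<Rightarrow> (real^'n \<Rightarrow> 'n::finite form2) \<Rightarrow> bool" where
  "weyl_pseudosymmetric M g \<longleftrightarrow> (\<exists>L. scalar_on M L \<and> (\<forall>p\<in>M. \<forall>x1 x2 x3 x4 x y.
     curv_act (g p) (Riem g p) (conformal g p) x1 x2 x3 x4 x y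
     = L p * tachibana (g p) (conformal g p) x1 x2 x3 x4 x y))"

definition conformally_recurrent ::
  "(real^'n) set \<Rightarrow> (real^'n \<Rightarrow> 'n::finite form2) \<Rightarrow> bool" where
  "conformally_recurrent M g \<longleftrightarrow> (\<exists>\<omega>. one_form_on M \<omega> \<and> (\<forall>p\<in>M. \<forall>x x1 x2 x3 x4.
     nabla4 g (conformal g) p x x1 x2 x3 x4 = \<omega> p x * conformal g p x1 x2 x3 x4))"

definition curv_2forms_recurrent_for :: "(real^'n) set \<Rightarrow> (real^'n \<Rightarrow> 'n::finite form2) \<Rightarrow>
    (real^'n \<Rightarrow> 'n form4) \<Rightarrow> (real^'n \<Rightarrow> 'n form1) \<Rightarrow> bool" where
  "curv_2forms_recurrent_for M g D \<omega> \<longleftrightarrow>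
     one_form_on M \<omega> \<and> (\<forall>p\<in>M. \<forall>x1 x2 x3 x y.
       nabla4 g D p x1 x2 x3 x y + nabla4 g D p x2 x3 x1 x y + nabla4 g D p x3 x1 x2 x y
       = \<omega> p x1 * D p x2 x3 x y + \<omega> p x2 * D p x3 x1 x y + \<omega> p x3 * D p x1 x2 x y)"

text \<open>The zero 1-form has to be excluded: by the second Bianchi identity it satisfies the
  recurrence equation for \<open>D = R\<close> on every manifold.\<close>

definition curv_2forms_recurrent :: "(real^'n) set \<Rightarrow> (real^'n \<Rightarrow> 'n::finite form2) \<Rightarrow>
    (real^'n \<Rightarrow> 'n form4) \<Rightarrow> bool" where
  "curv_2forms_recurrent M g D \<longleftrightarrow>
     (\<exists>\<omega>. curv_2forms_recurrent_for M g D \<omega> \<and> (\<exists>p\<in>M. \<exists>x. \<omega> p x \<noteq> 0))"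

definition ricci_1forms_recurrent ::
  "(real^'n) set \<Rightarrow> (real^'n \<Rightarrow> 'n::finite form2) \<Rightarrow> bool" where
  "ricci_1forms_recurrent M g \<longleftrightarrow> (\<exists>\<omega>. one_form_on M \<omega> \<and> (\<forall>p\<in>M. \<forall>x1 x2 x.
     nabla2 g (Ric g) p x1 x2 x - nabla2 g (Ric g) p x2 x1 x
     = \<omega> p x1 * Ric g p x2 x - \<omega> p x2 * Ric g p x1 x))"

definition einstein :: "(real^'n) set \<Rightarrow> (real^'n \<Rightarrow> 'n::finite form2) \<Rightarrow> bool" where
  "einstein M g \<longleftrightarrow>
     (\<exists>\<alpha>. scalar_on M \<alpha> \<and> (\<forall>p\<in>M. \<forall>x y. Ric g p x y = \<alpha> p * g p x y))"

definition ricci_simple_for :: "(real^'n) set \<Rightarrow> (real^'n \<Rightarrow> 'n::finite form2) \<Rightarrow>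
    (real^'n \<Rightarrow> real) \<Rightarrow> (real^'n \<Rightarrow> 'n form1) \<Rightarrow> bool" where
  "ricci_simple_for M g \<beta> \<omega> \<longleftrightarrow> scalar_on M \<beta> \<and> one_form_on M \<omega> \<and>
     (\<forall>p\<in>M. \<forall>x y. Ric g p x y = \<beta> p * (\<omega> p x * \<omega> p y))"

definition ricci_cyclic_parallel ::
  "(real^'n) set \<Rightarrow> (real^'n \<Rightarrow> 'n::finite form2) \<Rightarrow> bool" where
  "ricci_cyclic_parallel M g \<longleftrightarrow> (\<forall>p\<in>M. \<forall>x1 x2 x3.
     nabla2 g (Ric g) p x1 x2 x3 + nabla2 g (Ric g) p x2 x3 x1 + nabla2 g (Ric g) p x3 x1 x2 = 0)"

definition ricci_codazzi :: "(real^'n) set \<Rightarrow> (real^'n \<Rightarrow> 'n::finite form2) \<Rightarrow> bool" where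
  "ricci_codazzi M g \<longleftrightarrow> (\<forall>p\<in>M. \<forall>x1 x2 x3.
     nabla2 g (Ric g) p x1 x2 x3 = nabla2 g (Ric g) p x2 x1 x3)"

text \<open>Symmetry of \<open>E\<close> is not required; the general \<open>R\<close>-compatible tensor of the Vaidya
  metric is not symmetric.\<close>

definition compatible :: "(real^'n) set \<Rightarrow> (real^'n \<Rightarrow> 'n::finite form2) \<Rightarrow>
    (real^'n \<Rightarrow> 'n form4) \<Rightarrow> (real^'n \<Rightarrow> 'n form2) \<Rightarrow> bool" where
  "compatible M g D E \<longleftrightarrow> (\<forall>p\<in>M. \<forall>x x1 x2 x3.
     D p (endo (g p) (E p) x1) x x2 x3 + D p (endo (g p) (E p) x2) x x3 x1
     + D p (endo (g p) (E p) x3) x x1 x2 = 0)"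

text \<open>Compatibility through the curvature operator, for the slot of \<open>D\<close> that represents the
  value of the operator:
  \<open>g(\<D>(x2,x3)x, \<E> x1) + g(\<D>(x3,x1)x, \<E> x2) + g(\<D>(x1,x2)x, \<E> x3) = 0\<close>.
  For tensors with the algebraic symmetries of \<open>R\<close> this is \<open>compatible\<close>. The projective
  tensor is only skew in its first two arguments; the position of \<open>\<E>\<close> then matters, and
  this is the one in which \<open>R\<close> and \<open>P\<close> have the same compatible tensors.\<close>

definition op_compatible :: "(real^'n) set \<Rightarrow> (real^'n \<Rightarrow> 'n::finite form2) \<Rightarrow>
    (real^'n \<Rightarrow> 'n form4) \<Rightarrow> (real^'n \<Rightarrow> 'n form2) \<Rightarrow> bool" where
  "op_compatible M g D E \<longleftrightarrow> (\<forall>p\<in>M. \<forall>x x1 x2 x3.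
     D p x2 x3 x (endo (g p) (E p) x1) + D p x3 x1 x (endo (g p) (E p) x2)
     + D p x1 x2 x (endo (g p) (E p) x3) = 0)"

lemma op_compatible_iff_compatible:
  assumes "\<And>p x y z w. p \<in> M \<Longrightarrow> D p x y z w = D p z w x y"
    and "\<And>p x y z w. p \<in> M \<Longrightarrow> D p x y z w = - D p y x z w"
  shows "op_compatible M g D E \<longleftrightarrow> compatible M g D E"
proof -
  have "D p a b x e = - D p e x a b" if "p \<in> M" for p a b x e
    using assms that by metis
  then show ?thesis
    unfolding op_compatible_def compatible_def
    by (smt (verit, best))
qed

section \<open>The Vaidya metric\<close>

text \<open>Coordinates \<open>(u, r, \<theta>, \<phi>) = (p $ 1, p $ 2, p $ 3, p $ 4)\<close>.\<close>

definition vaidya_domain :: "real set \<Rightarrow> (real^4) set" where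
  "vaidya_domain I =
     {p. p $ 1 \<in> I \<and> 0 < p $ 2 \<and> 0 < p $ 3 \<and> p $ 3 < pi \<and> 0 < p $ 4 \<and> p $ 4 < 2 * pi}"

text \<open>\<open>2 dr du\<close> is the symmetric product \<open>dr \<otimes> du + du \<otimes> dr\<close>, so \<open>g\<^sub>1\<^sub>2 = g\<^sub>2\<^sub>1 = -1\<close>.\<close>

definition vaidya :: "(real \<Rightarrow> real) \<Rightarrow> real^4 \<Rightarrow> 4 form2" where
  "vaidya m p x y =
     - (1 - 2 * m (p $ 1) / p $ 2) * (x $ 1 * y $ 1) - (x $ 2 * y $ 1 + x $ 1 * y $ 2)
     + (p $ 2)\<^sup>2 * (x $ 3 * y $ 3 + (sin (p $ 3))\<^sup>2 * (x $ 4 * y $ 4))"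

definition RP_form :: "(real \<Rightarrow> real) \<Rightarrow> (real^4) set \<Rightarrow> (real^4 \<Rightarrow> 4 form2) \<Rightarrow> bool" where
  "RP_form m M E \<longleftrightarrow> (\<exists>a11 a12 a22 a33 a43 a44.
     (\<forall>a\<in>{a11, a12, a22, a33, a43, a44}. scalar_on M a) \<and>
     (\<forall>p\<in>M. form_matrix (E p) = vector
       [vector [a11 p, a12 p, 0, 0],
        vector [a12 p + p $ 2 * deriv m (p $ 1) / m (p $ 1) * a22 p, a22 p, 0, 0],
        vector [0, 0, a33 p, a43 p],
        vector [0, 0, a43 p, a44 p]]))"

definition CK_form :: "(real^4) set \<Rightarrow> (real^4 \<Rightarrow> 4 form2) \<Rightarrow> bool" where
  "CK_form M E \<longleftrightarrow> (\<exists>a11 a12 a22 a33 a34 a44.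
     (\<forall>a\<in>{a11, a12, a22, a33, a34, a44}. scalar_on M a) \<and>
     (\<forall>p\<in>M. form_matrix (E p) = vector
       [vector [a11 p, a12 p, 0, 0],
        vector [a12 p, a22 p, 0, 0],
        vector [0, 0, a33 p, a34 p],
        vector [0, 0, a34 p, a44 p]]))"

end

theory Submission
  imports Defs
begin

text \<open>In the null coframe \<open>(du, dr + (1/2 - m/r) du, r d\<theta>, r sin \<theta> d\<phi>)\<close> the metric and, with
  \<open>k = m/r\<^sup>3\<close>, \<open>s = m'/r\<^sup>2\<close>, the Riemann tensor have constant shape: the former is the flat null metric,
  the latter \<open>C + g \<and> (s du \<otimes> du)\<close> with \<open>C = k (3 g \<and> h - g \<and> g - 3 h \<and> h)\<close>, where \<open>h\<close> is the round part
  of \<open>g\<close>. The algebraic claims therefore reduce to identities between Kulkarni-Nomizu products of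
  \<open>g\<close>, \<open>h\<close> and \<open>du \<otimes> du\<close>. The differential claims follow in the same way from
  \<open>\<nabla>g = 0\<close>, \<open>(\<nabla>\<^sub>v h)(x, y) = - (h(v, x) dr(y) + h(v, y) dr(x)) / r\<close> and the analogous formula for
  \<open>\<nabla>(du \<otimes> du)\<close>.\<close>

section \<open>Smooth scalars\<close>

text \<open>Put \<open>l = g - h\<close>. The Weyl part is then
  \<open>k (l \<and> h - l \<and> l - h \<and> h)\<close>: since \<open>l\<close> and
  \<open>h\<close> are orthogonal forms of rank 2, this is, up to scale, the only trace-free
  combination of the three products, which accounts for the coefficients 3, -1 and -3. The obstacle
  is the size of the identities with six arguments: in components they are polynomials in 24
  coordinates. But \<open>D \<cdot> _\<close> and \<open>Q(A, _)\<close> are both derivations, so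
  they are determined by their values on \<open>g\<close>, \<open>h\<close> and
  \<open>du \<otimes> du\<close>, where only four vectors occur. After this Leibniz reduction both
  identities in which R acts leave one residual, a multiple of
  \<open>Q(du \<otimes> du, l) \<and> l\<close>, which vanishes because \<open>l\<close> is a
  symmetric product with factor \<open>du\<close>. The negative claims are evaluated on single
  vectors. Those that depend on m' need a point where m' is nonzero, and nonconstancy of m on an
  interval provides it.\<close>

lemma Ck_on_imp_continuous_on:
  assumes "Ck_on k U f"
  shows "continuous_on U f"
proof (cases k)
  case 0
  with assms show ?thesis by simp
next
  case (Suc n)
  with assms have "f differentiable_on U"
    by (auto simp: differentiable_on_def intro: differentiable_at_withinI)
  then show ?thesis by (rule differentiable_imp_continuous_on)
qed

lemma has_derivative_cong_open:
  assumes "open U" "p \<in> U" "\<And>q. q \<in> U \<Longrightarrow> f q = h q"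
  shows "(f has_derivative D) (at p) \<longleftrightarrow> (h has_derivative D) (at p)"
  using has_derivative_transform_within_open[OF _ assms(1,2)] assms(3) by metis

lemma frechet_derivative_cong_open:
  assumes "open U" "p \<in> U" "\<And>q. q \<in> U \<Longrightarrow> f q = h q"
  shows "frechet_derivative f (at p) = frechet_derivative h (at p)"
  using has_derivative_cong_open[OF assms] by (simp add: frechet_derivative_def)

text \<open>The derivative at a point of an open set only sees the values on that set. The induction
  is over all pairs \<open>f\<close>, \<open>h\<close> because their directional derivatives again
  agree on \<open>U\<close> alone.\<close>

lemma Ck_on_cong:
  assumes "open U" "\<And>p. p \<in> U \<Longrightarrow> f p = h p"
  shows "Ck_on k U f \<longleftrightarrow> Ck_on k U h"
  using assms(2)
proof (induction k arbitrary: f h)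
  case 0
  then show ?case by (simp cong: continuous_on_cong)
next
  case (Suc k)
  note d = has_derivative_cong_open[OF assms(1) _ Suc.prems]
  note e = frechet_derivative_cong_open[OF assms(1) _ Suc.prems]
  have "Ck_on k U (\<lambda>p. frechet_derivative f (at p) v) \<longleftrightarrow>
      Ck_on k U (\<lambda>p. frechet_derivative h (at p) v)" for v
    by (rule Suc.IH) (simp add: e)
  with d show ?case by (auto simp: differentiable_def)
qed

text \<open>Replaces the chosen \<open>frechet_derivative\<close> by a derivative in closed form, so
  that each closure property below only has to inspect that formula.\<close>

lemma Ck_on_SucI:
  assumes "open U" "\<And>p. p \<in> U \<Longrightarrow> (f has_derivative f' p) (at p)"
    "\<And>v. Ck_on k U (\<lambda>p. f' p v)"
  shows "Ck_on (Suc k) U f"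
proof -
  have "Ck_on k U (\<lambda>p. frechet_derivative f (at p) v)" for v
    using assms(3)[of v] by (rule Ck_on_cong[OF assms(1), THEN iffD1, rotated])
      (simp add: frechet_derivative_at[OF assms(2)])
  then show ?thesis using assms(2) by (auto simp: differentiable_def)
qed

text \<open>Serves the product rule, which multiplies derivatives of class k by undifferentiated
  factors given with class k + 1.\<close>

lemma Ck_on_SucD: "Ck_on (Suc k) U f \<Longrightarrow> Ck_on k U f"
proof (induction k arbitrary: f)
  case 0
  then show ?case using Ck_on_imp_continuous_on[OF 0] by simp
next
  case (Suc k)
  then show ?case by (metis Ck_on.simps(2))
qed

lemma Ck_on_const: "Ck_on k U (\<lambda>p. c)"
  by (induction k arbitrary: c) (auto simp: frechet_derivative_const)

lemma Ck_on_has_derivative: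
  "Ck_on (Suc k) U f \<Longrightarrow> p \<in> U \<Longrightarrow> (f has_derivative frechet_derivative f (at p)) (at p)"
  by (simp flip: frechet_derivative_works)

lemma Ck_on_add:
  assumes "open U"
  shows "Ck_on k U f \<Longrightarrow> Ck_on k U h \<Longrightarrow> Ck_on k U (\<lambda>p. f p + h p)"
proof (induction k arbitrary: f h)
  case 0
  then show ?case by (auto intro: continuous_intros)
next
  case (Suc k)
  show ?case
    using Suc.prems
    by (intro Ck_on_SucI[OF assms has_derivative_add[OF Ck_on_has_derivative Ck_on_has_derivative]]
        Suc.IH) auto
qed

lemma Ck_on_mult:
  assumes "open U"
  shows "Ck_on k U f \<Longrightarrow> Ck_on k U h \<Longrightarrow> Ck_on k U (\<lambda>p. f p * h p)"
proof (induction k arbitrary: f h)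
  case 0
  then show ?case by (auto intro: continuous_intros)
next
  case (Suc k)
  show ?case
    using Suc.prems Ck_on_SucD[OF Suc.prems(1)] Ck_on_SucD[OF Suc.prems(2)]
    by (intro Ck_on_SucI[OF assms has_derivative_mult[OF Ck_on_has_derivative Ck_on_has_derivative]]
        Ck_on_add[OF assms] Suc.IH) auto
qed

lemma Ck_on_inverse:
  assumes "open U"
  shows "Ck_on k U f \<Longrightarrow> \<forall>p\<in>U. f p \<noteq> 0 \<Longrightarrow> Ck_on k U (\<lambda>p. inverse (f p))"
proof (induction k arbitrary: f)
  case 0
  then show ?case by (auto intro: continuous_intros)
next
  case (Suc k)
  have "Ck_on k U (\<lambda>p. - (inverse (f p) * frechet_derivative f (at p) v * inverse (f p)))" for v
  proof -
    \<comment> \<open>In this form the derivative of 1/f involves only 1/f and f', so the induction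
      hypothesis applies; the sign becomes a constant factor, and closure under products
      suffices.\<close>
    have "Ck_on k U (\<lambda>p. (- 1) * (inverse (f p) * frechet_derivative f (at p) v * inverse (f p)))"
      using Suc.prems Ck_on_SucD[OF Suc.prems(1)]
      by (intro Ck_on_mult[OF assms] Ck_on_const Suc.IH) auto
    then show ?thesis by simp
  qed
  then show ?case
    using Suc.prems
    by (intro Ck_on_SucI[OF assms Deriv.has_derivative_inverse[OF _ Ck_on_has_derivative]]) auto
qed

text \<open>The derivative along \<open>v\<close> is the derivative of \<open>h\<close> at
  \<open>l p\<close> in direction \<open>l v\<close>, again a function of \<open>l p\<close> alone,
  so the induction runs over \<open>h\<close> with \<open>l\<close> fixed. It lifts functions of u
  to the coordinate domain.\<close>

lemma Ck_on_linear_compose: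
  fixes U :: "'a::real_normed_vector set" and h :: "real \<Rightarrow> real"
  assumes "open U" "bounded_linear l" "\<And>p. p \<in> U \<Longrightarrow> l p \<in> V"
  shows "Ck_on k V h \<Longrightarrow> Ck_on k U (\<lambda>p. h (l p))"
proof (induction k arbitrary: h)
  case 0
  then show ?case
    using continuous_on_compose2[of V h U l] linear_continuous_on[OF assms(2)] assms(3) by auto
next
  case (Suc k)
  show ?case
  proof (rule Ck_on_SucI[OF assms(1)])
    fix p assume "p \<in> U"
    with Suc.prems assms(3) have "(h has_derivative frechet_derivative h (at (l p))) (at (l p))"
      using Ck_on_has_derivative by blast
    then show "((\<lambda>p. h (l p)) has_derivative (\<lambda>v. frechet_derivative h (at (l p)) (l v))) (at p)"
      using has_derivative_compose[OF bounded_linear_imp_has_derivative[OF assms(2)]] by blast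
  next
    fix v
    show "Ck_on k U (\<lambda>p. frechet_derivative h (at (l p)) (l v))"
      using Suc.prems by (intro Suc.IH) auto
  qed
qed

lemma Ck_on_linear:
  assumes "open U" "bounded_linear l"
  shows "Ck_on k U l"
proof -
  have "Ck_on k UNIV (\<lambda>x::real. x)"
    by (cases k) (auto intro!: Ck_on_SucI[OF _ has_derivative_ident] Ck_on_const continuous_on_id simp del: Ck_on.simps(2))
  then show ?thesis by (rule Ck_on_linear_compose[OF assms UNIV_I])
qed

lemma scalar_on_const: "scalar_on U (\<lambda>p. c)"
  and scalar_on_mult: "open U \<Longrightarrow> scalar_on U f \<Longrightarrow> scalar_on U h \<Longrightarrow> scalar_on U (\<lambda>p. f p * h p)"
  and scalar_on_divide: "open U \<Longrightarrow> scalar_on U f \<Longrightarrow> scalar_on U h \<Longrightarrow>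
    \<forall>p\<in>U. h p \<noteq> 0 \<Longrightarrow> scalar_on U (\<lambda>p. f p / h p)"
  by (simp_all add: scalar_on_def Ck_on_const Ck_on_mult Ck_on_inverse divide_inverse)

lemma scalar_on_has_derivative:
  "scalar_on U f \<Longrightarrow> p \<in> U \<Longrightarrow> (f has_derivative frechet_derivative f (at p)) (at p)"
  by (metis scalar_on_def Ck_on_has_derivative)

lemma scalar_on_DERIV:
  fixes f :: "real \<Rightarrow> real"
  assumes "scalar_on U f" "x \<in> U"
  shows "(f has_real_derivative deriv f x) (at x)"
  using scalar_on_has_derivative[OF assms] DERIV_imp_deriv
  by (metis real_differentiable_def differentiableI)

text \<open>Smoothness of directional derivatives is part of \<open>Ck_on\<close>; on the real line
  the direction 1 gives \<open>deriv\<close>.\<close>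

lemma scalar_on_deriv:
  fixes f :: "real \<Rightarrow> real"
  assumes "open U" "scalar_on U f"
  shows "scalar_on U (deriv f)"
  unfolding scalar_on_def
proof
  fix k
  have "Ck_on k U (\<lambda>x. frechet_derivative f (at x) 1)"
    using assms(2) by (metis scalar_on_def Ck_on.simps(2))
  moreover have "frechet_derivative f (at x) 1 = deriv f x" if "x \<in> U" for x
    using frechet_derivative_at[OF scalar_on_DERIV[OF assms(2) that, unfolded has_field_derivative_def]]
    by (metis mult.right_neutral)
  ultimately show "Ck_on k U (deriv f)"
    using Ck_on_cong[OF assms(1)] by (smt (verit))
qed

text \<open>A derivative vanishing on an interval makes the function constant; this converts
  nonconstancy of the mass into a point that refutes the conditions below.\<close>

lemma exists_deriv_nonzero:
  fixes f :: "real \<Rightarrow> real"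
  assumes "open I" "is_interval I" "scalar_on I f" "\<not> f constant_on I"
  obtains x where "x \<in> I" "deriv f x \<noteq> 0"
proof (rule ccontr)
  assume "\<not> thesis"
  then have "\<forall>x\<in>I. deriv f x = 0" using that by blast
  then have "\<And>x. x \<in> I \<Longrightarrow> (f has_derivative (\<lambda>h. 0)) (at x within I)"
    using scalar_on_DERIV[OF assms(3)]
    by (metis has_field_derivative_def has_derivative_at_withinI lambda_zero)
  then have "\<exists>c. \<forall>x\<in>I. f x = c"
    using has_derivative_zero_constant[OF is_interval_convex[OF assms(2)]] by blast
  then show False using assms(4) by (auto simp: constant_on_def)
qed

section \<open>Raising indices with a nondegenerate form\<close>

lemma raise_eqI:
  fixes g :: "'n::finite form2"
  assumes g: "bilinear g" "\<And>x y. g x y = g y x" "\<And>x. (\<And>y. g x y = 0) \<Longrightarrow> x = 0"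
    and v: "\<And>w. g v w = \<alpha> w"
  shows "raise g \<alpha> = v"
proof -
  have expand: "g x y = (\<Sum>i\<in>UNIV. x $ i * g (axis i 1) y)" for x y
  proof -
    have "g x y = g (\<Sum>i\<in>UNIV. x $ i *\<^sub>R axis i 1) y"
      using basis_expansion[of x] by (simp add: scalar_mult_eq_scaleR)
    also have "\<dots> = (\<Sum>i\<in>UNIV. x $ i * g (axis i 1) y)"
    proof -
      interpret linear "\<lambda>x. g x y" using g(1) by (simp add: bilinear_def)
      show ?thesis by (simp add: sum scale)
    qed
    finally show ?thesis .
  qed
  have mv: "form_matrix g *v x = (\<chi> i. g x (axis i 1))" for x
    using expand[of x "axis _ 1"] g(2)[of "axis _ 1" "axis _ 1"]
    by (simp add: vec_eq_iff matrix_vector_mult_def form_matrix_def mult.commute)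
  \<comment> \<open>A trivial kernel makes the matrix invertible, so the choice operator inside
    \<open>matrix_inv\<close> picks a genuine inverse.\<close>
  have "x = 0" if "form_matrix g *v x = 0" for x
  proof (rule g(3))
    fix y
    have "g x (axis i 1) = 0" for i using that unfolding mv by (simp add: vec_eq_iff)
    then show "g x y = 0" using expand[of y x] g(2) by simp
  qed
  then obtain B where "B ** form_matrix g = mat 1"
    using matrix_left_invertible_ker[of "form_matrix g"] by blast
  then have "invertible (form_matrix g)"
    using invertible_left_inverse by blast
  then have "cometric g ** form_matrix g = mat 1"
    unfolding cometric_def matrix_inv_def invertible_def by (rule someI2_ex) simp
  then have "cometric g *v (form_matrix g *v v) = v"
    by (simp add: matrix_vector_mul_assoc)
  then show ?thesis by (simp add: raise_def mv v)
qed

text \<open>Column j of the inverse metric is the gradient of the j-th coordinate, so its entries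
  follow from guessed vectors through \<open>raise_eqI\<close>.\<close>

lemma cometric_eq_raise: "cometric g $ i $ j = raise g (\<lambda>w. w $ j) $ i"
proof -
  have "raise g (\<lambda>w. w $ j) = cometric g *v axis j 1"
    unfolding raise_def by (rule arg_cong[where f="\<lambda>z. cometric g *v z"]) (auto simp: vec_eq_iff axis_def)
  then show ?thesis by (simp add: matrix_vector_mult_basis column_def)
qed

section \<open>The curvature tensors in a null frame\<close>

lemma vector_4 [simp]:
  "(vector [a, b, c, d] :: 'a::zero^4) $ 1 = a" "(vector [a, b, c, d] :: 'a^4) $ 2 = b"
  "(vector [a, b, c, d] :: 'a^4) $ 3 = c" "(vector [a, b, c, d] :: 'a^4) $ 4 = d"
  by (simp_all add: vector_def)

definition null_metric :: "4 form2" where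
  "null_metric x y = x $ 3 * y $ 3 + x $ 4 * y $ 4 - x $ 1 * y $ 2 - x $ 2 * y $ 1"

definition sphere_form :: "4 form2" where
  "sphere_form x y = x $ 3 * y $ 3 + x $ 4 * y $ 4"

definition null_square :: "real \<Rightarrow> 4 form2" where
  "null_square s x y = s * (x $ 1 * y $ 1)"

text \<open>With these coefficients the Ricci tensor of \<open>riem_model k s\<close> is \<open>null_square (2 * s)\<close>.\<close>

definition weyl_model :: "real \<Rightarrow> 4 form4" where
  "weyl_model k x y z w = k * (3 * kulkarni_nomizu null_metric sphere_form x y z w
     - kulkarni_nomizu null_metric null_metric x y z w
     - 3 * kulkarni_nomizu sphere_form sphere_form x y z w)"

definition riem_model :: "real \<Rightarrow> real \<Rightarrow> 4 form4" where
  "riem_model k s x y z w =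
     weyl_model k x y z w + kulkarni_nomizu null_metric (null_square s) x y z w"

abbreviation biv :: "real^4 \<Rightarrow> real^4 \<Rightarrow> 4 \<Rightarrow> 4 \<Rightarrow> real" where
  "biv x y i j \<equiv> x $ i * y $ j - x $ j * y $ i"

text \<open>The curvature as a symmetric form in the Pluecker coordinates of the planes (x, y) and
  (z, w): frame components can be read off, and pair symmetry and skewness become visible.\<close>

lemma riem_model_eq: "riem_model k s x y z w =
   k * (2 * biv x y 3 4 * biv z w 3 4 - 2 * biv x y 1 2 * biv z w 1 2
     + biv x y 1 3 * biv z w 2 3 + biv x y 2 3 * biv z w 1 3
     + biv x y 1 4 * biv z w 2 4 + biv x y 2 4 * biv z w 1 4)
   - s * (biv x y 1 3 * biv z w 1 3 + biv x y 1 4 * biv z w 1 4)"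
  unfolding riem_model_def weyl_model_def kulkarni_nomizu_def null_metric_def sphere_form_def
    null_square_def by algebra

lemma bilinear_null_metric: "bilinear null_metric"
  by (auto simp: bilinear_def null_metric_def algebra_simps intro!: linearI)

text \<open>Raising swaps the first two entries with a sign because the frame vectors 1 and 2 are
  null with product -1.\<close>

lemma raise_null_metric:
  assumes "\<And>w. \<alpha> w = a * w $ 1 + b * w $ 2 + c * w $ 3 + d * w $ 4"
  shows "raise null_metric \<alpha> = vector [- b, - a, c, d]"
proof (rule raise_eqI[OF bilinear_null_metric])
  fix x :: "real^4" assume "\<And>y. null_metric x y = 0"
  from this[of "axis 1 1"] this[of "axis 2 1"] this[of "axis 3 1"] this[of "axis 4 1"]
  show "x = 0" by (simp add: null_metric_def axis_def vec_eq_iff forall_4)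
qed (auto simp: null_metric_def assms algebra_simps)

lemma curv_endo_riem_model: "curv_endo null_metric (riem_model k s) x y z = vector
   [2 * k * biv x y 1 2 * z $ 1 + k * (biv x y 1 3 * z $ 3 + biv x y 1 4 * z $ 4),
    - 2 * k * biv x y 1 2 * z $ 2 + k * (biv x y 2 3 * z $ 3 + biv x y 2 4 * z $ 4)
      - s * (biv x y 1 3 * z $ 3 + biv x y 1 4 * z $ 4),
    - 2 * k * biv x y 3 4 * z $ 4 + k * (biv x y 2 3 * z $ 1 + biv x y 1 3 * z $ 2)
      - s * biv x y 1 3 * z $ 1,
    2 * k * biv x y 3 4 * z $ 3 + k * (biv x y 2 4 * z $ 1 + biv x y 1 4 * z $ 2)
      - s * biv x y 1 4 * z $ 1]"
proof -
  have "riem_model k s x y z w =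
    (2 * k * biv x y 1 2 * z $ 2 - k * (biv x y 2 3 * z $ 3 + biv x y 2 4 * z $ 4)
      + s * (biv x y 1 3 * z $ 3 + biv x y 1 4 * z $ 4)) * w $ 1 +
    (- 2 * k * biv x y 1 2 * z $ 1 - k * (biv x y 1 3 * z $ 3 + biv x y 1 4 * z $ 4)) * w $ 2 +
    (- 2 * k * biv x y 3 4 * z $ 4 + k * (biv x y 2 3 * z $ 1 + biv x y 1 3 * z $ 2)
      - s * biv x y 1 3 * z $ 1) * w $ 3 +
    (2 * k * biv x y 3 4 * z $ 3 + k * (biv x y 2 4 * z $ 1 + biv x y 1 4 * z $ 2)
      - s * biv x y 1 4 * z $ 1) * w $ 4" for w
    unfolding riem_model_eq by algebra
  from raise_null_metric[of "riem_model k s x y z", OF this]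
  show ?thesis unfolding curv_endo_def by (simp add: algebra_simps)
qed

text \<open>Lets the formulas for \<open>riem_model\<close> serve the Weyl tensor through
  \<open>s = 0\<close>.\<close>

lemma weyl_model_eq: "weyl_model k = riem_model k 0"
  by (simp add: fun_eq_iff riem_model_def null_square_def kulkarni_nomizu_def)

section \<open>Derivations on Kulkarni-Nomizu products\<close>

definition curv_act2 :: "'n::finite form2 \<Rightarrow> 'n form4 \<Rightarrow> 'n form2 \<Rightarrow> 'n form4" where
  "curv_act2 g D A a b x y = - A (curv_endo g D x y a) b - A a (curv_endo g D x y b)"

definition tachibana2 :: "'n::finite form2 \<Rightarrow> 'n form2 \<Rightarrow> 'n form4" where
  "tachibana2 A B a b x y = A x a * B y b + A x b * B a y - A y a * B x b - A y b * B a x"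

text \<open>Inserting an endomorphism into each slot in turn obeys the Leibniz rule, term by term in
  the product.\<close>

lemma curv_act_kulkarni_nomizu:
  "curv_act g D (kulkarni_nomizu A B) x1 x2 x3 x4 x y =
     kulkarni_nomizu (\<lambda>a b. curv_act2 g D A a b x y) B x1 x2 x3 x4
   + kulkarni_nomizu A (\<lambda>a b. curv_act2 g D B a b x y) x1 x2 x3 x4"
  unfolding curv_act_def curv_act2_def kulkarni_nomizu_def by (simp add: algebra_simps)

text \<open>\<open>Q(E, _)\<close> is the action of the endomorphism
  \<open>wedge_endo E x y\<close>, hence a derivation for the same reason as
  \<open>curv_act\<close>.\<close>

lemma tachibana_kulkarni_nomizu:
  "tachibana E (kulkarni_nomizu A B) x1 x2 x3 x4 x y =
     kulkarni_nomizu (\<lambda>a b. tachibana2 E A a b x y) B x1 x2 x3 x4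
   + kulkarni_nomizu A (\<lambda>a b. tachibana2 E B a b x y) x1 x2 x3 x4"
  unfolding tachibana_def tachibana2_def kulkarni_nomizu_def by (simp add: algebra_simps)

text \<open>The curvature operator is skew for the metric, so it annihilates
  \<open>null_metric\<close>. On the other two building blocks its action is a combination of
  Tachibana tensors, which is the source of the pseudosymmetry type conditions.\<close>

lemma curv_act2_model:
  "curv_act2 null_metric (riem_model k s) null_metric a b x y = 0"
  "curv_act2 null_metric (riem_model k s) sphere_form a b x y
     = k * tachibana2 null_metric sphere_form a b x y
       + tachibana2 (null_square s) sphere_form a b x y"
  "curv_act2 null_metric (riem_model k s) (null_square t) a b x y
     = k * (2 * tachibana2 (null_square t) null_metric a b x y
            - 3 * tachibana2 (null_square t) sphere_form a b x y)"
  unfolding curv_act2_def tachibana2_def curv_endo_riem_model null_metric_def sphere_form_def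
    null_square_def vector_4 by algebra+

text \<open>As the metric is annihilated, only the slots holding \<open>sphere_form\<close>
  contribute: weight 3 from the mixed product, and twice -3 from the square.\<close>

lemma curv_act_weyl_model:
  "curv_act null_metric (riem_model k s) (weyl_model t) x1 x2 x3 x4 x y =
     t * (3 * kulkarni_nomizu null_metric
         (\<lambda>a b. curv_act2 null_metric (riem_model k s) sphere_form a b x y) x1 x2 x3 x4
     - 6 * kulkarni_nomizu sphere_form
         (\<lambda>a b. curv_act2 null_metric (riem_model k s) sphere_form a b x y) x1 x2 x3 x4)"
proof -
  have "curv_act null_metric D (weyl_model t) x1 x2 x3 x4 x y =
     t * (3 * curv_act null_metric D (kulkarni_nomizu null_metric sphere_form) x1 x2 x3 x4 x y
     - curv_act null_metric D (kulkarni_nomizu null_metric null_metric) x1 x2 x3 x4 x y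
     - 3 * curv_act null_metric D (kulkarni_nomizu sphere_form sphere_form) x1 x2 x3 x4 x y)" for D
    unfolding curv_act_def weyl_model_def by algebra
  from this[of "riem_model k s"] show ?thesis
    unfolding curv_act_kulkarni_nomizu curv_act2_model(1) kulkarni_nomizu_def by algebra
qed

lemma curv_act_riem_model:
  "curv_act null_metric (riem_model k s) (riem_model t v) x1 x2 x3 x4 x y =
     curv_act null_metric (riem_model k s) (weyl_model t) x1 x2 x3 x4 x y
     + kulkarni_nomizu null_metric
         (\<lambda>a b. curv_act2 null_metric (riem_model k s) (null_square v) a b x y) x1 x2 x3 x4"
proof -
  have "curv_act null_metric D (riem_model t v) x1 x2 x3 x4 x y =
     curv_act null_metric D (weyl_model t) x1 x2 x3 x4 x y
     + curv_act null_metric D (kulkarni_nomizu null_metric (null_square v)) x1 x2 x3 x4 x y" for D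
    unfolding curv_act_def riem_model_def by algebra
  moreover have "kulkarni_nomizu (\<lambda>a b. curv_act2 null_metric (riem_model k s) null_metric a b x y) B
      x1 x2 x3 x4 = 0" for B
    by (simp add: curv_act2_model kulkarni_nomizu_def)
  ultimately show ?thesis by (simp add: curv_act_kulkarni_nomizu)
qed

text \<open>For a general \<open>A\<close> also \<open>Q(A, g)\<close> contributes. The two right
  factors are the partial derivatives of the polynomial \<open>3 g h - g g - 3 h h\<close> with
  respect to g and h.\<close>

lemma tachibana_weyl_model:
  "tachibana A (weyl_model k) x1 x2 x3 x4 x y =
     k * (kulkarni_nomizu (\<lambda>a b. tachibana2 A null_metric a b x y)
            (\<lambda>a b. 3 * sphere_form a b - 2 * null_metric a b) x1 x2 x3 x4
     + kulkarni_nomizu (\<lambda>a b. tachibana2 A sphere_form a b x y)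
            (\<lambda>a b. 3 * null_metric a b - 6 * sphere_form a b) x1 x2 x3 x4)"
proof -
  have "tachibana A (weyl_model k) x1 x2 x3 x4 x y =
     k * (3 * tachibana A (kulkarni_nomizu null_metric sphere_form) x1 x2 x3 x4 x y
     - tachibana A (kulkarni_nomizu null_metric null_metric) x1 x2 x3 x4 x y
     - 3 * tachibana A (kulkarni_nomizu sphere_form sphere_form) x1 x2 x3 x4 x y)"
    unfolding tachibana_def weyl_model_def by algebra
  then show ?thesis
    unfolding tachibana_kulkarni_nomizu kulkarni_nomizu_def by algebra
qed

lemma tachibana_riem_model:
  "tachibana A (riem_model k s) x1 x2 x3 x4 x y = tachibana A (weyl_model k) x1 x2 x3 x4 x y
     + kulkarni_nomizu (\<lambda>a b. tachibana2 A null_metric a b x y) (null_square s) x1 x2 x3 x4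
     + kulkarni_nomizu null_metric (\<lambda>a b. tachibana2 A (null_square s) a b x y) x1 x2 x3 x4"
proof -
  have "tachibana A (riem_model k s) x1 x2 x3 x4 x y = tachibana A (weyl_model k) x1 x2 x3 x4 x y
     + tachibana A (kulkarni_nomizu null_metric (null_square s)) x1 x2 x3 x4 x y"
    unfolding tachibana_def riem_model_def by algebra
  then show ?thesis by (simp add: tachibana_kulkarni_nomizu)
qed

lemma tachibana2_self:
  "tachibana2 null_metric null_metric a b x y = 0"
  "tachibana2 (null_square t) (null_square s) a b x y = 0"
  unfolding tachibana2_def null_metric_def null_square_def by algebra+

lemma tachibana2_scale:
  "tachibana2 (null_square (c * s)) B a b x y = c * tachibana2 (null_square s) B a b x y"
  unfolding tachibana2_def null_square_def by algebra

text \<open>For fixed x and y, \<open>Q(du \<otimes> du, g)\<close> is a symmetric product of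
  \<open>du\<close> with a covector; in its product with \<open>du \<otimes> du\<close> every term
  contains \<open>du \<and> du\<close>.\<close>

lemma kulkarni_nomizu_tachibana_null_square:
  "kulkarni_nomizu (\<lambda>a b. tachibana2 (null_square t) null_metric a b x y) (null_square s) x1 x2 x3 x4 = 0"
  unfolding kulkarni_nomizu_def tachibana2_def null_square_def by algebra

text \<open>The form \<open>null_metric - sphere_form\<close> is minus the symmetric product of the
  first two coordinates, so \<open>Q(du \<otimes> du, _)\<close> sends it to a multiple of
  \<open>du \<otimes> du\<close>. Multiplying that with the form itself again produces a factor
  \<open>du \<and> du\<close> in every term.\<close>

lemma kulkarni_nomizu_tachibana_difference:
  "kulkarni_nomizu (\<lambda>a b. tachibana2 (null_square t) null_metric a b x y
       - tachibana2 (null_square t) sphere_form a b x y)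
     (\<lambda>a b. null_metric a b - sphere_form a b) x1 x2 x3 x4 = 0"
  unfolding kulkarni_nomizu_def tachibana2_def null_square_def null_metric_def sphere_form_def by algebra

lemma kulkarni_nomizu_zero: "kulkarni_nomizu (\<lambda>a b. 0) B x1 x2 x3 x4 = 0"
  by (simp add: kulkarni_nomizu_def)

text \<open>At \<open>s = 0\<close> the derivations \<open>C \<cdot> _\<close> and
  \<open>k Q(g, _)\<close> agree on the metric, where both vanish, and on
  \<open>sphere_form\<close>; hence they agree on the Weyl model.\<close>

lemma curv_act_weyl_weyl: "curv_act null_metric (weyl_model k) (weyl_model k) x1 x2 x3 x4 x y
  = k * tachibana null_metric (weyl_model k) x1 x2 x3 x4 x y"
proof -
  have 0: "tachibana2 (null_square 0) B a b x y = 0" for B a b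
    by (simp add: tachibana2_def null_square_def)
  have "curv_act null_metric (weyl_model k) (weyl_model k) x1 x2 x3 x4 x y =
    curv_act null_metric (riem_model k 0) (weyl_model k) x1 x2 x3 x4 x y"
    by (simp add: weyl_model_eq)
  then show ?thesis
    unfolding tachibana_weyl_model tachibana2_self kulkarni_nomizu_zero
      curv_act_weyl_model curv_act2_model 0
    unfolding kulkarni_nomizu_def by algebra
qed

lemma curv_act_riem_riem:
  "curv_act null_metric (riem_model k s) (riem_model k s) x1 x2 x3 x4 x y
     - tachibana (null_square (2 * s)) (riem_model k s) x1 x2 x3 x4 x y
   = k * tachibana null_metric (weyl_model k) x1 x2 x3 x4 x y" (is "?L = ?R")
proof -
  \<comment> \<open>All terms with \<open>Q(g, h)\<close> cancel; the remaining
    \<open>Q(du \<otimes> du, _)\<close> terms, those from Q(S, R) doubled by the factor 2 in the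
    Ricci tensor, combine with the common coefficient 6.\<close>
  have "?L - ?R = 6 * k * kulkarni_nomizu
     (\<lambda>a b. tachibana2 (null_square s) null_metric a b x y
       - tachibana2 (null_square s) sphere_form a b x y)
     (\<lambda>a b. null_metric a b - sphere_form a b) x1 x2 x3 x4"
    unfolding curv_act_riem_model curv_act_weyl_model curv_act2_model
      tachibana_riem_model tachibana_weyl_model tachibana2_self tachibana2_scale
      kulkarni_nomizu_zero kulkarni_nomizu_tachibana_null_square[of "2 * s", unfolded tachibana2_scale]
    unfolding kulkarni_nomizu_def by algebra
  then show ?thesis by (simp add: kulkarni_nomizu_tachibana_difference)
qed

lemma curv_act_riem_weyl:
  "curv_act null_metric (riem_model k s) (weyl_model k) x1 x2 x3 x4 x y
     + curv_act null_metric (weyl_model k) (riem_model k s) x1 x2 x3 x4 x y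
   = 2 * k * tachibana null_metric (weyl_model k) x1 x2 x3 x4 x y
     + tachibana (null_square (2 * s)) (weyl_model k) x1 x2 x3 x4 x y" (is "?L = ?R")
proof -
  have 0: "tachibana2 (null_square 0) B a b x y = 0" for B a b
    by (simp add: tachibana2_def null_square_def)
  have CR: "curv_act null_metric (weyl_model k) (riem_model k s) x1 x2 x3 x4 x y =
    curv_act null_metric (riem_model k 0) (riem_model k s) x1 x2 x3 x4 x y"
    by (simp add: weyl_model_eq)
  \<comment> \<open>The residual is the same one as for
    \<open>R \<cdot> R - Q(S, R)\<close>.\<close>
  have "?L - ?R = 6 * k * kulkarni_nomizu
     (\<lambda>a b. tachibana2 (null_square s) null_metric a b x y
       - tachibana2 (null_square s) sphere_form a b x y)
     (\<lambda>a b. null_metric a b - sphere_form a b) x1 x2 x3 x4"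
    unfolding CR curv_act_riem_model curv_act_weyl_model curv_act2_model 0
      tachibana_weyl_model tachibana2_self tachibana2_scale kulkarni_nomizu_zero
    unfolding kulkarni_nomizu_def by algebra
  then show ?thesis by (simp add: kulkarni_nomizu_tachibana_difference)
qed

lemma axis_nth_4:
  "axis 1 (1::real) $ (1::4) = 1"
  "axis 1 (1::real) $ (2::4) = 0"
  "axis 1 (1::real) $ (3::4) = 0"
  "axis 1 (1::real) $ (4::4) = 0"
  "axis 2 (1::real) $ (1::4) = 0"
  "axis 2 (1::real) $ (2::4) = 1"
  "axis 2 (1::real) $ (3::4) = 0"
  "axis 2 (1::real) $ (4::4) = 0"
  "axis 3 (1::real) $ (1::4) = 0"
  "axis 3 (1::real) $ (2::4) = 0"
  "axis 3 (1::real) $ (3::4) = 1"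
  "axis 3 (1::real) $ (4::4) = 0"
  "axis 4 (1::real) $ (1::4) = 0"
  "axis 4 (1::real) $ (2::4) = 0"
  "axis 4 (1::real) $ (3::4) = 0"
  "axis 4 (1::real) $ (4::4) = 1"
  by (simp_all add: axis_def)

text \<open>Only the last pair of test vectors varies: (e1, e3) detects \<open>s\<close>, while (e2,
  e3) depends on \<open>k\<close> alone. In the first two equations \<open>t\<close> belongs to the
  tensor acted upon: \<open>t = s\<close> gives R and \<open>t = 0\<close> gives C.\<close>

lemma pseudosymmetry_witnesses:
  "curv_act null_metric (riem_model k s) (riem_model k t) (axis 1 1) (axis 2 1) (axis 1 1) (axis 3 1)
     (axis 1 1) (axis 3 1) = k * t - 3 * k * s"
  "curv_act null_metric (riem_model k s) (riem_model k t) (axis 1 1) (axis 2 1) (axis 1 1) (axis 3 1)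
     (axis 2 1) (axis 3 1) = 3 * k\<^sup>2"
  "tachibana null_metric (riem_model k s) (axis 1 1) (axis 2 1) (axis 1 1) (axis 3 1) (axis 1 1) (axis 3 1) = s"
  "tachibana null_metric (riem_model k s) (axis 1 1) (axis 2 1) (axis 1 1) (axis 3 1) (axis 2 1) (axis 3 1) = 3 * k"
  "tachibana (null_square t) (riem_model k s) (axis 1 1) (axis 2 1) (axis 1 1) (axis 3 1) (axis 1 1) (axis 3 1) = - k * t"
  "tachibana (null_square t) (riem_model k s) (axis 1 1) (axis 2 1) (axis 1 1) (axis 3 1) (axis 2 1) (axis 3 1) = 0"
  unfolding curv_act_def tachibana_def curv_endo_riem_model riem_model_eq weyl_model_eq vector_4 axis_nth_4
    null_metric_def null_square_def by (simp_all add: power2_eq_square algebra_simps)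

section \<open>Compatible tensors of the model\<close>

lemma bilinear_expand_4:
  fixes E :: "4 form2"
  assumes "bilinear E"
  shows "E x y = x $ 1 * E (axis 1 1) y + x $ 2 * E (axis 2 1) y + x $ 3 * E (axis 3 1) y
     + x $ 4 * E (axis 4 1) y"
    "E y x = x $ 1 * E y (axis 1 1) + x $ 2 * E y (axis 2 1) + x $ 3 * E y (axis 3 1)
     + x $ 4 * E y (axis 4 1)"
proof -
  have x: "x = x $ 1 *\<^sub>R axis 1 1 + x $ 2 *\<^sub>R axis 2 1 + x $ 3 *\<^sub>R axis 3 1 + x $ 4 *\<^sub>R axis 4 1"
    using basis_expansion[of x] by (simp add: sum_4 scalar_mult_eq_scaleR)
  interpret l: linear "\<lambda>x. E x y" using assms by (simp add: bilinear_def)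
  interpret r: linear "E y" using assms by (simp add: bilinear_def)
  show "E x y = x $ 1 * E (axis 1 1) y + x $ 2 * E (axis 2 1) y + x $ 3 * E (axis 3 1) y
     + x $ 4 * E (axis 4 1) y"
    by (subst x) (simp only: l.add l.scale real_scaleR_def)
  show "E y x = x $ 1 * E y (axis 1 1) + x $ 2 * E y (axis 2 1) + x $ 3 * E y (axis 3 1)
     + x $ 4 * E y (axis 4 1)"
    by (subst x) (simp only: r.add r.scale real_scaleR_def)
qed

lemma endo_null_metric:
  assumes "bilinear E"
  shows "endo null_metric E x =
    vector [- E x (axis 2 1), - E x (axis 1 1), E x (axis 3 1), E x (axis 4 1)]"
proof -
  have "E x w = E x (axis 1 1) * w $ 1 + E x (axis 2 1) * w $ 2 + E x (axis 3 1) * w $ 3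
      + E x (axis 4 1) * w $ 4" for w
    unfolding bilinear_expand_4(2)[OF assms, of x w] by (simp only: mult.commute)
  from raise_null_metric[of "E x", OF this] show ?thesis by (simp add: endo_def)
qed

text \<open>The matrices of (vii) for \<open>c = r m' / m\<close> and of (viii) for \<open>c = 0\<close>.\<close>

definition block_form :: "real \<Rightarrow> 4 form2 \<Rightarrow> bool" where
  "block_form c E \<longleftrightarrow> E (axis 2 1) (axis 1 1) = E (axis 1 1) (axis 2 1) + c * E (axis 2 1) (axis 2 1) \<and>
     E (axis 4 1) (axis 3 1) = E (axis 3 1) (axis 4 1) \<and>
     (\<forall>i\<in>{1, 2}. \<forall>j\<in>{3, 4}. E (axis i 1) (axis j 1) = 0 \<and> E (axis j 1) (axis i 1) = 0)"

text \<open>The free constant \<open>c\<close> treats the projective tensor together with the Riemann and Weyl tensors.\<close>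

lemma op_compatible_model_iff:
  assumes E: "bilinear E" and k: "k \<noteq> 0"
    and D: "\<And>x y z w. D x y z w = riem_model k s x y z w - c * wedge4 null_metric (null_square 1) x y z w"
  shows "(\<forall>x x1 x2 x3. D x2 x3 x (endo null_metric E x1) + D x3 x1 x (endo null_metric E x2)
       + D x1 x2 x (endo null_metric E x3) = 0) \<longleftrightarrow> block_form (s / k) E" (is "?L \<longleftrightarrow> ?R")
proof
  note D' = D[unfolded riem_model_eq wedge4_def wedge_endo_def null_square_def null_metric_def
      vector_minus_component vector_scaleR_component real_scaleR_def]
  assume ?L
  then have L: "D (axis j 1) (axis n 1) (axis l 1) (endo null_metric E (axis i 1))
       + D (axis n 1) (axis i 1) (axis l 1) (endo null_metric E (axis j 1))
       + D (axis i 1) (axis j 1) (axis l 1) (endo null_metric E (axis n 1)) = 0" for i j n l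
    by blast
  let ?e = "\<lambda>i j. E (axis i 1) (axis j 1)"
  note L = L[unfolded D' endo_null_metric[OF E] vector_4]
  \<comment> \<open>Each pair of transposed mixed entries satisfies two linear equations with
    coefficients (1, 2) and (2, 1), so both entries vanish. Since l is not 1 here, the term with
    \<open>c\<close> is absent.\<close>
  have "k * (?e 2 3 + 2 * ?e 3 2) = 0" using L[where i=1 and j=2 and n=3 and l=2, unfolded axis_nth_4, simplified] by algebra
  moreover have "k * (2 * ?e 2 3 + ?e 3 2) = 0" using L[where i=2 and j=3 and n=4 and l=4, unfolded axis_nth_4, simplified] by algebra
  moreover have "k * (?e 2 4 + 2 * ?e 4 2) = 0" using L[where i=1 and j=2 and n=4 and l=2, unfolded axis_nth_4, simplified] by algebra
  moreover have "k * (2 * ?e 2 4 + ?e 4 2) = 0" using L[where i=2 and j=3 and n=4 and l=3, unfolded axis_nth_4, simplified] by algebra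
  ultimately have 2: "?e 2 3 = 0" "?e 3 2 = 0" "?e 2 4 = 0" "?e 4 2 = 0" using k by auto
  \<comment> \<open>The equations with index 1 also contain mixed entries with index 2, hence this
    order of elimination.\<close>
  have "k * (?e 1 3 + 2 * ?e 3 1) = 0" using L[where i=1 and j=2 and n=3 and l=1, unfolded axis_nth_4 2, simplified] by algebra
  moreover have "k * (2 * ?e 1 3 + ?e 3 1) = 0" using L[where i=1 and j=3 and n=4 and l=4, unfolded axis_nth_4 2, simplified] by algebra
  moreover have "k * (?e 1 4 + 2 * ?e 4 1) = 0" using L[where i=1 and j=2 and n=4 and l=1, unfolded axis_nth_4 2, simplified] by algebra
  moreover have "k * (2 * ?e 1 4 + ?e 4 1) = 0" using L[where i=1 and j=3 and n=4 and l=3, unfolded axis_nth_4 2, simplified] by algebra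
  ultimately have 1: "?e 1 3 = 0" "?e 3 1 = 0" "?e 1 4 = 0" "?e 4 1 = 0" using k by auto
  have "k * (?e 3 4 - ?e 4 3) = 0" using L[where i=1 and j=3 and n=4 and l=2, unfolded axis_nth_4, simplified] by algebra
  then have 3: "?e 4 3 = ?e 3 4" using k by simp
  \<comment> \<open>Here \<open>s\<close> survives: this equation is the source of the coefficient
    \<open>s / k\<close>, and so of \<open>r m' / m\<close>.\<close>
  have "k * ?e 2 1 = k * ?e 1 2 + s * ?e 2 2" using L[where i=1 and j=2 and n=3 and l=3, unfolded axis_nth_4, simplified] by algebra
  then have "?e 2 1 = ?e 1 2 + s / k * ?e 2 2" using k by (simp add: field_simps)
  with 1 2 3 show ?R by (simp add: block_form_def)
next
  note D' = D[unfolded riem_model_eq wedge4_def wedge_endo_def null_square_def null_metric_def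
      vector_minus_component vector_scaleR_component real_scaleR_def]
  let ?e = "\<lambda>i j. E (axis i 1) (axis j 1)"
  assume ?R
  \<comment> \<open>Writing \<open>s = q * k\<close> removes the division, so that the final
    identity is polynomial.\<close>
  define q where "q = s / k"
  with k have s: "s = q * k" by simp
  from \<open>?R\<close> have *: "?e 2 1 = ?e 1 2 + q * ?e 2 2" "?e 4 3 = ?e 3 4" "?e 1 3 = 0" "?e 1 4 = 0" "?e 2 3 = 0" "?e 2 4 = 0"
     "?e 3 1 = 0" "?e 4 1 = 0" "?e 3 2 = 0" "?e 4 2 = 0"
    by (simp_all add: block_form_def q_def)
  have e: "endo null_metric E x = vector [- x $ 1 * ?e 1 2 - x $ 2 * ?e 2 2,
    - x $ 1 * ?e 1 1 - x $ 2 * (?e 1 2 + q * ?e 2 2),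
    x $ 3 * ?e 3 3 + x $ 4 * ?e 3 4, x $ 3 * ?e 3 4 + x $ 4 * ?e 4 4]" for x
    unfolding endo_null_metric[OF E]
    using * bilinear_expand_4(1)[OF E, of x "axis 1 1"] bilinear_expand_4(1)[OF E, of x "axis 2 1"]
      bilinear_expand_4(1)[OF E, of x "axis 3 1"] bilinear_expand_4(1)[OF E, of x "axis 4 1"]
    by (simp add: algebra_simps)
  \<comment> \<open>The term with \<open>c\<close> amounts, up to sign, to the first coordinate of
    \<open>x\<close> times the cyclic sum of first coordinates against the skew part of
    \<open>E\<close>. By the block form that skew part lives on the indices 1 and 2, so the sum
    vanishes.\<close>
  show ?L
    unfolding D' e vector_4 s by algebra
qed

section \<open>The null frame and the Christoffel symbols\<close>

definition null_coframe :: "(real \<Rightarrow> real) \<Rightarrow> real^4 \<Rightarrow> real^4 \<Rightarrow> real^4" where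
  "null_coframe m p x =
     vector [x $ 1, x $ 2 + (1 / 2 - m (p $ 1) / p $ 2) * x $ 1, p $ 2 * x $ 3, p $ 2 * sin (p $ 3) * x $ 4]"

definition null_frame :: "(real \<Rightarrow> real) \<Rightarrow> real^4 \<Rightarrow> real^4 \<Rightarrow> real^4" where
  "null_frame m p z =
     vector [z $ 1, z $ 2 - (1 / 2 - m (p $ 1) / p $ 2) * z $ 1, z $ 3 / p $ 2, z $ 4 / (p $ 2 * sin (p $ 3))]"

lemma null_coframe_null_frame:
  "0 < p $ 2 \<Longrightarrow> 0 < sin (p $ 3) \<Longrightarrow> null_coframe m p (null_frame m p z) = z"
  by (simp add: null_coframe_def null_frame_def vec_eq_iff forall_4)

lemma null_frame_null_coframe:
  "0 < p $ 2 \<Longrightarrow> 0 < sin (p $ 3) \<Longrightarrow> null_frame m p (null_coframe m p z) = z"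
  by (simp add: null_coframe_def null_frame_def vec_eq_iff forall_4)

lemma linear_null_coframe: "linear (null_coframe m p)"
  by (rule linearI) (simp_all add: null_coframe_def vec_eq_iff forall_4 algebra_simps add_divide_distrib)

lemma linear_null_frame: "linear (null_frame m p)"
  by (rule linearI) (simp_all add: null_frame_def vec_eq_iff forall_4 algebra_simps add_divide_distrib)

text \<open>Completing the product: \<open>F du^2 + 2 dr du = 2 du (dr + F/2 du)\<close> with
  \<open>F = 1 - 2m/r\<close>, which is where the coefficient \<open>1/2 - m/r\<close> of the
  coframe comes from.\<close>

lemma vaidya_eq: "p $ 2 \<noteq> 0 \<Longrightarrow>
    vaidya m p x y = null_metric (null_coframe m p x) (null_coframe m p y)"
  by (simp add: vaidya_def null_metric_def null_coframe_def field_simps power2_eq_square)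

lemma bilinear_vaidya: "bilinear (vaidya m p)"
  unfolding bilinear_def vaidya_def by (auto intro!: linearI simp: algebra_simps add_divide_distrib)

lemma raise_vaidya_eqI:
  assumes "0 < p $ 2" "0 < sin (p $ 3)" "\<And>w. vaidya m p v w = \<alpha> w"
  shows "raise (vaidya m p) \<alpha> = v"
proof (rule raise_eqI[OF bilinear_vaidya _ _ assms(3)])
  show "vaidya m p x y = vaidya m p y x" for x y
    by (simp add: vaidya_def algebra_simps)
  fix x assume "\<And>y. vaidya m p x y = 0"
  from this[of "axis 1 1"] this[of "axis 2 1"] this[of "axis 3 1"] this[of "axis 4 1"] assms
  show "x = 0" by (simp add: vaidya_def axis_nth_4 vec_eq_iff forall_4)
qed

text \<open>The coframe is an isometry onto the flat null metric and so intertwines the raising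
  maps; this transports \<open>curv_endo\<close> and \<open>endo\<close> to the model.\<close>

lemma null_coframe_raise:
  assumes "0 < p $ 2" "0 < sin (p $ 3)" "linear \<alpha>"
  shows "null_coframe m p (raise (vaidya m p) (\<lambda>w. \<alpha> (null_coframe m p w))) = raise null_metric \<alpha>"
proof -
  have \<alpha>: "\<alpha> w = \<alpha> (axis 1 1) * w $ 1 + \<alpha> (axis 2 1) * w $ 2 + \<alpha> (axis 3 1) * w $ 3 + \<alpha> (axis 4 1) * w $ 4" for w
  proof -
    interpret linear \<alpha> by fact
    have "\<alpha> w = \<alpha> (w $ 1 *\<^sub>R axis 1 1 + w $ 2 *\<^sub>R axis 2 1 + w $ 3 *\<^sub>R axis 3 1 + w $ 4 *\<^sub>R axis 4 1)"
      using basis_expansion[of w] by (simp add: sum_4 scalar_mult_eq_scaleR)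
    then show ?thesis by (simp add: add scale mult.commute)
  qed
  have "null_metric (raise null_metric \<alpha>) w = \<alpha> w" for w
    unfolding raise_null_metric[of \<alpha>, OF \<alpha>] \<alpha>[of w] by (simp add: null_metric_def)
  then have "raise (vaidya m p) (\<lambda>w. \<alpha> (null_coframe m p w)) = null_frame m p (raise null_metric \<alpha>)"
    using assms by (intro raise_vaidya_eqI) (simp_all add: vaidya_eq null_coframe_null_frame)
  then show ?thesis using assms by (simp add: null_coframe_null_frame)
qed

lemma cometric_vaidya:
  assumes "0 < p $ 2" "0 < sin (p $ 3)"
  shows "cometric (vaidya m p) = vector
    [vector [0, - 1, 0, 0], vector [- 1, 1 - 2 * m (p $ 1) / p $ 2, 0, 0],
     vector [0, 0, 1 / (p $ 2)\<^sup>2, 0], vector [0, 0, 0, 1 / (p $ 2 * sin (p $ 3))\<^sup>2]]"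
proof -
  have "raise (vaidya m p) (\<lambda>w. w $ 1) = vector [0, - 1, 0, 0]"
    "raise (vaidya m p) (\<lambda>w. w $ 2) = vector [- 1, 1 - 2 * m (p $ 1) / p $ 2, 0, 0]"
    "raise (vaidya m p) (\<lambda>w. w $ 3) = vector [0, 0, 1 / (p $ 2)\<^sup>2, 0]"
    "raise (vaidya m p) (\<lambda>w. w $ 4) = vector [0, 0, 0, 1 / (p $ 2 * sin (p $ 3))\<^sup>2]"
    using assms by (auto intro!: raise_vaidya_eqI simp: vaidya_def field_simps)
  then show ?thesis by (simp add: vec_eq_iff forall_4 cometric_eq_raise)
qed

lemma has_derivative_coord:
  assumes "(h has_real_derivative h') (at (p $ i))"
  shows "((\<lambda>q. h (q $ i)) has_derivative (\<lambda>v. h' * v $ i)) (at p)"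
  using has_derivative_compose[OF bounded_linear_imp_has_derivative[OF bounded_linear_vec_nth]
      assms[unfolded has_field_derivative_def]] by simp

lemma has_derivative_nth: "((\<lambda>q. q $ i) has_derivative (\<lambda>v. v $ i)) F"
  by (rule bounded_linear_imp_has_derivative[OF bounded_linear_vec_nth])

lemma has_derivative_vector_4:
  assumes "(f1 has_derivative f1') (at p)" "(f2 has_derivative f2') (at p)"
    "(f3 has_derivative f3') (at p)" "(f4 has_derivative f4') (at p)"
  shows "((\<lambda>q. vector [f1 q, f2 q, f3 q, f4 q] :: real^4) has_derivative
    (\<lambda>v. vector [f1' v, f2' v, f3' v, f4' v])) (at p)"
proof -
  have e: "vector [a, b, c, d] = a *\<^sub>R axis 1 1 + b *\<^sub>R axis 2 1 + c *\<^sub>R axis 3 1 + d *\<^sub>R (axis 4 1 :: real^4)"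
    for a b c d :: real
    by (simp add: vec_eq_iff forall_4 axis_nth_4)
  show ?thesis unfolding e using assms by (auto intro!: derivative_intros)
qed

lemma has_derivative_vaidya:
  assumes "p $ 2 \<noteq> 0" "(m has_real_derivative m1) (at (p $ 1))"
  shows "((\<lambda>q. vaidya m q x y) has_derivative (\<lambda>v.
    (2 * m1 * v $ 1 / p $ 2 - 2 * m (p $ 1) * v $ 2 / (p $ 2)\<^sup>2) * (x $ 1 * y $ 1)
    + 2 * p $ 2 * v $ 2 * (x $ 3 * y $ 3 + (sin (p $ 3))\<^sup>2 * (x $ 4 * y $ 4))
    + 2 * (p $ 2)\<^sup>2 * sin (p $ 3) * cos (p $ 3) * v $ 3 * (x $ 4 * y $ 4))) (at p)"
  unfolding vaidya_def
  using assms(1)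
  by (auto intro!: derivative_eq_intros has_derivative_coord[OF assms(2)] has_derivative_nth
      has_derivative_coord[OF DERIV_sin] ext simp: field_simps power2_eq_square)

lemmas frechet_derivative_vaidya =
  has_derivative_vaidya[THEN frechet_derivative_at, symmetric, THEN fun_cong]

definition vaidya_christoffel :: "(real \<Rightarrow> real) \<Rightarrow> real^4 \<Rightarrow> real^4 \<Rightarrow> real^4 \<Rightarrow> real^4" where
  "vaidya_christoffel m p x y = vector
    [- m (p $ 1) / (p $ 2)\<^sup>2 * (x $ 1 * y $ 1)
       + p $ 2 * (x $ 3 * y $ 3 + (sin (p $ 3))\<^sup>2 * (x $ 4 * y $ 4)),
     (- deriv m (p $ 1) / p $ 2 + (1 - 2 * m (p $ 1) / p $ 2) * m (p $ 1) / (p $ 2)\<^sup>2) * (x $ 1 * y $ 1)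
       + m (p $ 1) / (p $ 2)\<^sup>2 * (x $ 1 * y $ 2 + x $ 2 * y $ 1)
       - (p $ 2 - 2 * m (p $ 1)) * (x $ 3 * y $ 3 + (sin (p $ 3))\<^sup>2 * (x $ 4 * y $ 4)),
     (x $ 2 * y $ 3 + x $ 3 * y $ 2) / p $ 2 - sin (p $ 3) * cos (p $ 3) * (x $ 4 * y $ 4),
     (x $ 2 * y $ 4 + x $ 4 * y $ 2) / p $ 2
       + cos (p $ 3) / sin (p $ 3) * (x $ 3 * y $ 4 + x $ 4 * y $ 3)]"

text \<open>No inverse metric is multiplied out: the proposed vector is lowered and compared with
  the Koszul expression.\<close>

lemma christoffel_vaidya:
  assumes "0 < p $ 2" "0 < sin (p $ 3)" "(m has_real_derivative deriv m (p $ 1)) (at (p $ 1))"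
  shows "christoffel (vaidya m) p x y = vaidya_christoffel m p x y"
  unfolding christoffel_def
proof (rule raise_vaidya_eqI[OF assms(1,2)])
  have p: "p $ 2 \<noteq> 0" "sin (p $ 3) \<noteq> 0" using assms by auto
  fix w
  show "vaidya m p (vaidya_christoffel m p x y) w =
    (frechet_derivative (\<lambda>q. vaidya m q y w) (at p) x + frechet_derivative (\<lambda>q. vaidya m q x w) (at p) y
      - frechet_derivative (\<lambda>q. vaidya m q x y) (at p) w) / 2"
    unfolding frechet_derivative_vaidya[OF p(1) assms(3)]
    unfolding vaidya_def vaidya_christoffel_def vector_4
    using p by (simp add: divide_simps) algebra
qed

lemma frechet_derivative_vaidya_christoffel:
  assumes "0 < p $ 2" "0 < sin (p $ 3)" "(m has_real_derivative deriv m (p $ 1)) (at (p $ 1))"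
    "(deriv m has_real_derivative m2) (at (p $ 1))"
  shows "frechet_derivative (\<lambda>q. vaidya_christoffel m q x y) (at p) v = vector
    [(- deriv m (p $ 1) * v $ 1 / (p $ 2)\<^sup>2 + 2 * m (p $ 1) * v $ 2 / (p $ 2)^3) * (x $ 1 * y $ 1)
       + v $ 2 * (x $ 3 * y $ 3 + (sin (p $ 3))\<^sup>2 * (x $ 4 * y $ 4))
       + 2 * p $ 2 * sin (p $ 3) * cos (p $ 3) * v $ 3 * (x $ 4 * y $ 4),
     (- m2 * v $ 1 / p $ 2 + deriv m (p $ 1) * v $ 2 / (p $ 2)\<^sup>2 + deriv m (p $ 1) * v $ 1 / (p $ 2)\<^sup>2
       - 2 * m (p $ 1) * v $ 2 / (p $ 2)^3 - 4 * m (p $ 1) * deriv m (p $ 1) * v $ 1 / (p $ 2)^3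
       + 6 * (m (p $ 1))\<^sup>2 * v $ 2 / (p $ 2)^4) * (x $ 1 * y $ 1)
       + (deriv m (p $ 1) * v $ 1 / (p $ 2)\<^sup>2 - 2 * m (p $ 1) * v $ 2 / (p $ 2)^3) * (x $ 1 * y $ 2 + x $ 2 * y $ 1)
       - (v $ 2 - 2 * deriv m (p $ 1) * v $ 1) * (x $ 3 * y $ 3 + (sin (p $ 3))\<^sup>2 * (x $ 4 * y $ 4))
       - 2 * (p $ 2 - 2 * m (p $ 1)) * sin (p $ 3) * cos (p $ 3) * v $ 3 * (x $ 4 * y $ 4),
     - v $ 2 / (p $ 2)\<^sup>2 * (x $ 2 * y $ 3 + x $ 3 * y $ 2) - ((cos (p $ 3))\<^sup>2 - (sin (p $ 3))\<^sup>2) * v $ 3 * (x $ 4 * y $ 4),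
     - v $ 2 / (p $ 2)\<^sup>2 * (x $ 2 * y $ 4 + x $ 4 * y $ 2)
       - v $ 3 / (sin (p $ 3))\<^sup>2 * (x $ 3 * y $ 4 + x $ 4 * y $ 3)]" (is "_ = ?D v")
proof -
  have p: "p $ 2 \<noteq> 0" "sin (p $ 3) \<noteq> 0" using assms by auto
  note d = derivative_eq_intros has_derivative_coord[OF assms(3)] has_derivative_coord[OF assms(4)]
    has_derivative_nth has_derivative_coord[OF DERIV_sin] has_derivative_coord[OF DERIV_cos]
  have "((\<lambda>q. vaidya_christoffel m q x y) has_derivative ?D) (at p)"
    unfolding vaidya_christoffel_def
  proof (rule has_derivative_vector_4)
    show "((\<lambda>q. - m (q $ 1) / (q $ 2)\<^sup>2 * (x $ 1 * y $ 1)
       + q $ 2 * (x $ 3 * y $ 3 + (sin (q $ 3))\<^sup>2 * (x $ 4 * y $ 4))) has_derivative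
       (\<lambda>v. (- deriv m (p $ 1) * v $ 1 / (p $ 2)\<^sup>2 + 2 * m (p $ 1) * v $ 2 / (p $ 2)^3) * (x $ 1 * y $ 1)
       + v $ 2 * (x $ 3 * y $ 3 + (sin (p $ 3))\<^sup>2 * (x $ 4 * y $ 4))
       + 2 * p $ 2 * sin (p $ 3) * cos (p $ 3) * v $ 3 * (x $ 4 * y $ 4))) (at p)"
      using p by (auto intro!: d) (rule ext, simp add: divide_simps, algebra)
    show "((\<lambda>q. (- deriv m (q $ 1) / q $ 2 + (1 - 2 * m (q $ 1) / q $ 2) * m (q $ 1) / (q $ 2)\<^sup>2) * (x $ 1 * y $ 1)
       + m (q $ 1) / (q $ 2)\<^sup>2 * (x $ 1 * y $ 2 + x $ 2 * y $ 1)
       - (q $ 2 - 2 * m (q $ 1)) * (x $ 3 * y $ 3 + (sin (q $ 3))\<^sup>2 * (x $ 4 * y $ 4))) has_derivative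
       (\<lambda>v. (- m2 * v $ 1 / p $ 2 + deriv m (p $ 1) * v $ 2 / (p $ 2)\<^sup>2 + deriv m (p $ 1) * v $ 1 / (p $ 2)\<^sup>2
       - 2 * m (p $ 1) * v $ 2 / (p $ 2)^3 - 4 * m (p $ 1) * deriv m (p $ 1) * v $ 1 / (p $ 2)^3
       + 6 * (m (p $ 1))\<^sup>2 * v $ 2 / (p $ 2)^4) * (x $ 1 * y $ 1)
       + (deriv m (p $ 1) * v $ 1 / (p $ 2)\<^sup>2 - 2 * m (p $ 1) * v $ 2 / (p $ 2)^3) * (x $ 1 * y $ 2 + x $ 2 * y $ 1)
       - (v $ 2 - 2 * deriv m (p $ 1) * v $ 1) * (x $ 3 * y $ 3 + (sin (p $ 3))\<^sup>2 * (x $ 4 * y $ 4))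
       - 2 * (p $ 2 - 2 * m (p $ 1)) * sin (p $ 3) * cos (p $ 3) * v $ 3 * (x $ 4 * y $ 4))) (at p)"
      using p by (auto intro!: d) (rule ext, simp add: divide_simps, algebra)
    show "((\<lambda>q. (x $ 2 * y $ 3 + x $ 3 * y $ 2) / q $ 2 - sin (q $ 3) * cos (q $ 3) * (x $ 4 * y $ 4)) has_derivative
      (\<lambda>v. - v $ 2 / (p $ 2)\<^sup>2 * (x $ 2 * y $ 3 + x $ 3 * y $ 2)
        - ((cos (p $ 3))\<^sup>2 - (sin (p $ 3))\<^sup>2) * v $ 3 * (x $ 4 * y $ 4))) (at p)"
      using p by (auto intro!: d) (rule ext, simp add: divide_simps, algebra)
    \<comment> \<open>The derivative of the cotangent becomes \<open>- 1 / sin^2\<close> only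
      through this relation, and \<open>algebra\<close> treats sine and cosine as unrelated
      terms.\<close>
    have sc: "cos (p $ 3) * cos (p $ 3) = 1 - sin (p $ 3) * sin (p $ 3)"
      using sin_cos_squared_add[of "p $ 3"] by (simp add: power2_eq_square)
    show "((\<lambda>q. (x $ 2 * y $ 4 + x $ 4 * y $ 2) / q $ 2
       + cos (q $ 3) / sin (q $ 3) * (x $ 3 * y $ 4 + x $ 4 * y $ 3)) has_derivative
      (\<lambda>v. - v $ 2 / (p $ 2)\<^sup>2 * (x $ 2 * y $ 4 + x $ 4 * y $ 2)
       - v $ 3 / (sin (p $ 3))\<^sup>2 * (x $ 3 * y $ 4 + x $ 4 * y $ 3))) (at p)"
      using p by (auto intro!: d) (rule ext, simp add: divide_simps, use sc in algebra)
  qed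
  then show ?thesis by (rule frechet_derivative_at[symmetric, THEN fun_cong])
qed

lemma open_vaidya_domain:
  assumes "open I"
  shows "open (vaidya_domain I)"
proof -
  have "vaidya_domain I = (\<lambda>p. p $ 1) -` I \<inter> {p. 0 < p $ 2} \<inter> {p. 0 < p $ 3} \<inter> {p. p $ 3 < pi}
      \<inter> {p. 0 < p $ 4} \<inter> {p. p $ 4 < 2 * pi}"
    by (auto simp: vaidya_domain_def)
  then show ?thesis
    by (auto intro!: open_Int open_Collect_less continuous_intros open_vimage assms)
qed

section \<open>Curvature in coordinates and in the null frame\<close>

locale vaidya_mass =
  fixes m :: "real \<Rightarrow> real" and I :: "real set"
  assumes open_I: "open I" and smooth: "scalar_on I m"
begin

abbreviation "M \<equiv> vaidya_domain I"
abbreviation "\<kappa> p \<equiv> m (p $ 1) / (p $ 2)^3"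
abbreviation "\<sigma> p \<equiv> deriv m (p $ 1) / (p $ 2)\<^sup>2"

lemma domain:
  assumes "p \<in> M"
  shows "p $ 1 \<in> I" "0 < p $ 2" "0 < sin (p $ 3)" "p $ 2 \<noteq> 0" "sin (p $ 3) \<noteq> 0"
    "(m has_real_derivative deriv m (p $ 1)) (at (p $ 1))"
    "(deriv m has_real_derivative deriv (deriv m) (p $ 1)) (at (p $ 1))"
proof -
  show 1: "p $ 1 \<in> I" using assms by (simp add: vaidya_domain_def)
  show "0 < p $ 2" "0 < sin (p $ 3)" "p $ 2 \<noteq> 0" "sin (p $ 3) \<noteq> 0"
    using assms sin_gt_zero[of "p $ 3"] by (auto simp: vaidya_domain_def)
  show "(m has_real_derivative deriv m (p $ 1)) (at (p $ 1))"
    by (rule scalar_on_DERIV[OF smooth 1])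
  show "(deriv m has_real_derivative deriv (deriv m) (p $ 1)) (at (p $ 1))"
    by (rule scalar_on_DERIV[OF scalar_on_deriv[OF open_I smooth] 1])
qed

text \<open>Constant fields have vanishing bracket, and \<open>covd\<close> of a constant field is
  the explicit Christoffel vector on \<open>M\<close>; openness of \<open>M\<close> permits
  differentiating that equation.\<close>

lemma curv_op_vaidya:
  assumes p: "p \<in> M"
  shows "curv_op (vaidya m) (\<lambda>_. x) (\<lambda>_. y) (\<lambda>_. z) p =
    - frechet_derivative (\<lambda>q. vaidya_christoffel m q y z) (at p) x
    - vaidya_christoffel m p x (vaidya_christoffel m p y z)
    + frechet_derivative (\<lambda>q. vaidya_christoffel m q x z) (at p) y
    + vaidya_christoffel m p y (vaidya_christoffel m p x z)"
proof -
  have c: "christoffel (vaidya m) q a b = vaidya_christoffel m q a b" if "q \<in> M" for q a b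
    using domain[OF that] by (simp add: christoffel_vaidya)
  have e: "covd (vaidya m) (\<lambda>_. a) (\<lambda>_. b) q = vaidya_christoffel m q a b" if "q \<in> M" for q a b
    using c[OF that] by (simp add: covd_def frechet_derivative_const)
  have "frechet_derivative (covd (vaidya m) (\<lambda>_. a) (\<lambda>_. b)) (at p) =
      frechet_derivative (\<lambda>q. vaidya_christoffel m q a b) (at p)" for a b
    by (rule frechet_derivative_cong_open[OF open_vaidya_domain[OF open_I] p e])
  then have "covd (vaidya m) (\<lambda>_. d) (covd (vaidya m) (\<lambda>_. a) (\<lambda>_. b)) p =
      frechet_derivative (\<lambda>q. vaidya_christoffel m q a b) (at p) d
      + vaidya_christoffel m p d (vaidya_christoffel m p a b)" for a b d
    using c[OF p] e[OF p] by (simp add: covd_def[of _ _ "covd _ _ _"])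
  moreover have "covd (vaidya m) (lie_bracket (\<lambda>_. x) (\<lambda>_. y)) (\<lambda>_. z) p = 0"
    using c[OF p] by (simp add: covd_def lie_bracket_def frechet_derivative_const vaidya_christoffel_def
      vec_eq_iff forall_4)
  ultimately show ?thesis by (simp add: curv_op_def)
qed

text \<open>The curvature endomorphism is compared component by component, with no contraction
  against a fourth vector. The second derivative of \<open>m\<close> multiplies the product of the
  first coordinates of x, y and z, which is symmetric in x and y, so it cancels.\<close>

lemma null_coframe_curv_op:
  assumes p: "p \<in> M"
  shows "null_coframe m p (curv_op (vaidya m) (\<lambda>_. x) (\<lambda>_. y) (\<lambda>_. z) p) =
    curv_endo null_metric (riem_model (\<kappa> p) (\<sigma> p))
      (null_coframe m p x) (null_coframe m p y) (null_coframe m p z)"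
proof -
  note D = domain(2-)[OF p]
  have sc: "cos (p $ 3) ^2 = 1 - sin (p $ 3)^2"
    by (rule cos_squared_eq)
  note u = curv_op_vaidya[OF p] frechet_derivative_vaidya_christoffel[OF D(1,2,5,6)]
  note u2 = curv_endo_riem_model null_coframe_def vaidya_christoffel_def vector_4
    vector_add_component vector_minus_component vector_uminus_component
  have "null_coframe m p (curv_op (vaidya m) (\<lambda>_. x) (\<lambda>_. y) (\<lambda>_. z) p) $ 1 =
    curv_endo null_metric (riem_model (\<kappa> p) (\<sigma> p))
      (null_coframe m p x) (null_coframe m p y) (null_coframe m p z) $ 1"
    unfolding u unfolding u2
    using D(3,4) by (simp add: divide_simps) algebra
  moreover have "null_coframe m p (curv_op (vaidya m) (\<lambda>_. x) (\<lambda>_. y) (\<lambda>_. z) p) $ 2 =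
    curv_endo null_metric (riem_model (\<kappa> p) (\<sigma> p))
      (null_coframe m p x) (null_coframe m p y) (null_coframe m p z) $ 2"
    unfolding u unfolding u2
    using D(3,4) by (simp add: divide_simps) algebra
  moreover have "null_coframe m p (curv_op (vaidya m) (\<lambda>_. x) (\<lambda>_. y) (\<lambda>_. z) p) $ 3 =
    curv_endo null_metric (riem_model (\<kappa> p) (\<sigma> p))
      (null_coframe m p x) (null_coframe m p y) (null_coframe m p z) $ 3"
    unfolding u unfolding u2
    using D(3,4) by (simp add: divide_simps) (use sc in algebra)
  moreover have "null_coframe m p (curv_op (vaidya m) (\<lambda>_. x) (\<lambda>_. y) (\<lambda>_. z) p) $ 4 =
    curv_endo null_metric (riem_model (\<kappa> p) (\<sigma> p))
      (null_coframe m p x) (null_coframe m p y) (null_coframe m p z) $ 4"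
    unfolding u unfolding u2
    using D(3,4) by (simp add: divide_simps) (use sc in algebra)
  ultimately show ?thesis by (simp add: vec_eq_iff forall_4)
qed
end

lemma null_metric_curv_endo:
  "null_metric (curv_endo null_metric (riem_model k s) x y z) w = riem_model k s x y z w"
  unfolding curv_endo_riem_model riem_model_eq null_metric_def vector_4 by algebra

lemma linear_riem_model: "linear (riem_model k s x y z)"
  by (rule linearI) (simp_all add: riem_model_eq algebra_simps)

context vaidya_mass
begin

lemma Riem_vaidya:
  assumes "p \<in> M"
  shows "Riem (vaidya m) p x y z w = riem_model (\<kappa> p) (\<sigma> p)
    (null_coframe m p x) (null_coframe m p y) (null_coframe m p z) (null_coframe m p w)"
  using domain[OF assms]
  by (simp add: Riem_def vaidya_eq null_coframe_curv_op[OF assms] null_metric_curv_endo)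

text \<open>The Weyl part is trace-free, and the trace of \<open>g \<and> A\<close> in dimension 4
  is \<open>2 A + tr(A) g\<close>, where \<open>du \<otimes> du\<close> has trace 0.\<close>

lemma Ric_vaidya:
  assumes "p \<in> M"
  shows "Ric (vaidya m) p x y = 2 * \<sigma> p * (x $ 1 * y $ 1)"
  using domain[OF assms]
  unfolding Ric_def sum_4 Riem_vaidya[OF assms] cometric_vaidya[OF domain(2,3)[OF assms]]
    riem_model_eq null_coframe_def vector_4 axis_nth_4
  by (simp add: divide_simps) algebra

lemma Ric_null_square:
  assumes "p \<in> M"
  shows "Ric (vaidya m) p x y = null_square (2 * \<sigma> p) (null_coframe m p x) (null_coframe m p y)"
  by (simp add: Ric_vaidya[OF assms] null_square_def null_coframe_def)

lemma scal_vaidya: "p \<in> M \<Longrightarrow> scal (vaidya m) p = 0"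
  by (simp add: scal_def sum_4 Ric_vaidya cometric_vaidya domain axis_nth_4)

lemma kulkarni_nomizu_vaidya_Ric:
  assumes "p \<in> M"
  shows "kulkarni_nomizu (vaidya m p) (Ric (vaidya m) p) x y z w = 2 * kulkarni_nomizu null_metric
    (null_square (\<sigma> p)) (null_coframe m p x) (null_coframe m p y) (null_coframe m p z) (null_coframe m p w)"
  unfolding kulkarni_nomizu_def Ric_null_square[OF assms] vaidya_eq[OF domain(4)[OF assms]] null_square_def
  by algebra

lemma conharmonic_vaidya:
  assumes "p \<in> M"
  shows "conharmonic (vaidya m) p x y z w = weyl_model (\<kappa> p)
    (null_coframe m p x) (null_coframe m p y) (null_coframe m p z) (null_coframe m p w)"
  by (simp add: conharmonic_def Riem_vaidya[OF assms] kulkarni_nomizu_vaidya_Ric[OF assms] riem_model_def)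

lemma conformal_vaidya:
  "p \<in> M \<Longrightarrow> conformal (vaidya m) p = conharmonic (vaidya m) p"
  by (simp add: fun_eq_iff conformal_def scal_vaidya)

lemma concircular_vaidya:
  "p \<in> M \<Longrightarrow> concircular (vaidya m) p = Riem (vaidya m) p"
  by (simp add: fun_eq_iff concircular_def scal_vaidya)

lemma projective_vaidya:
  assumes "p \<in> M"
  shows "projective (vaidya m) p x y z w = riem_model (\<kappa> p) (\<sigma> p)
    (null_coframe m p x) (null_coframe m p y) (null_coframe m p z) (null_coframe m p w)
    - 2 * \<sigma> p / 3 * wedge4 null_metric (null_square 1)
    (null_coframe m p x) (null_coframe m p y) (null_coframe m p z) (null_coframe m p w)"
proof -
  have "wedge4 (vaidya m p) (Ric (vaidya m) p) x y z w = 2 * \<sigma> p * wedge4 null_metric (null_square 1)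
    (null_coframe m p x) (null_coframe m p y) (null_coframe m p z) (null_coframe m p w)"
    unfolding wedge4_def wedge_endo_def Ric_null_square[OF assms] vaidya_eq[OF domain(4)[OF assms]] null_square_def
      linear_diff[OF linear_null_coframe] linear_cmul[OF linear_null_coframe] null_metric_def
      vector_minus_component vector_scaleR_component real_scaleR_def
    by algebra
  then show ?thesis by (simp add: projective_def Riem_vaidya[OF assms])
qed

text \<open>The acting tensor takes the model form because its last index is raised;
  \<open>H\<close> may be anything pulled back by the coframe.\<close>

lemma curv_act_pullback:
  assumes p: "p \<in> M"
    and A: "\<And>x y z w. A x y z w = riem_model k s
      (null_coframe m p x) (null_coframe m p y) (null_coframe m p z) (null_coframe m p w)"
    and H: "\<And>x y z w. H x y z w = H0
      (null_coframe m p x) (null_coframe m p y) (null_coframe m p z) (null_coframe m p w)"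
  shows "curv_act (vaidya m p) A H x1 x2 x3 x4 x y = curv_act null_metric (riem_model k s) H0
    (null_coframe m p x1) (null_coframe m p x2) (null_coframe m p x3) (null_coframe m p x4)
    (null_coframe m p x) (null_coframe m p y)"
proof -
  have "null_coframe m p (curv_endo (vaidya m p) A a b c) = curv_endo null_metric (riem_model k s)
      (null_coframe m p a) (null_coframe m p b) (null_coframe m p c)" for a b c
  proof -
    have "A a b c = (\<lambda>w. riem_model k s (null_coframe m p a) (null_coframe m p b) (null_coframe m p c)
        (null_coframe m p w))"
      using A by blast
    then show ?thesis
      using null_coframe_raise[OF domain(2,3)[OF p] linear_riem_model] by (simp add: curv_endo_def)
  qed
  then show ?thesis by (simp add: curv_act_def H)
qed

lemma tachibana_pullback:
  assumes "\<And>x y. A x y = A0 (null_coframe m p x) (null_coframe m p y)"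
    and "\<And>x y z w. H x y z w = H0
      (null_coframe m p x) (null_coframe m p y) (null_coframe m p z) (null_coframe m p w)"
  shows "tachibana A H x1 x2 x3 x4 x y = tachibana A0 H0
    (null_coframe m p x1) (null_coframe m p x2) (null_coframe m p x3) (null_coframe m p x4)
    (null_coframe m p x) (null_coframe m p y)"
  by (simp add: tachibana_def assms)

lemma endo_pullback:
  assumes p: "p \<in> M" and E: "bilinear E"
  shows "null_coframe m p (endo (vaidya m p) E x) =
    endo null_metric (\<lambda>a b. E (null_frame m p a) (null_frame m p b)) (null_coframe m p x)"
proof -
  note d = domain(2,3)[OF p]
  have "linear (\<lambda>w. E x (null_frame m p w))"
    using linear_compose[OF linear_null_frame, of "E x" m p] E by (simp add: bilinear_def o_def)
  from null_coframe_raise[OF d this, of m] d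
  show ?thesis by (simp add: endo_def null_frame_null_coframe)
qed

text \<open>The frame arises by subtracting a multiple of the second coordinate vector from the
  first and rescaling the last two. The shift changes the entries (1,2) and (2,1) by the same
  multiple of the entry (2,2), so the relation between them keeps its constant
  \<open>c\<close>.\<close>

lemma block_form_pullback:
  assumes p: "p \<in> M" and E: "bilinear E"
  shows "block_form c (\<lambda>a b. E (null_frame m p a) (null_frame m p b)) \<longleftrightarrow> block_form c E"
proof -
  note d = domain[OF p]
  define f where "f = 1 / 2 - m (p $ 1) / p $ 2"
  define r where "r = p $ 2"
  define t where "t = p $ 2 * sin (p $ 3)"
  have rt: "r \<noteq> 0" "t \<noteq> 0" using d by (simp_all add: r_def t_def)
  have fr: "null_frame m p (axis 1 1) = axis 1 1 - f *\<^sub>R axis 2 1"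
    "null_frame m p (axis 2 1) = axis 2 1"
    "null_frame m p (axis 3 1) = inverse r *\<^sub>R axis 3 1"
    "null_frame m p (axis 4 1) = inverse t *\<^sub>R axis 4 1"
    by (simp_all add: null_frame_def f_def r_def t_def vec_eq_iff forall_4 axis_nth_4 inverse_eq_divide)
  show ?thesis
    unfolding block_form_def
    by (auto simp: fr bilinear_lsub[OF E] bilinear_rsub[OF E] bilinear_lmul[OF E] bilinear_rmul[OF E]
        rt algebra_simps)
qed

lemma op_compatible_at_iff:
  assumes p: "p \<in> M" and E: "bilinear E" and k: "k \<noteq> 0"
    and D: "\<And>x y z w. D x y z w = riem_model k s
      (null_coframe m p x) (null_coframe m p y) (null_coframe m p z) (null_coframe m p w)
      - c * wedge4 null_metric (null_square 1)
      (null_coframe m p x) (null_coframe m p y) (null_coframe m p z) (null_coframe m p w)"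
  shows "(\<forall>x x1 x2 x3. D x2 x3 x (endo (vaidya m p) E x1) + D x3 x1 x (endo (vaidya m p) E x2)
       + D x1 x2 x (endo (vaidya m p) E x3) = 0) \<longleftrightarrow> block_form (s / k) E" (is "?L \<longleftrightarrow> _")
proof -
  define E0 where "E0 = (\<lambda>a b. E (null_frame m p a) (null_frame m p b))"
  define D0 where "D0 = (\<lambda>x y z w. riem_model k s x y z w - c * wedge4 null_metric (null_square 1) x y z w)"
  have E0: "bilinear E0"
    using E linear_compose[OF linear_null_frame[of m p], of "E _"]
      linear_compose[OF linear_null_frame[of m p], of "\<lambda>a. E a _"]
    by (simp add: bilinear_def E0_def o_def)
  have D0: "D x y z w = D0 (null_coframe m p x) (null_coframe m p y) (null_coframe m p z) (null_coframe m p w)"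
    for x y z w by (simp add: D D0_def)
  note cf = null_coframe_null_frame[OF domain(2,3)[OF p]]
  have "?L \<longleftrightarrow> (\<forall>x x1 x2 x3. D0 x2 x3 x (endo null_metric E0 x1) + D0 x3 x1 x (endo null_metric E0 x2)
       + D0 x1 x2 x (endo null_metric E0 x3) = 0)"
    (is "_ \<longleftrightarrow> ?N")
  proof
    assume L: ?L
    show ?N
    proof (intro allI)
      fix x x1 x2 x3
      show "D0 x2 x3 x (endo null_metric E0 x1) + D0 x3 x1 x (endo null_metric E0 x2)
          + D0 x1 x2 x (endo null_metric E0 x3) = 0"
        \<comment> \<open>Every model vector is the coframe image of a frame vector, so both
          quantifications range over the same tuples.\<close>
        using L[rule_format, of "null_frame m p x2" "null_frame m p x3" "null_frame m p x" "null_frame m p x1"]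
        unfolding D0 endo_pullback[OF p E] E0_def[symmetric] cf .
    qed
  next
    assume ?N
    then show ?L unfolding D0 endo_pullback[OF p E] E0_def[symmetric] by blast
  qed
  also have "\<dots> \<longleftrightarrow> block_form (s / k) E0"
    by (rule op_compatible_model_iff[OF E0 k, where c = c]) (simp add: D0_def)
  finally show ?thesis
    using block_form_pullback[OF p E] by (simp add: E0_def)
qed

end

section \<open>Covariant derivatives\<close>

text \<open>The curvature formulas hold on the coordinate domain; covariant derivatives at
  \<open>p\<close> depend only on values near \<open>p\<close>.\<close>

lemma nabla2_cong_open:
  assumes "open U" "p \<in> U" "\<And>q. q \<in> U \<Longrightarrow> A q = B q"
  shows "nabla2 g A p = nabla2 g B p"
proof -
  have "frechet_derivative (\<lambda>q. A q y z) (at p) = frechet_derivative (\<lambda>q. B q y z) (at p)" for y z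
    by (rule frechet_derivative_cong_open[OF assms(1,2)]) (simp add: assms(3))
  with assms show ?thesis by (simp add: nabla2_def fun_eq_iff)
qed

lemma nabla4_cong_open:
  assumes "open U" "p \<in> U" "\<And>q. q \<in> U \<Longrightarrow> A q = B q"
  shows "nabla4 g A p = nabla4 g B p"
proof -
  have "frechet_derivative (\<lambda>q. A q x y z w) (at p) = frechet_derivative (\<lambda>q. B q x y z w) (at p)" for x y z w
    by (rule frechet_derivative_cong_open[OF assms(1,2)]) (simp add: assms(3))
  with assms show ?thesis by (simp add: nabla4_def fun_eq_iff)
qed

lemma nabla4_kulkarni_nomizu:
  assumes "\<And>x y. (\<lambda>q. A q x y) differentiable (at p)" "\<And>x y. (\<lambda>q. B q x y) differentiable (at p)"
  shows "nabla4 g (\<lambda>q. kulkarni_nomizu (A q) (B q)) p x y1 y2 y3 y4 =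
    kulkarni_nomizu (nabla2 g A p x) (B p) y1 y2 y3 y4 + kulkarni_nomizu (A p) (nabla2 g B p x) y1 y2 y3 y4"
proof -
  note d = assms[THEN frechet_derivative_works[THEN iffD1]]
  have "((\<lambda>q. kulkarni_nomizu (A q) (B q) y1 y2 y3 y4) has_derivative
    (\<lambda>v. kulkarni_nomizu (\<lambda>a b. frechet_derivative (\<lambda>q. A q a b) (at p) v) (B p) y1 y2 y3 y4
      + kulkarni_nomizu (A p) (\<lambda>a b. frechet_derivative (\<lambda>q. B q a b) (at p) v) y1 y2 y3 y4)) (at p)"
    unfolding kulkarni_nomizu_def
    by (rule has_derivative_eq_rhs, (rule d derivative_intros)+) (simp add: algebra_simps)
  then have "frechet_derivative (\<lambda>q. kulkarni_nomizu (A q) (B q) y1 y2 y3 y4) (at p) x =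
    kulkarni_nomizu (\<lambda>a b. frechet_derivative (\<lambda>q. A q a b) (at p) x) (B p) y1 y2 y3 y4
      + kulkarni_nomizu (A p) (\<lambda>a b. frechet_derivative (\<lambda>q. B q a b) (at p) x) y1 y2 y3 y4"
    by (rule frechet_derivative_at[symmetric, THEN fun_cong])
  then show ?thesis
    unfolding nabla4_def nabla2_def by (simp add: kulkarni_nomizu_def algebra_simps)
qed

lemma nabla4_scale:
  assumes "(f has_derivative f') (at p)" "(\<lambda>q. T q y1 y2 y3 y4) differentiable (at p)"
  shows "nabla4 g (\<lambda>q x y z w. f q * T q x y z w) p x y1 y2 y3 y4 =
    f' x * T p y1 y2 y3 y4 + f p * nabla4 g T p x y1 y2 y3 y4"
proof -
  have "((\<lambda>q. f q * T q y1 y2 y3 y4) has_derivative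
    (\<lambda>v. f p * frechet_derivative (\<lambda>q. T q y1 y2 y3 y4) (at p) v + f' v * T p y1 y2 y3 y4)) (at p)"
    using assms(1) assms(2)[THEN frechet_derivative_works[THEN iffD1]] by (rule has_derivative_mult)
  then have "frechet_derivative (\<lambda>q. f q * T q y1 y2 y3 y4) (at p) x =
    f p * frechet_derivative (\<lambda>q. T q y1 y2 y3 y4) (at p) x + f' x * T p y1 y2 y3 y4"
    by (rule frechet_derivative_at[symmetric, THEN fun_cong])
  then show ?thesis unfolding nabla4_def by (simp add: algebra_simps)
qed

lemma nabla4_add:
  assumes "(\<lambda>q. T q y1 y2 y3 y4) differentiable (at p)" "(\<lambda>q. T' q y1 y2 y3 y4) differentiable (at p)"
  shows "nabla4 g (\<lambda>q x y z w. T q x y z w + T' q x y z w) p x y1 y2 y3 y4 =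
    nabla4 g T p x y1 y2 y3 y4 + nabla4 g T' p x y1 y2 y3 y4"
proof -
  have "((\<lambda>q. T q y1 y2 y3 y4 + T' q y1 y2 y3 y4) has_derivative
    (\<lambda>v. frechet_derivative (\<lambda>q. T q y1 y2 y3 y4) (at p) v
      + frechet_derivative (\<lambda>q. T' q y1 y2 y3 y4) (at p) v)) (at p)"
    by (intro has_derivative_add assms[THEN frechet_derivative_works[THEN iffD1]])
  then have "frechet_derivative (\<lambda>q. T q y1 y2 y3 y4 + T' q y1 y2 y3 y4) (at p) x =
    frechet_derivative (\<lambda>q. T q y1 y2 y3 y4) (at p) x + frechet_derivative (\<lambda>q. T' q y1 y2 y3 y4) (at p) x"
    by (rule frechet_derivative_at[symmetric, THEN fun_cong])
  then show ?thesis unfolding nabla4_def by simp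
qed

lemma differentiable_kulkarni_nomizu:
  assumes "\<And>x y. (\<lambda>q. A q x y) differentiable (at p)" "\<And>x y. (\<lambda>q. B q x y) differentiable (at p)"
  shows "(\<lambda>q. kulkarni_nomizu (A q) (B q) y1 y2 y3 y4) differentiable (at p)"
  unfolding kulkarni_nomizu_def using assms by (intro derivative_intros) auto

section \<open>Coordinate tensor fields and the second Bianchi identity\<close>

definition round_part :: "real^4 \<Rightarrow> 4 form2" where
  "round_part p x y = (p $ 2)\<^sup>2 * (x $ 3 * y $ 3 + (sin (p $ 3))\<^sup>2 * (x $ 4 * y $ 4))"

definition weyl_shape :: "(real \<Rightarrow> real) \<Rightarrow> real^4 \<Rightarrow> 4 form4" where
  "weyl_shape m p x y z w = 3 * kulkarni_nomizu (vaidya m p) (round_part p) x y z w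
     - kulkarni_nomizu (vaidya m p) (vaidya m p) x y z w
     - 3 * kulkarni_nomizu (round_part p) (round_part p) x y z w"

definition weyl_shape' :: "(real \<Rightarrow> real) \<Rightarrow> real^4 \<Rightarrow> real^4 \<Rightarrow> 4 form4" where
  "weyl_shape' m p v x y z w = 3 * kulkarni_nomizu (vaidya m p) (\<lambda>a b. round_part p v a * b $ 2 + round_part p v b * a $ 2) x y z w
     - 6 * kulkarni_nomizu (round_part p) (\<lambda>a b. round_part p v a * b $ 2 + round_part p v b * a $ 2) x y z w"

definition ricci_shape :: "(real \<Rightarrow> real) \<Rightarrow> real^4 \<Rightarrow> 4 form4" where
  "ricci_shape m p = kulkarni_nomizu (vaidya m p) (\<lambda>a b. a $ 1 * b $ 1)"

definition ricci_shape' :: "(real \<Rightarrow> real) \<Rightarrow> real^4 \<Rightarrow> real^4 \<Rightarrow> 4 form4" where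
  "ricci_shape' m p v = kulkarni_nomizu (vaidya m p) (\<lambda>a b. round_part p v a * b $ 1 + round_part p v b * a $ 1)"

text \<open>The primed tensors are \<open>-r \<nabla>\<^sub>v\<close> of the unprimed ones, up to a multiple of \<open>du(v) ricci_shape\<close>;
  the next three identities are the coefficients of \<open>m\<close>, \<open>m'\<close> and \<open>m''\<close> in the second Bianchi identity.\<close>

lemma bianchi_mass:
  "x1 $ 2 * weyl_shape m p x2 x3 x y + x2 $ 2 * weyl_shape m p x3 x1 x y + x3 $ 2 * weyl_shape m p x1 x2 x y
    = - (weyl_shape' m p x1 x2 x3 x y + weyl_shape' m p x2 x3 x1 x y + weyl_shape' m p x3 x1 x2 x y) / 3"
proof -
  \<comment> \<open>With the linear forms \<open>r d\<theta>\<close> and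
    \<open>r sin \<theta> d\<phi>\<close> as atoms the sine disappears, and the claim is a
    polynomial identity.\<close>
  define a where "a = (\<lambda>v::real^4. p $ 2 * v $ 3)"
  define b where "b = (\<lambda>v::real^4. p $ 2 * sin (p $ 3) * v $ 4)"
  define F where "F = 1 - 2 * m (p $ 1) / p $ 2"
  have 1: "round_part p v w = a v * a w + b v * b w" for v w
    unfolding round_part_def a_def b_def by algebra
  have 2: "vaidya m p v w = - F * v $ 1 * w $ 1 - v $ 1 * w $ 2 - v $ 2 * w $ 1 + a v * a w + b v * b w" for v w
    unfolding vaidya_def a_def b_def F_def by algebra
  have "3 * (x1 $ 2 * weyl_shape m p x2 x3 x y + x2 $ 2 * weyl_shape m p x3 x1 x y + x3 $ 2 * weyl_shape m p x1 x2 x y)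
    = - (weyl_shape' m p x1 x2 x3 x y + weyl_shape' m p x2 x3 x1 x y + weyl_shape' m p x3 x1 x2 x y)"
    unfolding weyl_shape_def weyl_shape'_def kulkarni_nomizu_def 1 2 by algebra
  then show ?thesis by simp
qed

lemma bianchi_mass_flux:
  "x1 $ 1 * weyl_shape m p x2 x3 x y + x2 $ 1 * weyl_shape m p x3 x1 x y + x3 $ 1 * weyl_shape m p x1 x2 x y
    = 2 * (x1 $ 2 * ricci_shape m p x2 x3 x y + x2 $ 2 * ricci_shape m p x3 x1 x y + x3 $ 2 * ricci_shape m p x1 x2 x y)
     + ricci_shape' m p x1 x2 x3 x y + ricci_shape' m p x2 x3 x1 x y + ricci_shape' m p x3 x1 x2 x y"
proof -
  define a where "a = (\<lambda>v::real^4. p $ 2 * v $ 3)"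
  define b where "b = (\<lambda>v::real^4. p $ 2 * sin (p $ 3) * v $ 4)"
  define F where "F = 1 - 2 * m (p $ 1) / p $ 2"
  have 1: "round_part p v w = a v * a w + b v * b w" for v w
    unfolding round_part_def a_def b_def by algebra
  have 2: "vaidya m p v w = - F * v $ 1 * w $ 1 - v $ 1 * w $ 2 - v $ 2 * w $ 1 + a v * a w + b v * b w" for v w
    unfolding vaidya_def a_def b_def F_def by algebra
  show ?thesis
    unfolding weyl_shape_def ricci_shape_def ricci_shape'_def kulkarni_nomizu_def 1 2 by algebra
qed

lemma bianchi_null:
  "x1 $ 1 * ricci_shape m p x2 x3 x y + x2 $ 1 * ricci_shape m p x3 x1 x y + x3 $ 1 * ricci_shape m p x1 x2 x y = 0"
  unfolding ricci_shape_def kulkarni_nomizu_def vaidya_def by algebra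

lemma nabla2_linear:
  assumes "(\<lambda>q. A q y z) differentiable (at p)" "(\<lambda>q. B q y z) differentiable (at p)"
  shows "nabla2 g (\<lambda>q x y. a * A q x y + b * B q x y) p x y z = a * nabla2 g A p x y z + b * nabla2 g B p x y z"
proof -
  have "((\<lambda>q. a * A q y z + b * B q y z) has_derivative
    (\<lambda>v. a * frechet_derivative (\<lambda>q. A q y z) (at p) v + b * frechet_derivative (\<lambda>q. B q y z) (at p) v)) (at p)"
    by (intro derivative_intros assms[THEN frechet_derivative_works[THEN iffD1]])
  then have "frechet_derivative (\<lambda>q. a * A q y z + b * B q y z) (at p) x =
    a * frechet_derivative (\<lambda>q. A q y z) (at p) x + b * frechet_derivative (\<lambda>q. B q y z) (at p) x"
    by (rule frechet_derivative_at[symmetric, THEN fun_cong])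
  then show ?thesis unfolding nabla2_def by (simp add: algebra_simps)
qed

lemma has_derivative_round_part: "((\<lambda>q. round_part q x y) has_derivative (\<lambda>v.
    2 * p $ 2 * v $ 2 * (x $ 3 * y $ 3 + (sin (p $ 3))\<^sup>2 * (x $ 4 * y $ 4))
    + 2 * (p $ 2)\<^sup>2 * sin (p $ 3) * cos (p $ 3) * v $ 3 * (x $ 4 * y $ 4))) (at p)"
  unfolding round_part_def
  by (auto intro!: derivative_eq_intros has_derivative_nth has_derivative_coord[OF DERIV_sin] ext
      simp: algebra_simps power2_eq_square)

lemmas frechet_derivative_round_part =
  has_derivative_round_part[THEN frechet_derivative_at, symmetric, THEN fun_cong]

context vaidya_mass
begin

lemma differentiable_vaidya: "p \<in> M \<Longrightarrow> (\<lambda>q. vaidya m q x y) differentiable (at p)"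
  using has_derivative_vaidya domain(4,6) differentiableI by blast

lemma differentiable_round_part: "(\<lambda>q. round_part q x y) differentiable (at p)"
  using has_derivative_round_part differentiableI by blast

lemma nabla2_vaidya:
  assumes "p \<in> M"
  shows "nabla2 (vaidya m) (vaidya m) p x y z = 0"
  unfolding nabla2_def frechet_derivative_vaidya[OF domain(4,6)[OF assms]]
    christoffel_vaidya[OF domain(2,3,6)[OF assms]]
  unfolding vaidya_christoffel_def vaidya_def vector_4
  using domain(4,5)[OF assms] by (simp add: divide_simps) algebra

lemma nabla2_round_part:
  assumes "p \<in> M"
  shows "nabla2 (vaidya m) round_part p x y z =
    - (round_part p x y * z $ 2 + round_part p x z * y $ 2) / p $ 2"
  unfolding nabla2_def frechet_derivative_round_part
    christoffel_vaidya[OF domain(2,3,6)[OF assms]]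
  unfolding vaidya_christoffel_def round_part_def vector_4
  using domain(4,5)[OF assms] by (simp add: divide_simps) algebra

lemma nabla2_null_square:
  assumes "p \<in> M"
  shows "nabla2 (vaidya m) (\<lambda>q a b. a $ 1 * b $ 1) p x y z =
    2 * m (p $ 1) / (p $ 2)\<^sup>2 * (x $ 1 * y $ 1 * z $ 1)
    - (round_part p x y * z $ 1 + round_part p x z * y $ 1) / p $ 2"
  unfolding nabla2_def frechet_derivative_const
    christoffel_vaidya[OF domain(2,3,6)[OF assms]]
  unfolding vaidya_christoffel_def round_part_def vector_4
  using domain(4,5)[OF assms] by (simp add: divide_simps) algebra

lemma nabla4_weyl_shape:
  assumes p: "p \<in> M"
  shows "nabla4 (vaidya m) (weyl_shape m) p v x y z w = - weyl_shape' m p v x y z w / p $ 2"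
proof -
  \<comment> \<open>The shape is grouped as \<open>g \<and> (3 h - g) + h \<and> (- 3 h)\<close>,
    two products for the Leibniz rule. The coefficient 0 in \<open>?C\<close> gives both right
    factors the form required by \<open>nabla2_linear\<close>.\<close>
  let ?B = "\<lambda>q a b. 3 * round_part q a b + (- 1) * vaidya m q a b"
  let ?C = "\<lambda>q a b. (- 3) * round_part q a b + 0 * vaidya m q a b"
  note d = differentiable_vaidya[OF p] differentiable_round_part
  have dB: "(\<lambda>q. ?B q a b) differentiable (at p)" "(\<lambda>q. ?C q a b) differentiable (at p)" for a b
    by (intro derivative_intros d)+
  have "weyl_shape m = (\<lambda>q x y z w. kulkarni_nomizu (vaidya m q) (?B q) x y z w
      + kulkarni_nomizu (round_part q) (?C q) x y z w)"
    by (simp add: fun_eq_iff weyl_shape_def kulkarni_nomizu_def algebra_simps)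
  then have "nabla4 (vaidya m) (weyl_shape m) p v x y z w =
    nabla4 (vaidya m) (\<lambda>q. kulkarni_nomizu (vaidya m q) (?B q)) p v x y z w
    + nabla4 (vaidya m) (\<lambda>q. kulkarni_nomizu (round_part q) (?C q)) p v x y z w"
    using nabla4_add[where T = "\<lambda>q. kulkarni_nomizu (vaidya m q) (?B q)"
        and T' = "\<lambda>q. kulkarni_nomizu (round_part q) (?C q)"]
      differentiable_kulkarni_nomizu[where A = "vaidya m" and B = ?B, OF d(1) dB(1)]
      differentiable_kulkarni_nomizu[where A = round_part and B = ?C, OF d(2) dB(2)]
    by simp
  also have "\<dots> = kulkarni_nomizu (nabla2 (vaidya m) (vaidya m) p v) (?B p) x y z w
      + kulkarni_nomizu (vaidya m p) (nabla2 (vaidya m) ?B p v) x y z w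
      + kulkarni_nomizu (nabla2 (vaidya m) round_part p v) (?C p) x y z w
      + kulkarni_nomizu (round_part p) (nabla2 (vaidya m) ?C p v) x y z w"
    using nabla4_kulkarni_nomizu[where A = "vaidya m" and B = ?B, OF d(1) dB(1)]
      nabla4_kulkarni_nomizu[where A = round_part and B = ?C, OF d(2) dB(2)] by simp
  also have "\<dots> = - weyl_shape' m p v x y z w / p $ 2"
    unfolding kulkarni_nomizu_def weyl_shape'_def nabla2_linear[OF d(2) d(1)] nabla2_vaidya[OF p] nabla2_round_part[OF p]
    using domain(4)[OF p] by (simp add: divide_simps) algebra
  finally show ?thesis .
qed

lemma nabla4_ricci_shape:
  assumes p: "p \<in> M"
  shows "nabla4 (vaidya m) (ricci_shape m) p v x y z w =
    2 * m (p $ 1) / (p $ 2)\<^sup>2 * v $ 1 * ricci_shape m p x y z w - ricci_shape' m p v x y z w / p $ 2"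
proof -
  let ?B = "\<lambda>q a b. a $ 1 * b $ 1"
  have "ricci_shape m = (\<lambda>q. kulkarni_nomizu (vaidya m q) (?B q))"
    by (simp add: fun_eq_iff ricci_shape_def)
  then have "nabla4 (vaidya m) (ricci_shape m) p v x y z w =
      kulkarni_nomizu (nabla2 (vaidya m) (vaidya m) p v) (?B p) x y z w
      + kulkarni_nomizu (vaidya m p) (nabla2 (vaidya m) ?B p v) x y z w"
    using nabla4_kulkarni_nomizu[OF differentiable_vaidya[OF p], of ?B] by simp
  also have "\<dots> = 2 * m (p $ 1) / (p $ 2)\<^sup>2 * v $ 1 * ricci_shape m p x y z w - ricci_shape' m p v x y z w / p $ 2"
    unfolding kulkarni_nomizu_def ricci_shape_def ricci_shape'_def nabla2_vaidya[OF p] nabla2_null_square[OF p]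
    using domain(4)[OF p] by (simp add: divide_simps) algebra
  finally show ?thesis .
qed

lemma has_derivative_mass_term:
  assumes p: "p \<in> M"
  shows "(\<kappa> has_derivative (\<lambda>v. deriv m (p $ 1) * v $ 1 / (p $ 2)^3 - 3 * m (p $ 1) * v $ 2 / (p $ 2)^4)) (at p)"
    "(\<sigma> has_derivative (\<lambda>v. deriv (deriv m) (p $ 1) * v $ 1 / (p $ 2)\<^sup>2 - 2 * deriv m (p $ 1) * v $ 2 / (p $ 2)^3)) (at p)"
proof -
  note d = derivative_eq_intros has_derivative_coord[OF domain(6)[OF p]] has_derivative_coord[OF domain(7)[OF p]]
    has_derivative_nth
  show "(\<kappa> has_derivative (\<lambda>v. deriv m (p $ 1) * v $ 1 / (p $ 2)^3 - 3 * m (p $ 1) * v $ 2 / (p $ 2)^4)) (at p)"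
    using domain(4)[OF p] by (auto intro!: d) (rule ext, simp add: divide_simps, algebra)
  show "(\<sigma> has_derivative (\<lambda>v. deriv (deriv m) (p $ 1) * v $ 1 / (p $ 2)\<^sup>2 - 2 * deriv m (p $ 1) * v $ 2 / (p $ 2)^3)) (at p)"
    using domain(4)[OF p] by (auto intro!: d) (rule ext, simp add: divide_simps, algebra)
qed

text \<open>\<open>nabla4\<close> differentiates with fixed coordinate vectors while the coframe
  moves with the point; hence the model is rewritten through the fields \<open>vaidya\<close> and
  \<open>round_part\<close>, whose covariant derivatives are simple.\<close>

lemma conformal_shape:
  assumes "p \<in> M"
  shows "conformal (vaidya m) p = (\<lambda>x y z w. \<kappa> p * weyl_shape m p x y z w)"
proof -
  have "round_part p = (\<lambda>x y. sphere_form (null_coframe m p x) (null_coframe m p y))"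
    by (simp add: fun_eq_iff round_part_def sphere_form_def null_coframe_def algebra_simps power2_eq_square)
  then show ?thesis
    by (simp add: fun_eq_iff conformal_vaidya[OF assms] conharmonic_vaidya[OF assms] weyl_model_def
        weyl_shape_def kulkarni_nomizu_def vaidya_eq[OF domain(4)[OF assms]])
qed

lemma Riem_shape:
  assumes "p \<in> M"
  shows "Riem (vaidya m) p = (\<lambda>x y z w. \<kappa> p * weyl_shape m p x y z w + \<sigma> p * ricci_shape m p x y z w)"
proof -
  have "kulkarni_nomizu (vaidya m p) (Ric (vaidya m) p) x y z w = 2 * (\<sigma> p * ricci_shape m p x y z w)"
    for x y z w
    unfolding ricci_shape_def kulkarni_nomizu_def Ric_vaidya[OF assms] by algebra
  then have "Riem (vaidya m) p x y z w = conformal (vaidya m) p x y z w + \<sigma> p * ricci_shape m p x y z w"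
    for x y z w
    by (simp add: conformal_vaidya[OF assms] conharmonic_def)
  then show ?thesis by (simp add: fun_eq_iff conformal_shape[OF assms])
qed

lemma differentiable_shapes:
  assumes p: "p \<in> M"
  shows "(\<lambda>q. weyl_shape m q x y z w) differentiable (at p)"
    "(\<lambda>q. ricci_shape m q x y z w) differentiable (at p)"
  unfolding weyl_shape_def ricci_shape_def kulkarni_nomizu_def
  by (intro derivative_intros differentiable_vaidya[OF p] differentiable_round_part)+

lemma nabla4_conformal:
  assumes p: "p \<in> M"
  shows "nabla4 (vaidya m) (conformal (vaidya m)) p v x y z w =
    (deriv m (p $ 1) * v $ 1 / (p $ 2)^3 - 3 * m (p $ 1) * v $ 2 / (p $ 2)^4) * weyl_shape m p x y z w
    - m (p $ 1) / (p $ 2)^4 * weyl_shape' m p v x y z w"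
proof -
  have "nabla4 (vaidya m) (conformal (vaidya m)) p =
      nabla4 (vaidya m) (\<lambda>q x y z w. \<kappa> q * weyl_shape m q x y z w) p"
    by (rule nabla4_cong_open[OF open_vaidya_domain[OF open_I] p conformal_shape])
  then show ?thesis
    unfolding nabla4_scale[OF has_derivative_mass_term(1)[OF p] differentiable_shapes(1)[OF p]]
      nabla4_weyl_shape[OF p]
    by (simp add: nabla4_scale[OF has_derivative_mass_term(1)[OF p] differentiable_shapes(1)[OF p]]
      nabla4_weyl_shape[OF p] eval_nat_numeral)
qed

lemma nabla4_Riem:
  assumes p: "p \<in> M"
  shows "nabla4 (vaidya m) (Riem (vaidya m)) p v x y z w =
    nabla4 (vaidya m) (conformal (vaidya m)) p v x y z w
    + (deriv (deriv m) (p $ 1) * v $ 1 / (p $ 2)\<^sup>2 - 2 * deriv m (p $ 1) * v $ 2 / (p $ 2)^3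
       + 2 * m (p $ 1) * deriv m (p $ 1) / (p $ 2)^4 * v $ 1) * ricci_shape m p x y z w
    - deriv m (p $ 1) / (p $ 2)^3 * ricci_shape' m p v x y z w"
proof -
  note o = open_vaidya_domain[OF open_I]
  have C: "nabla4 (vaidya m) (conformal (vaidya m)) p =
      nabla4 (vaidya m) (\<lambda>q x y z w. \<kappa> q * weyl_shape m q x y z w) p"
    by (rule nabla4_cong_open[OF o p conformal_shape])
  have R: "nabla4 (vaidya m) (Riem (vaidya m)) p =
      nabla4 (vaidya m) (\<lambda>q x y z w. \<kappa> q * weyl_shape m q x y z w + \<sigma> q * ricci_shape m q x y z w) p"
    by (rule nabla4_cong_open[OF o p Riem_shape])
  have d: "(\<lambda>q. \<kappa> q * weyl_shape m q x y z w) differentiable (at p)"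
    "(\<lambda>q. \<sigma> q * ricci_shape m q x y z w) differentiable (at p)"
    by (rule differentiable_mult[OF differentiableI[OF has_derivative_mass_term(1)[OF p]] differentiable_shapes(1)[OF p]],
        rule differentiable_mult[OF differentiableI[OF has_derivative_mass_term(2)[OF p]] differentiable_shapes(2)[OF p]])
  show ?thesis
    unfolding C R
      nabla4_add[where T = "\<lambda>q x y z w. \<kappa> q * weyl_shape m q x y z w"
        and T' = "\<lambda>q x y z w. \<sigma> q * ricci_shape m q x y z w", OF d]
      nabla4_scale[OF has_derivative_mass_term(2)[OF p] differentiable_shapes(2)[OF p]] nabla4_ricci_shape[OF p]
    using domain(4)[OF p] by (simp add: field_simps eval_nat_numeral)
qed

text \<open>Differentiating the factor \<open>m / r^3\<close> gives a \<open>du\<close> term and a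
  \<open>dr\<close> term. By \<open>bianchi_mass\<close> the \<open>dr\<close> term cancels the
  cyclic sum of \<open>weyl_shape'\<close>; the \<open>du\<close> term is \<open>m' / m\<close>
  times the Weyl tensor.\<close>

lemma cyclic_nabla4_conformal:
  assumes p: "p \<in> M" and "m (p $ 1) \<noteq> 0"
  shows "nabla4 (vaidya m) (conformal (vaidya m)) p x1 x2 x3 x y
      + nabla4 (vaidya m) (conformal (vaidya m)) p x2 x3 x1 x y
      + nabla4 (vaidya m) (conformal (vaidya m)) p x3 x1 x2 x y =
    deriv m (p $ 1) / m (p $ 1) * x1 $ 1 * conformal (vaidya m) p x2 x3 x y
    + deriv m (p $ 1) / m (p $ 1) * x2 $ 1 * conformal (vaidya m) p x3 x1 x y
    + deriv m (p $ 1) / m (p $ 1) * x3 $ 1 * conformal (vaidya m) p x1 x2 x y"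
  unfolding nabla4_conformal[OF p] conformal_shape[OF p]
  using bianchi_mass[of x1 m p x2 x3 x y] domain(4)[OF p] assms(2)
  by (simp add: divide_simps) algebra

text \<open>Makes the left side of the recurrence equation for R vanish, leaving an algebraic
  condition on the 1-form.\<close>

lemma second_bianchi:
  assumes p: "p \<in> M"
  shows "nabla4 (vaidya m) (Riem (vaidya m)) p x1 x2 x3 x y
      + nabla4 (vaidya m) (Riem (vaidya m)) p x2 x3 x1 x y
      + nabla4 (vaidya m) (Riem (vaidya m)) p x3 x1 x2 x y = 0"
  unfolding nabla4_Riem[OF p] nabla4_conformal[OF p]
  using bianchi_mass[of x1 m p x2 x3 x y] bianchi_mass_flux[of x1 m p x2 x3 x y] bianchi_null[of x1 m p x2 x3 x y]
    domain(4)[OF p]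
  by (simp add: divide_simps) algebra

end

section \<open>The geometric conditions\<close>

lemma one_form_on_component:
  assumes "open U" "scalar_on U f"
  shows "one_form_on U (\<lambda>p x. f p * x $ i)"
  using assms by (auto simp: one_form_on_def algebra_simps intro!: linearI scalar_on_mult scalar_on_const)

lemma form_matrix_eq_iff:
  fixes A :: "4 form2"
  shows "form_matrix A = vector [vector [a11, a12, a13, a14], vector [a21, a22, a23, a24],
     vector [a31, a32, a33, a34], vector [a41, a42, a43, a44]] \<longleftrightarrow>
   A (axis 1 1) (axis 1 1) = a11 \<and> A (axis 1 1) (axis 2 1) = a12 \<and>
   A (axis 1 1) (axis 3 1) = a13 \<and> A (axis 1 1) (axis 4 1) = a14 \<and>
   A (axis 2 1) (axis 1 1) = a21 \<and> A (axis 2 1) (axis 2 1) = a22 \<and>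
   A (axis 2 1) (axis 3 1) = a23 \<and> A (axis 2 1) (axis 4 1) = a24 \<and>
   A (axis 3 1) (axis 1 1) = a31 \<and> A (axis 3 1) (axis 2 1) = a32 \<and>
   A (axis 3 1) (axis 3 1) = a33 \<and> A (axis 3 1) (axis 4 1) = a34 \<and>
   A (axis 4 1) (axis 1 1) = a41 \<and> A (axis 4 1) (axis 2 1) = a42 \<and>
   A (axis 4 1) (axis 3 1) = a43 \<and> A (axis 4 1) (axis 4 1) = a44"
  by (auto simp: form_matrix_def vec_eq_iff forall_4)

text \<open>Smoothness of the coefficients is automatic, as they are components of the smooth tensor
  \<open>E\<close>; what remains is the pointwise shape.\<close>

lemma RP_form_iff:
  assumes "tensor02_on U E"
  shows "RP_form m U E \<longleftrightarrow> (\<forall>p\<in>U. block_form (p $ 2 * deriv m (p $ 1) / m (p $ 1)) (E p))"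
proof
  assume "RP_form m U E"
  then show "\<forall>p\<in>U. block_form (p $ 2 * deriv m (p $ 1) / m (p $ 1)) (E p)"
    by (auto simp: RP_form_def block_form_def form_matrix_eq_iff)
next
  assume *: "\<forall>p\<in>U. block_form (p $ 2 * deriv m (p $ 1) / m (p $ 1)) (E p)"
  let ?a = "\<lambda>i j p. E p (axis i 1) (axis j 1)"
  have "scalar_on U (?a i j)" for i j using assms by (simp add: tensor02_on_def)
  then have 1: "\<forall>a\<in>{?a 1 1, ?a 1 2, ?a 2 2, ?a 3 3, ?a 4 3, ?a 4 4}. scalar_on U a"
    by simp
  have 2: "\<forall>p\<in>U. form_matrix (E p) = vector
       [vector [?a 1 1 p, ?a 1 2 p, 0, 0], vector [?a 1 2 p + p $ 2 * deriv m (p $ 1) / m (p $ 1) * ?a 2 2 p, ?a 2 2 p, 0, 0],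
        vector [0, 0, ?a 3 3 p, ?a 4 3 p], vector [0, 0, ?a 4 3 p, ?a 4 4 p]]"
    using * by (simp add: form_matrix_eq_iff block_form_def)
  show "RP_form m U E"
    unfolding RP_form_def
    by (rule exI[of _ "?a 1 1"], rule exI[of _ "?a 1 2"], rule exI[of _ "?a 2 2"], rule exI[of _ "?a 3 3"],
        rule exI[of _ "?a 4 3"], rule exI[of _ "?a 4 4"], rule conjI[OF 1 2])
qed

lemma CK_form_iff:
  assumes "tensor02_on U E"
  shows "CK_form U E \<longleftrightarrow> (\<forall>p\<in>U. block_form 0 (E p))"
proof
  assume "CK_form U E"
  then show "\<forall>p\<in>U. block_form 0 (E p)"
    by (auto simp: CK_form_def block_form_def form_matrix_eq_iff)
next
  assume *: "\<forall>p\<in>U. block_form 0 (E p)"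
  let ?a = "\<lambda>i j p. E p (axis i 1) (axis j 1)"
  have "scalar_on U (?a i j)" for i j using assms by (simp add: tensor02_on_def)
  then have 1: "\<forall>a\<in>{?a 1 1, ?a 1 2, ?a 2 2, ?a 3 3, ?a 3 4, ?a 4 4}. scalar_on U a"
    by simp
  have 2: "\<forall>p\<in>U. form_matrix (E p) = vector
       [vector [?a 1 1 p, ?a 1 2 p, 0, 0], vector [?a 1 2 p, ?a 2 2 p, 0, 0],
        vector [0, 0, ?a 3 3 p, ?a 3 4 p], vector [0, 0, ?a 3 4 p, ?a 4 4 p]]"
    using * by (simp add: form_matrix_eq_iff block_form_def)
  show "CK_form U E"
    unfolding CK_form_def
    by (rule exI[of _ "?a 1 1"], rule exI[of _ "?a 1 2"], rule exI[of _ "?a 2 2"], rule exI[of _ "?a 3 3"],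
        rule exI[of _ "?a 3 4"], rule exI[of _ "?a 4 4"], rule conjI[OF 1 2])
qed

lemma riem_model_symmetries:
  "riem_model k s x y z w = riem_model k s z w x y"
  "riem_model k s x y z w = - riem_model k s y x z w"
  unfolding riem_model_eq by algebra+

section \<open>Pseudosymmetry conditions on the coordinate domain\<close>

context vaidya_mass
begin

lemma ex_domain_point: "u \<in> I \<Longrightarrow> \<exists>p\<in>M. p $ 1 = u"
  by (rule bexI[of _ "vector [u, 1, pi / 2, pi]"]) (auto simp: vaidya_domain_def)

lemma conformal_weyl_model:
  "p \<in> M \<Longrightarrow> conformal (vaidya m) p x y z w = weyl_model (\<kappa> p)
    (null_coframe m p x) (null_coframe m p y) (null_coframe m p z) (null_coframe m p w)"
  by (simp add: conformal_vaidya conharmonic_vaidya)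

lemma pullbacks:
  assumes p: "p \<in> M"
  shows
    "curv_act (vaidya m p) (Riem (vaidya m) p) (Riem (vaidya m) p) x1 x2 x3 x4 x y
      = curv_act null_metric (riem_model (\<kappa> p) (\<sigma> p)) (riem_model (\<kappa> p) (\<sigma> p))
       (null_coframe m p x1) (null_coframe m p x2) (null_coframe m p x3) (null_coframe m p x4)
       (null_coframe m p x) (null_coframe m p y)"
    "curv_act (vaidya m p) (Riem (vaidya m) p) (conformal (vaidya m) p) x1 x2 x3 x4 x y
      = curv_act null_metric (riem_model (\<kappa> p) (\<sigma> p)) (weyl_model (\<kappa> p))
       (null_coframe m p x1) (null_coframe m p x2) (null_coframe m p x3) (null_coframe m p x4)
       (null_coframe m p x) (null_coframe m p y)"
    "curv_act (vaidya m p) (conformal (vaidya m) p) (Riem (vaidya m) p) x1 x2 x3 x4 x y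
      = curv_act null_metric (weyl_model (\<kappa> p)) (riem_model (\<kappa> p) (\<sigma> p))
       (null_coframe m p x1) (null_coframe m p x2) (null_coframe m p x3) (null_coframe m p x4)
       (null_coframe m p x) (null_coframe m p y)"
    "curv_act (vaidya m p) (conformal (vaidya m) p) (conformal (vaidya m) p) x1 x2 x3 x4 x y
      = curv_act null_metric (weyl_model (\<kappa> p)) (weyl_model (\<kappa> p))
       (null_coframe m p x1) (null_coframe m p x2) (null_coframe m p x3) (null_coframe m p x4)
       (null_coframe m p x) (null_coframe m p y)"
    "tachibana (vaidya m p) (Riem (vaidya m) p) x1 x2 x3 x4 x y
      = tachibana null_metric (riem_model (\<kappa> p) (\<sigma> p))
       (null_coframe m p x1) (null_coframe m p x2) (null_coframe m p x3) (null_coframe m p x4)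
       (null_coframe m p x) (null_coframe m p y)"
    "tachibana (vaidya m p) (conformal (vaidya m) p) x1 x2 x3 x4 x y
      = tachibana null_metric (weyl_model (\<kappa> p))
       (null_coframe m p x1) (null_coframe m p x2) (null_coframe m p x3) (null_coframe m p x4)
       (null_coframe m p x) (null_coframe m p y)"
    "tachibana (Ric (vaidya m) p) (Riem (vaidya m) p) x1 x2 x3 x4 x y
      = tachibana (null_square (2 * \<sigma> p)) (riem_model (\<kappa> p) (\<sigma> p))
       (null_coframe m p x1) (null_coframe m p x2) (null_coframe m p x3) (null_coframe m p x4)
       (null_coframe m p x) (null_coframe m p y)"
    "tachibana (Ric (vaidya m) p) (conformal (vaidya m) p) x1 x2 x3 x4 x y
      = tachibana (null_square (2 * \<sigma> p)) (weyl_model (\<kappa> p))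
       (null_coframe m p x1) (null_coframe m p x2) (null_coframe m p x3) (null_coframe m p x4)
       (null_coframe m p x) (null_coframe m p y)"
proof -
  \<comment> \<open>As an acting tensor C is presented as a \<open>riem_model\<close> with second
    parameter 0, to fit \<open>curv_act_pullback\<close>.\<close>
  note C0 = conformal_weyl_model[OF p, unfolded weyl_model_eq]
  show "curv_act (vaidya m p) (Riem (vaidya m) p) (Riem (vaidya m) p) x1 x2 x3 x4 x y
      = curv_act null_metric (riem_model (\<kappa> p) (\<sigma> p)) (riem_model (\<kappa> p) (\<sigma> p))
       (null_coframe m p x1) (null_coframe m p x2) (null_coframe m p x3) (null_coframe m p x4)
       (null_coframe m p x) (null_coframe m p y)"
    by (rule curv_act_pullback[where k = "\<kappa> p" and s = "\<sigma> p"
        and A = "Riem (vaidya m) p"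
        and H = "Riem (vaidya m) p" and H0 = "riem_model (\<kappa> p) (\<sigma> p)",
        OF p Riem_vaidya[OF p] Riem_vaidya[OF p]])
  show "curv_act (vaidya m p) (Riem (vaidya m) p) (conformal (vaidya m) p) x1 x2 x3 x4 x y
      = curv_act null_metric (riem_model (\<kappa> p) (\<sigma> p)) (weyl_model (\<kappa> p))
       (null_coframe m p x1) (null_coframe m p x2) (null_coframe m p x3) (null_coframe m p x4)
       (null_coframe m p x) (null_coframe m p y)"
    by (rule curv_act_pullback[where k = "\<kappa> p" and s = "\<sigma> p"
        and A = "Riem (vaidya m) p"
        and H = "conformal (vaidya m) p" and H0 = "weyl_model (\<kappa> p)",
        OF p Riem_vaidya[OF p] conformal_weyl_model[OF p]])
  show "curv_act (vaidya m p) (conformal (vaidya m) p) (Riem (vaidya m) p) x1 x2 x3 x4 x y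
      = curv_act null_metric (weyl_model (\<kappa> p)) (riem_model (\<kappa> p) (\<sigma> p))
       (null_coframe m p x1) (null_coframe m p x2) (null_coframe m p x3) (null_coframe m p x4)
       (null_coframe m p x) (null_coframe m p y)"
    using curv_act_pullback[where k = "\<kappa> p" and s = "0"
        and A = "conformal (vaidya m) p"
        and H = "Riem (vaidya m) p" and H0 = "riem_model (\<kappa> p) (\<sigma> p)",
        OF p C0 Riem_vaidya[OF p]]
    by (simp add: weyl_model_eq)
  show "curv_act (vaidya m p) (conformal (vaidya m) p) (conformal (vaidya m) p) x1 x2 x3 x4 x y
      = curv_act null_metric (weyl_model (\<kappa> p)) (weyl_model (\<kappa> p))
       (null_coframe m p x1) (null_coframe m p x2) (null_coframe m p x3) (null_coframe m p x4)
       (null_coframe m p x) (null_coframe m p y)"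
    using curv_act_pullback[where k = "\<kappa> p" and s = "0"
        and A = "conformal (vaidya m) p"
        and H = "conformal (vaidya m) p" and H0 = "weyl_model (\<kappa> p)",
        OF p C0 conformal_weyl_model[OF p]]
    by (simp add: weyl_model_eq)
  show "tachibana (vaidya m p) (Riem (vaidya m) p) x1 x2 x3 x4 x y
      = tachibana null_metric (riem_model (\<kappa> p) (\<sigma> p))
       (null_coframe m p x1) (null_coframe m p x2) (null_coframe m p x3) (null_coframe m p x4)
       (null_coframe m p x) (null_coframe m p y)"
    by (rule tachibana_pullback[where A = "vaidya m p"
        and A0 = "null_metric"
        and H = "Riem (vaidya m) p" and H0 = "riem_model (\<kappa> p) (\<sigma> p)",
        OF vaidya_eq[OF domain(4)[OF p]] Riem_vaidya[OF p]])
  show "tachibana (vaidya m p) (conformal (vaidya m) p) x1 x2 x3 x4 x y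
      = tachibana null_metric (weyl_model (\<kappa> p))
       (null_coframe m p x1) (null_coframe m p x2) (null_coframe m p x3) (null_coframe m p x4)
       (null_coframe m p x) (null_coframe m p y)"
    by (rule tachibana_pullback[where A = "vaidya m p"
        and A0 = "null_metric"
        and H = "conformal (vaidya m) p" and H0 = "weyl_model (\<kappa> p)",
        OF vaidya_eq[OF domain(4)[OF p]] conformal_weyl_model[OF p]])
  show "tachibana (Ric (vaidya m) p) (Riem (vaidya m) p) x1 x2 x3 x4 x y
      = tachibana (null_square (2 * \<sigma> p)) (riem_model (\<kappa> p) (\<sigma> p))
       (null_coframe m p x1) (null_coframe m p x2) (null_coframe m p x3) (null_coframe m p x4)
       (null_coframe m p x) (null_coframe m p y)"
    by (rule tachibana_pullback[where A = "Ric (vaidya m) p"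
        and A0 = "null_square (2 * \<sigma> p)"
        and H = "Riem (vaidya m) p" and H0 = "riem_model (\<kappa> p) (\<sigma> p)",
        OF Ric_null_square[OF p] Riem_vaidya[OF p]])
  show "tachibana (Ric (vaidya m) p) (conformal (vaidya m) p) x1 x2 x3 x4 x y
      = tachibana (null_square (2 * \<sigma> p)) (weyl_model (\<kappa> p))
       (null_coframe m p x1) (null_coframe m p x2) (null_coframe m p x3) (null_coframe m p x4)
       (null_coframe m p x) (null_coframe m p y)"
    by (rule tachibana_pullback[where A = "Ric (vaidya m) p"
        and A0 = "null_square (2 * \<sigma> p)"
        and H = "conformal (vaidya m) p" and H0 = "weyl_model (\<kappa> p)",
        OF Ric_null_square[OF p] conformal_weyl_model[OF p]])
qed

lemma pseudosymmetry_identities: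
  assumes "p \<in> M"
  shows "curv_act (vaidya m p) (conformal (vaidya m) p) (conformal (vaidya m) p) x1 x2 x3 x4 x y
      = \<kappa> p * tachibana (vaidya m p) (conformal (vaidya m) p) x1 x2 x3 x4 x y"
    "curv_act (vaidya m p) (Riem (vaidya m) p) (Riem (vaidya m) p) x1 x2 x3 x4 x y
        - tachibana (Ric (vaidya m) p) (Riem (vaidya m) p) x1 x2 x3 x4 x y
      = \<kappa> p * tachibana (vaidya m p) (conformal (vaidya m) p) x1 x2 x3 x4 x y"
    "curv_act (vaidya m p) (Riem (vaidya m) p) (conformal (vaidya m) p) x1 x2 x3 x4 x y
        + curv_act (vaidya m p) (conformal (vaidya m) p) (Riem (vaidya m) p) x1 x2 x3 x4 x y
      = 2 * m (p $ 1) / (p $ 2)^3 * tachibana (vaidya m p) (conformal (vaidya m) p) x1 x2 x3 x4 x y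
        + tachibana (Ric (vaidya m) p) (conformal (vaidya m) p) x1 x2 x3 x4 x y"
  unfolding pullbacks[OF assms]
  by (rule curv_act_weyl_weyl, rule curv_act_riem_riem, simp only: curv_act_riem_weyl times_divide_eq_right)

lemma kappa_nonzero: "p \<in> M \<Longrightarrow> m (p $ 1) \<noteq> 0 \<Longrightarrow> \<kappa> p \<noteq> 0"
  using domain(4) by simp

lemma sigma_nonzero: "p \<in> M \<Longrightarrow> deriv m (p $ 1) \<noteq> 0 \<Longrightarrow> \<sigma> p \<noteq> 0"
  using domain(4) by simp

lemma frame_witnesses:
  assumes p: "p \<in> M"
  defines "e \<equiv> \<lambda>i. null_frame m p (axis i 1)"
  shows "curv_act (vaidya m p) (Riem (vaidya m) p) (Riem (vaidya m) p) (e 1) (e 2) (e 1) (e 3) (e 1) (e 3)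
      = - 2 * \<kappa> p * \<sigma> p"
    "curv_act (vaidya m p) (Riem (vaidya m) p) (Riem (vaidya m) p) (e 1) (e 2) (e 1) (e 3) (e 2) (e 3)
      = 3 * (\<kappa> p)\<^sup>2"
    "curv_act (vaidya m p) (Riem (vaidya m) p) (conformal (vaidya m) p) (e 1) (e 2) (e 1) (e 3) (e 1) (e 3)
      = - 3 * \<kappa> p * \<sigma> p"
    "curv_act (vaidya m p) (Riem (vaidya m) p) (conformal (vaidya m) p) (e 1) (e 2) (e 1) (e 3) (e 2) (e 3)
      = 3 * (\<kappa> p)\<^sup>2"
    "tachibana (vaidya m p) (Riem (vaidya m) p) (e 1) (e 2) (e 1) (e 3) (e 1) (e 3) = \<sigma> p"
    "tachibana (vaidya m p) (Riem (vaidya m) p) (e 1) (e 2) (e 1) (e 3) (e 2) (e 3) = 3 * \<kappa> p"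
    "tachibana (vaidya m p) (conformal (vaidya m) p) (e 1) (e 2) (e 1) (e 3) (e 1) (e 3) = 0"
    "tachibana (Ric (vaidya m) p) (Riem (vaidya m) p) (e 1) (e 2) (e 1) (e 3) (e 2) (e 3) = 0"
  unfolding e_def pullbacks[OF p] null_coframe_null_frame[OF domain(2,3)[OF p]] weyl_model_eq pseudosymmetry_witnesses
  by simp_all

section \<open>The covariant derivative of the Ricci tensor\<close>

lemma nabla2_Ric:
  assumes p: "p \<in> M"
  shows "nabla2 (vaidya m) (Ric (vaidya m)) p x y z =
    2 * (deriv (deriv m) (p $ 1) * x $ 1 / (p $ 2)\<^sup>2 - 2 * deriv m (p $ 1) * x $ 2 / (p $ 2)^3) * (y $ 1 * z $ 1)
    + 2 * \<sigma> p * (2 * m (p $ 1) / (p $ 2)\<^sup>2 * (x $ 1 * y $ 1 * z $ 1)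
    - (round_part p x y * z $ 1 + round_part p x z * y $ 1) / p $ 2)"
proof -
  have e: "nabla2 (vaidya m) (Ric (vaidya m)) p = nabla2 (vaidya m) (\<lambda>q x y. 2 * \<sigma> q * (x $ 1 * y $ 1)) p"
    by (rule nabla2_cong_open[OF open_vaidya_domain[OF open_I] p]) (simp add: fun_eq_iff Ric_vaidya)
  have "((\<lambda>q. 2 * \<sigma> q * (y $ 1 * z $ 1)) has_derivative (\<lambda>v.
    2 * (deriv (deriv m) (p $ 1) * v $ 1 / (p $ 2)\<^sup>2 - 2 * deriv m (p $ 1) * v $ 2 / (p $ 2)^3) * (y $ 1 * z $ 1))) (at p)"
    by (intro has_derivative_mult_left has_derivative_mult_right has_derivative_mass_term[OF p])
  then have f: "frechet_derivative (\<lambda>q. 2 * \<sigma> q * (y $ 1 * z $ 1)) (at p) x =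
    2 * (deriv (deriv m) (p $ 1) * x $ 1 / (p $ 2)\<^sup>2 - 2 * deriv m (p $ 1) * x $ 2 / (p $ 2)^3) * (y $ 1 * z $ 1)"
    by (rule frechet_derivative_at[symmetric, THEN fun_cong])
  have n: "nabla2 (vaidya m) (\<lambda>q a b. a $ 1 * b $ 1) p x y z =
      - (christoffel (vaidya m) p x y $ 1 * z $ 1) - y $ 1 * christoffel (vaidya m) p x z $ 1"
    by (simp add: nabla2_def frechet_derivative_const)
  show ?thesis
    \<comment> \<open>\<open>nabla2_null_square\<close> is used backwards: the Christoffel terms
      then match on both sides without being expanded.\<close>
    unfolding e nabla2_null_square[OF p, symmetric] n
    unfolding nabla2_def f by algebra
qed

text \<open>The covariant derivative of \<open>du\<close> along \<theta> has a
  \<open>d\<theta>\<close> component. Since S vanishes on (1, 3) and (3, 3), this triple refutes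
  symmetry, cyclic parallelism, the Codazzi condition and, for every 1-form, recurrence of the Ricci
  1-forms.\<close>

lemma nabla2_Ric_witness:
  assumes "p \<in> M"
  shows "nabla2 (vaidya m) (Ric (vaidya m)) p (axis 3 1) (axis 1 1) (axis 3 1) = - 2 * \<sigma> p * p $ 2"
    "nabla2 (vaidya m) (Ric (vaidya m)) p (axis 3 1) (axis 3 1) (axis 1 1) = - 2 * \<sigma> p * p $ 2"
    "nabla2 (vaidya m) (Ric (vaidya m)) p (axis 1 1) (axis 3 1) (axis 3 1) = 0"
  using domain(4)[OF assms]
  by (simp_all add: nabla2_Ric[OF assms] round_part_def axis_nth_4 power2_eq_square)

lemma ricci_conditions_fail:
  assumes p: "p \<in> M" and "deriv m (p $ 1) \<noteq> 0"
  shows "\<not> ricci_flat M (vaidya m)" "\<not> ricci_symmetric M (vaidya m)" "\<not> einstein M (vaidya m)"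
    "\<not> ricci_cyclic_parallel M (vaidya m)" "\<not> ricci_codazzi M (vaidya m)"
    "\<not> ricci_1forms_recurrent M (vaidya m)"
proof -
  note r = domain(4)[OF p]
  have s: "\<sigma> p \<noteq> 0" using assms r by simp
  have R: "Ric (vaidya m) p (axis 1 1) (axis 1 1) = 2 * \<sigma> p" "Ric (vaidya m) p (axis 3 1) (axis 3 1) = 0"
    "Ric (vaidya m) p (axis 1 1) (axis 3 1) = 0"
    by (simp_all add: Ric_vaidya[OF p] axis_nth_4)
  note w = nabla2_Ric_witness[OF p]
  show "\<not> ricci_flat M (vaidya m)"
    using p R s unfolding ricci_flat_def by (metis mult_eq_0_iff zero_neq_numeral)
  show "\<not> ricci_symmetric M (vaidya m)"
  proof
    assume "ricci_symmetric M (vaidya m)"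
    then have "nabla2 (vaidya m) (Ric (vaidya m)) p (axis 3 1) (axis 1 1) (axis 3 1) = 0"
      using p by (simp add: ricci_symmetric_def)
    then show False using w s r by simp
  qed
  show "\<not> einstein M (vaidya m)"
  proof
    assume "einstein M (vaidya m)"
    then obtain a where a: "Ric (vaidya m) p x y = a * vaidya m p x y" for x y
      using p by (auto simp: einstein_def)
    from a[of "axis 3 1" "axis 3 1"] have "a = 0"
      using R r by (simp add: vaidya_def axis_nth_4)
    with a[of "axis 1 1" "axis 1 1"] show False using R s by simp
  qed
  show "\<not> ricci_cyclic_parallel M (vaidya m)"
  proof
    assume "ricci_cyclic_parallel M (vaidya m)"
    then have "nabla2 (vaidya m) (Ric (vaidya m)) p (axis 3 1) (axis 1 1) (axis 3 1)
      + nabla2 (vaidya m) (Ric (vaidya m)) p (axis 1 1) (axis 3 1) (axis 3 1)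
      + nabla2 (vaidya m) (Ric (vaidya m)) p (axis 3 1) (axis 3 1) (axis 1 1) = 0"
      using p unfolding ricci_cyclic_parallel_def by blast
    then show False using w s r by simp
  qed
  show "\<not> ricci_codazzi M (vaidya m)"
  proof
    assume "ricci_codazzi M (vaidya m)"
    then have "nabla2 (vaidya m) (Ric (vaidya m)) p (axis 3 1) (axis 1 1) (axis 3 1)
      = nabla2 (vaidya m) (Ric (vaidya m)) p (axis 1 1) (axis 3 1) (axis 3 1)"
      using p unfolding ricci_codazzi_def by blast
    then show False using w s r by simp
  qed
  show "\<not> ricci_1forms_recurrent M (vaidya m)"
  proof
    assume "ricci_1forms_recurrent M (vaidya m)"
    then obtain w' :: "real^4 \<Rightarrow> 4 form1" where "nabla2 (vaidya m) (Ric (vaidya m)) p (axis 3 1) (axis 1 1) (axis 3 1)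
      - nabla2 (vaidya m) (Ric (vaidya m)) p (axis 1 1) (axis 3 1) (axis 3 1)
      = w' p (axis 3 1) * Ric (vaidya m) p (axis 1 1) (axis 3 1)
        - w' p (axis 1 1) * Ric (vaidya m) p (axis 3 1) (axis 3 1)"
      using p unfolding ricci_1forms_recurrent_def by blast
    then show False using w s r R by simp
  qed
qed

lemma not_conformally_semisymmetric:
  assumes p: "p \<in> M" and "m (p $ 1) \<noteq> 0"
  shows "\<not> conformally_semisymmetric M (vaidya m)"
proof
  assume "conformally_semisymmetric M (vaidya m)"
  then have "3 * (\<kappa> p)\<^sup>2 = 0"
    using p frame_witnesses(4)[OF p] by (simp add: conformally_semisymmetric_def)
  then show False using kappa_nonzero[OF assms] by simp
qed

text \<open>The pair (e2, e3) forces L to be \<open>\<kappa> p\<close>, the pair (e1, e3) forces it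
  to be \<open>- 2 * \<kappa> p\<close>.\<close>

lemma not_deszcz_pseudosymmetric:
  assumes p: "p \<in> M" and m: "m (p $ 1) \<noteq> 0" and "deriv m (p $ 1) \<noteq> 0"
  shows "\<not> deszcz_pseudosymmetric M (vaidya m)"
proof
  assume "deszcz_pseudosymmetric M (vaidya m)"
  then obtain L where L: "\<forall>p\<in>M. \<forall>x1 x2 x3 x4 x y. curv_act (vaidya m p) (Riem (vaidya m) p) (Riem (vaidya m) p) x1 x2 x3 x4 x y
     = L p * tachibana (vaidya m p) (Riem (vaidya m) p) x1 x2 x3 x4 x y"
    using p unfolding deszcz_pseudosymmetric_def by blast
  have 1: "- 2 * \<kappa> p * \<sigma> p = L p * \<sigma> p" using bspec[OF L p] frame_witnesses(1,5)[OF p] by metis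
  have 2: "3 * (\<kappa> p)\<^sup>2 = L p * (3 * \<kappa> p)" using bspec[OF L p] frame_witnesses(2,6)[OF p] by metis
  have "False" if "- 2 * k * s = l * s" "3 * k\<^sup>2 = l * (3 * k)" "k \<noteq> 0" "s \<noteq> 0" for k s l :: real
    using that by (auto simp: power2_eq_square)
  from this[OF 1 2 kappa_nonzero[OF p m] sigma_nonzero[OF p assms(3)]] show False .
qed

text \<open>On the pair (e1, e3) the tensor Q(g, C) vanishes, but \<open>R \<cdot> C\<close> does
  not.\<close>

lemma not_weyl_pseudosymmetric:
  assumes p: "p \<in> M" and m: "m (p $ 1) \<noteq> 0" and "deriv m (p $ 1) \<noteq> 0"
  shows "\<not> weyl_pseudosymmetric M (vaidya m)"
proof
  assume "weyl_pseudosymmetric M (vaidya m)"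
  then obtain L where L: "\<forall>p\<in>M. \<forall>x1 x2 x3 x4 x y. curv_act (vaidya m p) (Riem (vaidya m) p) (conformal (vaidya m) p) x1 x2 x3 x4 x y
     = L p * tachibana (vaidya m p) (conformal (vaidya m) p) x1 x2 x3 x4 x y"
    using p unfolding weyl_pseudosymmetric_def by blast
  have "- 3 * \<kappa> p * \<sigma> p = L p * 0" using bspec[OF L p] frame_witnesses(3,7)[OF p] by metis
  then show False using kappa_nonzero[OF p m] sigma_nonzero[OF p assms(3)] by simp
qed

lemma not_ricci_generalized_pseudosymmetric:
  assumes p: "p \<in> M" and m: "m (p $ 1) \<noteq> 0"
  shows "\<not> ricci_generalized_pseudosymmetric M (vaidya m)"
proof
  assume "ricci_generalized_pseudosymmetric M (vaidya m)"
  then obtain L where L: "\<forall>p\<in>M. \<forall>x1 x2 x3 x4 x y. curv_act (vaidya m p) (Riem (vaidya m) p) (Riem (vaidya m) p) x1 x2 x3 x4 x y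
     = L p * tachibana (Ric (vaidya m) p) (Riem (vaidya m) p) x1 x2 x3 x4 x y"
    using p unfolding ricci_generalized_pseudosymmetric_def by blast
  have "3 * (\<kappa> p)\<^sup>2 = L p * 0" using bspec[OF L p] frame_witnesses(2,8)[OF p] by metis
  then show False using kappa_nonzero[OF p m] by simp
qed

lemma not_conformally_recurrent:
  assumes p: "p \<in> M" and m: "m (p $ 1) \<noteq> 0"
  shows "\<not> conformally_recurrent M (vaidya m)"
proof
  assume "conformally_recurrent M (vaidya m)"
  \<comment> \<open>The component (r, \<phi>, \<phi>, \<theta>) of C is 0, but that of its covariant
    derivative along \<theta> is not, since this derivative mixes \<open>dr\<close> with
    \<open>d\<theta>\<close>.\<close>
  then obtain w :: "real^4 \<Rightarrow> 4 form1" where "nabla4 (vaidya m) (conformal (vaidya m)) p (axis 3 1) (axis 2 1) (axis 4 1) (axis 4 1) (axis 3 1)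
      = w p (axis 3 1) * conformal (vaidya m) p (axis 2 1) (axis 4 1) (axis 4 1) (axis 3 1)"
    using p unfolding conformally_recurrent_def by blast
  then show False
    using domain(4,5)[OF p] m
    by (simp add: nabla4_conformal[OF p] conformal_shape[OF p] weyl_shape_def weyl_shape'_def kulkarni_nomizu_def
        vaidya_def round_part_def axis_nth_4)
qed

text \<open>By the second Bianchi identity the recurrence equation says that the wedge of the 1-form
  with R is 0. The frame components of R on the planes (1, 2) and (3, 4) are nonzero and force the
  1-form to vanish.\<close>

lemma not_curv_2forms_recurrent_Riem:
  assumes m: "\<forall>u\<in>I. m u \<noteq> 0"
  shows "\<not> curv_2forms_recurrent M (vaidya m) (Riem (vaidya m))"
proof
  assume "curv_2forms_recurrent M (vaidya m) (Riem (vaidya m))"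
  then obtain w p x where w: "curv_2forms_recurrent_for M (vaidya m) (Riem (vaidya m)) w"
    and p: "p \<in> M" and x: "w p x \<noteq> 0"
    unfolding curv_2forms_recurrent_def by blast
  interpret linear "w p"
    using w p by (simp add: curv_2forms_recurrent_for_def one_form_on_def)
  let ?e = "\<lambda>i. null_frame m p (axis i 1)"
  have k: "\<kappa> p \<noteq> 0" using kappa_nonzero[OF p] domain(1)[OF p] m by blast
  have *: "w p x1 * Riem (vaidya m) p x2 x3 a b + w p x2 * Riem (vaidya m) p x3 x1 a b
      + w p x3 * Riem (vaidya m) p x1 x2 a b = 0" for x1 x2 x3 a b
    using w p second_bianchi[OF p] by (simp add: curv_2forms_recurrent_for_def)
  note R = Riem_vaidya[OF p] null_coframe_null_frame[OF domain(2,3)[OF p]] riem_model_eq axis_nth_4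
  \<comment> \<open>Each frame vector is completed by the pair (3, 4) or (1, 2) that does not
    contain it. Only one of the three terms survives, with factor \<open>2 * \<kappa> p\<close> up
    to sign.\<close>
  have e: "w p (?e 1) = 0" "w p (?e 2) = 0" "w p (?e 3) = 0" "w p (?e 4) = 0"
    using k *[of "?e 1" "?e 3" "?e 4" "?e 3" "?e 4"] *[of "?e 2" "?e 3" "?e 4" "?e 3" "?e 4"]
      *[of "?e 3" "?e 1" "?e 2" "?e 1" "?e 2"] *[of "?e 4" "?e 1" "?e 2" "?e 1" "?e 2"]
    unfolding R by simp_all
  define z where "z = null_coframe m p x"
  have "z = z $ 1 *\<^sub>R axis 1 1 + z $ 2 *\<^sub>R axis 2 1 + z $ 3 *\<^sub>R axis 3 1 + z $ 4 *\<^sub>R axis 4 1"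
    by (simp add: vec_eq_iff forall_4 axis_nth_4)
  then have "null_frame m p z = z $ 1 *\<^sub>R ?e 1 + z $ 2 *\<^sub>R ?e 2 + z $ 3 *\<^sub>R ?e 3 + z $ 4 *\<^sub>R ?e 4"
    by (metis linear_add[OF linear_null_frame] linear_cmul[OF linear_null_frame])
  then have "x = z $ 1 *\<^sub>R ?e 1 + z $ 2 *\<^sub>R ?e 2 + z $ 3 *\<^sub>R ?e 3 + z $ 4 *\<^sub>R ?e 4"
    using null_frame_null_coframe[OF domain(2,3)[OF p]] by (simp add: z_def)
  then have "w p x = w p (z $ 1 *\<^sub>R ?e 1 + z $ 2 *\<^sub>R ?e 2 + z $ 3 *\<^sub>R ?e 3 + z $ 4 *\<^sub>R ?e 4)"
    by (rule arg_cong)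
  then have "w p x = 0" by (simp add: add scale e)
  with x show False by simp
qed

section \<open>Compatible tensors for R, P, C and K\<close>

lemma op_compatible_iff:
  assumes m: "\<forall>u\<in>I. m u \<noteq> 0" and E: "\<And>p. p \<in> M \<Longrightarrow> bilinear (E p)"
    and D: "\<And>p x y z w. p \<in> M \<Longrightarrow> D p x y z w = riem_model (\<kappa> p) (s p)
      (null_coframe m p x) (null_coframe m p y) (null_coframe m p z) (null_coframe m p w)
      - c p * wedge4 null_metric (null_square 1)
      (null_coframe m p x) (null_coframe m p y) (null_coframe m p z) (null_coframe m p w)"
  shows "op_compatible M (vaidya m) D E \<longleftrightarrow> (\<forall>p\<in>M. block_form (s p / \<kappa> p) (E p))"
  unfolding op_compatible_def
proof (rule ball_cong[OF refl])
  fix p assume p: "p \<in> M"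
  have "\<kappa> p \<noteq> 0" using kappa_nonzero[OF p] domain(1)[OF p] m by blast
  then show "(\<forall>x x1 x2 x3. D p x2 x3 x (endo (vaidya m p) (E p) x1) + D p x3 x1 x (endo (vaidya m p) (E p) x2)
      + D p x1 x2 x (endo (vaidya m p) (E p) x3) = 0) \<longleftrightarrow> block_form (s p / \<kappa> p) (E p)"
    by (rule op_compatible_at_iff[where D = "D p" and s = "s p" and c = "c p", OF p E[OF p] _ D[OF p]])
qed

text \<open>Without the projective term the tensor has the symmetries of R, so both notions of
  compatibility coincide.\<close>

lemma compatible_iff:
  assumes m: "\<forall>u\<in>I. m u \<noteq> 0" and E: "\<And>p. p \<in> M \<Longrightarrow> bilinear (E p)"
    and D: "\<And>p x y z w. p \<in> M \<Longrightarrow> D p x y z w = riem_model (\<kappa> p) (s p)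
      (null_coframe m p x) (null_coframe m p y) (null_coframe m p z) (null_coframe m p w)"
  shows "compatible M (vaidya m) D E \<longleftrightarrow> (\<forall>p\<in>M. block_form (s p / \<kappa> p) (E p))"
proof -
  have "op_compatible M (vaidya m) D E \<longleftrightarrow> compatible M (vaidya m) D E"
    by (rule op_compatible_iff_compatible; unfold D) (rule riem_model_symmetries)+
  moreover have "op_compatible M (vaidya m) D E \<longleftrightarrow> (\<forall>p\<in>M. block_form (s p / \<kappa> p) (E p))"
    by (rule op_compatible_iff[where c = "\<lambda>_. 0", OF m], erule E, simp add: D)
  ultimately show ?thesis by simp
qed

lemma sigma_div_kappa: "p \<in> M \<Longrightarrow> \<sigma> p / \<kappa> p = p $ 2 * deriv m (p $ 1) / m (p $ 1)"
  using domain(4)[of p] by (simp add: field_simps eval_nat_numeral)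

lemma compatible_Riem_iff:
  assumes m: "\<forall>u\<in>I. m u \<noteq> 0" and E: "tensor02_on M E"
  shows "compatible M (vaidya m) (Riem (vaidya m)) E \<longleftrightarrow> RP_form m M E"
    "op_compatible M (vaidya m) (projective (vaidya m)) E \<longleftrightarrow> RP_form m M E"
proof -
  have b: "\<And>p. p \<in> M \<Longrightarrow> bilinear (E p)" using E by (simp add: tensor02_on_def)
  have "compatible M (vaidya m) (Riem (vaidya m)) E \<longleftrightarrow> (\<forall>p\<in>M. block_form (\<sigma> p / \<kappa> p) (E p))"
    by (rule compatible_iff[OF m], erule b, erule Riem_vaidya)
  then show "compatible M (vaidya m) (Riem (vaidya m)) E \<longleftrightarrow> RP_form m M E"
    unfolding RP_form_iff[OF E] using sigma_div_kappa by (metis (no_types, lifting))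
  have "op_compatible M (vaidya m) (projective (vaidya m)) E \<longleftrightarrow> (\<forall>p\<in>M. block_form (\<sigma> p / \<kappa> p) (E p))"
    by (rule op_compatible_iff[OF m], erule b, erule projective_vaidya)
  then show "op_compatible M (vaidya m) (projective (vaidya m)) E \<longleftrightarrow> RP_form m M E"
    unfolding RP_form_iff[OF E] using sigma_div_kappa by (metis (no_types, lifting))
qed

lemma compatible_conharmonic_iff:
  assumes m: "\<forall>u\<in>I. m u \<noteq> 0" and E: "tensor02_on M E"
  shows "compatible M (vaidya m) (conharmonic (vaidya m)) E \<longleftrightarrow> CK_form M E"
    "compatible M (vaidya m) (conformal (vaidya m)) E \<longleftrightarrow> CK_form M E"
proof -
  have b: "\<And>p. p \<in> M \<Longrightarrow> bilinear (E p)" using E by (simp add: tensor02_on_def)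
  have "compatible M (vaidya m) (conharmonic (vaidya m)) E \<longleftrightarrow> (\<forall>p\<in>M. block_form (0 / \<kappa> p) (E p))"
    by (rule compatible_iff[OF m], erule b, erule conharmonic_vaidya[unfolded weyl_model_eq])
  then show "compatible M (vaidya m) (conharmonic (vaidya m)) E \<longleftrightarrow> CK_form M E"
    unfolding CK_form_iff[OF E] by simp
  have "compatible M (vaidya m) (conformal (vaidya m)) E \<longleftrightarrow> (\<forall>p\<in>M. block_form (0 / \<kappa> p) (E p))"
    by (rule compatible_iff[OF m], erule b, erule conformal_weyl_model[unfolded weyl_model_eq])
  then show "compatible M (vaidya m) (conformal (vaidya m)) E \<longleftrightarrow> CK_form M E"
    unfolding CK_form_iff[OF E] by simp
qed

text \<open>The Ricci tensor can only be nonzero in the entry (1, 1), which fits the block shape for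
  every \<open>c\<close>.\<close>

lemma Ric_compatible:
  assumes m: "\<forall>u\<in>I. m u \<noteq> 0"
  shows "compatible M (vaidya m) (Riem (vaidya m)) (Ric (vaidya m))"
    "compatible M (vaidya m) (conformal (vaidya m)) (Ric (vaidya m))"
proof -
  have b: "bilinear (Ric (vaidya m) p)" if "p \<in> M" for p
    using Ric_vaidya[OF that] by (auto simp: bilinear_def algebra_simps add_divide_distrib intro!: linearI)
  have block: "block_form c (Ric (vaidya m) p)" if "p \<in> M" for p c
    using Ric_vaidya[OF that] by (simp add: block_form_def axis_nth_4)
  have "compatible M (vaidya m) (Riem (vaidya m)) (Ric (vaidya m)) \<longleftrightarrow>
      (\<forall>p\<in>M. block_form (\<sigma> p / \<kappa> p) (Ric (vaidya m) p))"
    by (rule compatible_iff[OF m], erule b, erule Riem_vaidya)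
  with block show "compatible M (vaidya m) (Riem (vaidya m)) (Ric (vaidya m))" by blast
  have "compatible M (vaidya m) (conformal (vaidya m)) (Ric (vaidya m)) \<longleftrightarrow>
      (\<forall>p\<in>M. block_form (0 / \<kappa> p) (Ric (vaidya m) p))"
    by (rule compatible_iff[OF m], erule b, erule conformal_weyl_model[unfolded weyl_model_eq])
  with block show "compatible M (vaidya m) (conformal (vaidya m)) (Ric (vaidya m))" by blast
qed

lemma scalar_on_mass:
  shows "scalar_on M (\<lambda>p. m (p $ 1))" "scalar_on M (\<lambda>p. deriv m (p $ 1))" "scalar_on M (\<lambda>p. p $ i)"
proof -
  note o = open_vaidya_domain[OF open_I]
  have "scalar_on M (\<lambda>p. h (p $ 1))" if "scalar_on I h" for h
    using Ck_on_linear_compose[where l = "\<lambda>p. p $ 1" and V = I and h = h, OF o bounded_linear_vec_nth domain(1)]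
      that by (simp add: scalar_on_def)
  then show "scalar_on M (\<lambda>p. m (p $ 1))" "scalar_on M (\<lambda>p. deriv m (p $ 1))"
    using smooth scalar_on_deriv[OF open_I smooth] by blast+
  show "scalar_on M (\<lambda>p. p $ i)"
    unfolding scalar_on_def using Ck_on_linear[OF o bounded_linear_vec_nth] by blast
qed

text \<open>The gradient of u is minus the r coordinate vector, on which \<open>du\<close> vanishes;
  this yields both the null norm of \<eta> and \<open>S^2 = 0\<close>.\<close>

lemma raise_coordinate_1:
  assumes "p \<in> M"
  shows "raise (vaidya m p) (\<lambda>w. c * w $ 1) = vector [0, - c, 0, 0]"
  using domain(2,3)[OF assms] by (intro raise_vaidya_eqI) (simp_all add: vaidya_def)

lemma Ric2_vaidya: "p \<in> M \<Longrightarrow> Ric2 (vaidya m) p x y = 0"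
proof -
  assume p: "p \<in> M"
  have "Ric (vaidya m) p x = (\<lambda>w. 2 * \<sigma> p * x $ 1 * w $ 1)"
    by (simp add: fun_eq_iff Ric_vaidya[OF p])
  then have "endo (vaidya m p) (Ric (vaidya m) p) x = vector [0, - (2 * \<sigma> p * x $ 1), 0, 0]"
    unfolding endo_def by (simp only: raise_coordinate_1[OF p])
  then show ?thesis by (simp add: Ric2_def Ric_vaidya[OF p])
qed

end

theorem theorem4p1:
  fixes m :: "real \<Rightarrow> real" and I :: "real set"
    and M :: "(real^4) set" and g :: "real^4 \<Rightarrow> 4 form2"
    and R P K W C :: "real^4 \<Rightarrow> 4 form4" and S :: "real^4 \<Rightarrow> 4 form2"
    and \<eta> \<omega> :: "real^4 \<Rightarrow> 4 form1" and \<beta> :: "real^4 \<Rightarrow> real"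
  assumes I: "open I" "is_interval I" "I \<noteq> {}"
    and m_smooth: "scalar_on I m"
    and m_noninc: "antimono_on I m"
    and m_nonzero: "\<forall>u\<in>I. m u \<noteq> 0"
    and M_def: "M = vaidya_domain I" and g_def: "g = vaidya m"
    and R_def: "R = Riem g" and S_def: "S = Ric g"
    and P_def: "P = projective g" and K_def: "K = conharmonic g"
    and W_def: "W = concircular g" and C_def: "C = conformal g"
    and \<omega>_def: "\<omega> = (\<lambda>p x. deriv m (p $ 1) / m (p $ 1) * x $ 1)"
    and \<beta>_def: "\<beta> = (\<lambda>p. 2 * deriv m (p $ 1))"
    and \<eta>_def: "\<eta> = (\<lambda>p x. 1 / p $ 2 * x $ 1)"
  shows
    "((\<not> m constant_on I \<longrightarrow> \<not> ricci_flat M g \<and> \<not> ricci_symmetric M g) \<and>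
      (\<forall>p\<in>M. scal g p = 0) \<and> (\<forall>p\<in>M. R p = W p) \<and> (\<forall>p\<in>M. C p = K p))
     \<and>
     (\<not> conformally_semisymmetric M g \<and>
      (\<not> m constant_on I \<longrightarrow> \<not> deszcz_pseudosymmetric M g) \<and>
      (\<forall>p\<in>M. \<forall>x1 x2 x3 x4 x y.
         curv_act (g p) (C p) (C p) x1 x2 x3 x4 x y
         = m (p $ 1) / (p $ 2)^3 * tachibana (g p) (C p) x1 x2 x3 x4 x y))
     \<and>
     (\<not> ricci_generalized_pseudosymmetric M g \<and>
      (\<not> m constant_on I \<longrightarrow> \<not> weyl_pseudosymmetric M g) \<and>
      (\<forall>p\<in>M. \<forall>x1 x2 x3 x4 x y.
         curv_act (g p) (R p) (R p) x1 x2 x3 x4 x y - tachibana (S p) (R p) x1 x2 x3 x4 x y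
         = m (p $ 1) / (p $ 2)^3 * tachibana (g p) (C p) x1 x2 x3 x4 x y) \<and>
      (\<forall>p\<in>M. \<forall>x1 x2 x3 x4 x y.
         curv_act (g p) (R p) (C p) x1 x2 x3 x4 x y + curv_act (g p) (C p) (R p) x1 x2 x3 x4 x y
         = 2 * m (p $ 1) / (p $ 2)^3 * tachibana (g p) (C p) x1 x2 x3 x4 x y
           + tachibana (S p) (C p) x1 x2 x3 x4 x y))
     \<and>
     (\<not> conformally_recurrent M g \<and> \<not> curv_2forms_recurrent M g R \<and>
      (\<not> m constant_on I \<longrightarrow> \<not> ricci_1forms_recurrent M g) \<and>
      curv_2forms_recurrent_for M g C \<omega> \<and>
      (\<not> m constant_on I \<longrightarrow> curv_2forms_recurrent M g C))
     \<and>
     ((\<not> m constant_on I \<longrightarrow> \<not> einstein M g) \<and>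
      ricci_simple_for M g \<beta> \<eta> \<and> (\<forall>p\<in>M. form_norm (g p) (\<eta> p) = 0) \<and>
      (\<forall>p\<in>M. \<forall>x1 x2 x3 x4. kulkarni_nomizu (S p) (S p) x1 x2 x3 x4 = 0) \<and>
      (\<forall>p\<in>M. \<forall>x y. Ric2 g p x y = 0))
     \<and>
     ((\<not> m constant_on I \<longrightarrow> \<not> ricci_cyclic_parallel M g \<and> \<not> ricci_codazzi M g) \<and>
      compatible M g R S \<and> compatible M g C S)
     \<and>
     (\<forall>E. tensor02_on M E \<longrightarrow>
        (compatible M g R E \<longleftrightarrow> RP_form m M E) \<and> (op_compatible M g P E \<longleftrightarrow> RP_form m M E))
     \<and>
     (\<forall>E. tensor02_on M E \<longrightarrow>
        (compatible M g C E \<longleftrightarrow> CK_form M E) \<and> (compatible M g K E \<longleftrightarrow> CK_form M E))"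
proof -
  interpret vaidya_mass m I
    using I(1) m_smooth by unfold_locales
  note o = open_vaidya_domain[OF I(1)]
  obtain u0 where "u0 \<in> I" using I(3) by blast
  then obtain p0 where p0: "p0 \<in> M" "m (p0 $ 1) \<noteq> 0"
    using ex_domain_point m_nonzero unfolding M_def by metis
  \<comment> \<open>Every claim conditional on nonconstancy of \<open>m\<close> is decided at one
    such point.\<close>
  have nc: "\<exists>p\<in>M. m (p $ 1) \<noteq> 0 \<and> deriv m (p $ 1) \<noteq> 0" if "\<not> m constant_on I"
    using exists_deriv_nonzero[OF I(1,2) m_smooth that] ex_domain_point m_nonzero unfolding M_def by metis
  have \<omega>: "one_form_on M \<omega>"
    unfolding \<omega>_def M_def
    using m_nonzero domain(1)
    by (intro one_form_on_component[OF o] scalar_on_divide[OF o] scalar_on_mass) auto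
  have C: "curv_2forms_recurrent_for M g C \<omega>"
    unfolding curv_2forms_recurrent_for_def
    using \<omega> cyclic_nabla4_conformal m_nonzero domain(1) unfolding M_def g_def C_def \<omega>_def by blast
  have \<eta>: "one_form_on M \<eta>"
    unfolding \<eta>_def M_def
    using domain(4)
    by (intro one_form_on_component[OF o] scalar_on_divide[OF o] scalar_on_mass scalar_on_const) auto
  have \<beta>: "scalar_on M \<beta>"
    unfolding \<beta>_def M_def by (intro scalar_on_mult[OF o] scalar_on_mass scalar_on_const)
  have i: "(\<not> m constant_on I \<longrightarrow> \<not> ricci_flat M g \<and> \<not> ricci_symmetric M g) \<and>
      (\<forall>p\<in>M. scal g p = 0) \<and> (\<forall>p\<in>M. R p = W p) \<and> (\<forall>p\<in>M. C p = K p)"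
    using nc ricci_conditions_fail scal_vaidya concircular_vaidya conformal_vaidya
    unfolding M_def g_def R_def W_def C_def K_def by metis
  have ii: "\<not> conformally_semisymmetric M g \<and>
      (\<not> m constant_on I \<longrightarrow> \<not> deszcz_pseudosymmetric M g) \<and>
      (\<forall>p\<in>M. \<forall>x1 x2 x3 x4 x y.
         curv_act (g p) (C p) (C p) x1 x2 x3 x4 x y
         = m (p $ 1) / (p $ 2)^3 * tachibana (g p) (C p) x1 x2 x3 x4 x y)"
    using p0 nc not_conformally_semisymmetric not_deszcz_pseudosymmetric pseudosymmetry_identities(1)
    unfolding M_def g_def C_def by blast
  have iii: "\<not> ricci_generalized_pseudosymmetric M g \<and>
      (\<not> m constant_on I \<longrightarrow> \<not> weyl_pseudosymmetric M g) \<and>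
      (\<forall>p\<in>M. \<forall>x1 x2 x3 x4 x y.
         curv_act (g p) (R p) (R p) x1 x2 x3 x4 x y - tachibana (S p) (R p) x1 x2 x3 x4 x y
         = m (p $ 1) / (p $ 2)^3 * tachibana (g p) (C p) x1 x2 x3 x4 x y) \<and>
      (\<forall>p\<in>M. \<forall>x1 x2 x3 x4 x y.
         curv_act (g p) (R p) (C p) x1 x2 x3 x4 x y + curv_act (g p) (C p) (R p) x1 x2 x3 x4 x y
         = 2 * m (p $ 1) / (p $ 2)^3 * tachibana (g p) (C p) x1 x2 x3 x4 x y
           + tachibana (S p) (C p) x1 x2 x3 x4 x y)"
    using p0 nc not_ricci_generalized_pseudosymmetric not_weyl_pseudosymmetric pseudosymmetry_identities(2,3)
    unfolding M_def g_def C_def R_def S_def by blast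
  have \<omega>_nonzero: "curv_2forms_recurrent M g C" if nonconst: "\<not> m constant_on I"
  proof -
    \<comment> \<open>The recurrence form must be nonzero somewhere, and \<open>m' / m du\<close> is
      nonzero wherever m' is.\<close>
    from nc[OF nonconst] obtain p where "p \<in> M" "m (p $ 1) \<noteq> 0" "deriv m (p $ 1) \<noteq> 0" by blast
    then have "\<omega> p (axis 1 1) \<noteq> 0" by (simp add: \<omega>_def axis_nth_4)
    with C \<open>p \<in> M\<close> show ?thesis unfolding curv_2forms_recurrent_def by blast
  qed
  have iv: "\<not> conformally_recurrent M g \<and> \<not> curv_2forms_recurrent M g R \<and>
      (\<not> m constant_on I \<longrightarrow> \<not> ricci_1forms_recurrent M g) \<and>
      curv_2forms_recurrent_for M g C \<omega> \<and>
      (\<not> m constant_on I \<longrightarrow> curv_2forms_recurrent M g C)"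
    using C \<omega>_nonzero p0 nc not_conformally_recurrent not_curv_2forms_recurrent_Riem[OF m_nonzero] ricci_conditions_fail(6)
    unfolding M_def g_def R_def by blast
  have simple: "ricci_simple_for M g \<beta> \<eta>"
    using \<beta> \<eta> Ric_vaidya unfolding ricci_simple_for_def M_def g_def \<beta>_def \<eta>_def
    by (simp add: power2_eq_square)
  have norm: "form_norm (g p) (\<eta> p) = 0" if "p \<in> M" for p
    using raise_coordinate_1[of p "1 / p $ 2"] that unfolding form_norm_def M_def g_def \<eta>_def by simp
  have v: "(\<not> m constant_on I \<longrightarrow> \<not> einstein M g) \<and>
      ricci_simple_for M g \<beta> \<eta> \<and> (\<forall>p\<in>M. form_norm (g p) (\<eta> p) = 0) \<and>
      (\<forall>p\<in>M. \<forall>x1 x2 x3 x4. kulkarni_nomizu (S p) (S p) x1 x2 x3 x4 = 0) \<and>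
      (\<forall>p\<in>M. \<forall>x y. Ric2 g p x y = 0)"
    using simple norm nc ricci_conditions_fail(3) Ric2_vaidya Ric_vaidya
    unfolding M_def g_def S_def by (auto simp: kulkarni_nomizu_def)
  have vi: "(\<not> m constant_on I \<longrightarrow> \<not> ricci_cyclic_parallel M g \<and> \<not> ricci_codazzi M g) \<and>
      compatible M g R S \<and> compatible M g C S"
    using nc ricci_conditions_fail(4,5) Ric_compatible[OF m_nonzero]
    unfolding M_def g_def S_def C_def R_def by blast
  have vii: "\<forall>E. tensor02_on M E \<longrightarrow>
        (compatible M g R E \<longleftrightarrow> RP_form m M E) \<and> (op_compatible M g P E \<longleftrightarrow> RP_form m M E)"
    using compatible_Riem_iff[OF m_nonzero] unfolding M_def g_def R_def P_def by blast
  have viii: "\<forall>E. tensor02_on M E \<longrightarrow>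
        (compatible M g C E \<longleftrightarrow> CK_form M E) \<and> (compatible M g K E \<longleftrightarrow> CK_form M E)"
    using compatible_conharmonic_iff[OF m_nonzero] unfolding M_def g_def C_def K_def by blast
  show ?thesis
    by (rule conjI[OF i conjI[OF ii conjI[OF iii conjI[OF iv conjI[OF v conjI[OF vi conjI[OF vii viii]]]]]]])
qed

end
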